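(* Let $D$ be a tangle diagram. Then $D$ can be transformed into an OU tangle diagram by a finite sequence of glide moves if and only if $D$ is acyclic. In that case the resulting OU tangle diagram, denoted $\Gamma(D)$, is uniquely determined by $D$ (it does not depend on the choice of glide moves leading to it).
   Context: A tangle diagram is an oriented tangle diagram drawn in a disk, all of whose components (strands) are oriented intervals with endpoints on the boundary of the disk (no closed components); diagrams are considered up to planar isotopy. At each crossing one passage is "over" (O) and the other is "under" (U). OU: a tangle diagram is OU (Over-then-Under) if every strand, traversed along its orientation, goes through all of its over passages before any of its under passages. Glide move: suppose that along some strand two consecutive passages (with no passage between them) are first an under passage at a crossing $x_1$ (with over strand "strand 1") and then an over passage at a crossing $x_2\neq x_1$ (with under strand "strand 2"). Call the short piece of strand containing these two passages "3". The glide move pushes strand 1 forward along and over 3, past strand 2, and pushes strand 2 backward along and under 3, so that afterwards 3 first passes over strand 2 and then passes under strand 1, and strand 1 passes over strand 2 in two new crossings, one on each side of 3. Combinatorially: let $s_1,s_2\in\{\pm1\}$ be the signs of $x_1,x_2$; let $i_1$ be the position of the over passage of $x_1$, $j_1$ the position of its under passage, $i_2$ the position of the over passage of $x_2$ and $j_2$ the position of its under passage, so $i_2$ immediately follows $j_1$. Writing $X_s[a,b]$ for a crossing of sign $s$ with over passage at position $a$ and under passage at position $b$, the glide move replaces $X_{s_1}[i_1,j_1],\,X_{s_2}[i_2,j_2]$ by $$X_{s_2}[j_1,j_2],\quad X_{s_1}[i_1,i_2],\quad X_{s_1s_2}[i_1-\tfrac{s_1}{3},\,j_2+\tfrac{s_2}{3}],\quad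 X_{-s_1s_2}[i_1+\tfrac{s_1}{3},\,j_2-\tfrac{s_2}{3}],$$ where positions on a strand are numbered by consecutive integers in the order of traversal and $\pm\tfrac13$ means "immediately after/before". The strands involved need not be distinct, but $x_1\ne x_2$ is required. The part of the diagram away from a neighbourhood of the piece 3 is unchanged. Acyclic: a cascade path in $D$ is a directed path that travels along strands of $D$ consistently with their orientation, except that at a crossing it may (but need not) drop from the over strand to the under strand and then continue along the orientation of the under strand; it may never go from the under strand to the over strand. $D$ is acyclic if it has no closed cascade path. *)

theory Defs
  imports Complex_Main
begin

text \<open>
  Tangle diagrams up to planar isotopy are encoded by signed Gauss data with planarity: the
  strands are numbered \<open>0, \<dots>, n - 1\<close>, the passages of strand \<open>k\<close> in the order of traversal have
  the positions \<open>(k, 0), (k, 1), \<dots>\<close>, and \<open>Crossing s a b\<close> is a crossing of sign \<open>s\<close> with over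
  passage at position \<open>a\<close> and under passage at position \<open>b\<close>.  The crossings carry no names, so
  that equality of these data is planar isotopy (fixing the boundary of the disk).
\<close>

datatype 'p crossing = Crossing (sign: int) (over: 'p) (under: 'p)

datatype endpoint = Start nat | End nat

text \<open>The boundary lists the endpoints of the strands counterclockwise along the boundary circle
  of the disk, from a base point on that circle.\<close>

datatype diagram = Diagram
  (strands: nat)
  (boundary: "endpoint list")
  (crossings: "(nat \<times> nat) crossing set")

definition positions :: "'p crossing set \<Rightarrow> 'p set" where
  "positions X = over ` X \<union> under ` X"

definition passages :: "diagram \<Rightarrow> nat \<Rightarrow> nat" where
  "passages D k = card {i. (k, i) \<in> positions (crossings D)}"

definition gauss_diagram :: "diagram \<Rightarrow> bool" where
  "gauss_diagram D \<longleftrightarrow>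
     finite (crossings D) \<and>
     sign ` crossings D \<subseteq> {1, -1} \<and>
     inj_on over (crossings D) \<and>
     inj_on under (crossings D) \<and>
     over ` crossings D \<inter> under ` crossings D = {} \<and>
     positions (crossings D) = {(k, i). k < strands D \<and> i < passages D k} \<and>
     distinct (boundary D) \<and>
     set (boundary D) = Start ` {..<strands D} \<union> End ` {..<strands D}"


text \<open>
  The arc \<open>(k, a)\<close> is the part of strand \<open>k\<close> between its passages \<open>a - 1\<close> and \<open>a\<close>; the arc
  \<open>(k, 0)\<close> begins at the start of the strand and the arc \<open>(k, passages D k)\<close> ends at its end.
  A side is an arc with a direction of travel, which is that of the strand or its opposite; it
  stands for the border of the region that lies to the left of the traveller.
\<close>

datatype side = Along nat nat | Against nat nat

fun reverse_side :: "side \<Rightarrow> side" where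
  "reverse_side (Along k a) = Against k a"
| "reverse_side (Against k a) = Along k a"

definition sides :: "diagram \<Rightarrow> side set" where
  "sides D = (\<Union>k<strands D. \<Union>a\<le>passages D k. {Along k a, Against k a})"

text \<open>The four sides leaving a crossing, in counterclockwise order.  At a positive crossing the
  over direction is rotated counterclockwise (by less than a half turn) to the under direction.\<close>

fun crossing_star :: "(nat \<times> nat) crossing \<Rightarrow> side list" where
  "crossing_star (Crossing s (k, i) (l, j)) =
     (if s = 1
      then [Along k (i + 1), Along l (j + 1), Against k i, Against l j]
      else [Along k (i + 1), Against l j, Against k i, Along l (j + 1)])"

fun endpoint_side :: "diagram \<Rightarrow> endpoint \<Rightarrow> side" where
  "endpoint_side D (Start k) = Along k 0"
| "endpoint_side D (End k) = Against k (passages D k)"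

text \<open>The exterior of the disk is contracted to one further vertex; seen from there, the
  counterclockwise order of the endpoints is the reverse of the one along the circle.\<close>

definition stars :: "diagram \<Rightarrow> side list set" where
  "stars D = insert (rev (map (endpoint_side D) (boundary D))) (crossing_star ` crossings D)"

text \<open>Following the border of a region on the left: arriving at a vertex along \<open>d\<close>, one leaves by
  the sharpest left turn, which is the side clockwise next to \<open>reverse_side d\<close>.  Arriving at an
  endpoint, one thereby follows the boundary circle counterclockwise to the next endpoint.\<close>

definition left_turn :: "diagram \<Rightarrow> (side \<times> side) set" where
  "left_turn D = {(d, d'). \<exists>v\<in>stars D. \<exists>m<length v.
     d' = v ! m \<and> reverse_side d = v ! ((m + 1) mod length v)}"

text \<open>The regions are the cycles of the permutation \<open>left_turn D\<close> of \<open>sides D\<close>.\<close>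

definition regions :: "diagram \<Rightarrow> side set set" where
  "regions D = sides D // (left_turn D)\<^sup>*"

text \<open>
  Gauss data can be drawn in a disk iff the surface glued from the regions is a sphere.
  All components being intervals, the graph formed by the boundary circle and the strands
  is connected as soon as there is a strand.  With \<open>c\<close> crossings and \<open>n\<close> strands it has
  \<open>c + 2 * n\<close> vertices and \<open>2 * c + 3 * n\<close> edges, and its faces are the regions and the exterior
  of the disk, so that Euler's formula is the equation below.  Without strands there is only the
  empty diagram.
\<close>

definition tangle_diagram :: "diagram \<Rightarrow> bool" where
  "tangle_diagram D \<longleftrightarrow> gauss_diagram D \<and>
     (strands D = 0 \<or> card (regions D) = card (crossings D) + strands D + 1)"


definition OU :: "diagram \<Rightarrow> bool" where
  "OU D \<longleftrightarrow> (\<forall>k i j. (k, i) \<in> over ` crossings D \<longrightarrow> (k, j) \<in> under ` crossings D \<longrightarrow> i < j)"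


text \<open>Consecutive integer positions for crossings given with rational positions.\<close>

definition rank :: "(nat \<times> rat) set \<Rightarrow> nat \<times> rat \<Rightarrow> nat \<times> nat" where
  "rank P p = (fst p, card {q. (fst p, q) \<in> P \<and> q < snd p})"

definition renumber :: "(nat \<times> rat) crossing set \<Rightarrow> (nat \<times> nat) crossing set" where
  "renumber X = map_crossing (rank (positions X)) ` X"

definition rational_position :: "nat \<times> nat \<Rightarrow> nat \<times> rat" where
  "rational_position p = (fst p, of_nat (snd p))"

text \<open>The rational position \<open>p + t / 3\<close>.\<close>

definition shift :: "nat \<times> nat \<Rightarrow> int \<Rightarrow> nat \<times> rat" where
  "shift p t = (fst p, of_nat (snd p) + of_int t / 3)"

definition glide_crossings ::
  "(nat \<times> nat) crossing set \<Rightarrow> (nat \<times> nat) crossing \<Rightarrow> (nat \<times> nat) crossing \<Rightarrow>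
   (nat \<times> rat) crossing set" where
  "glide_crossings X x1 x2 =
     (let s1 = sign x1; i1 = over x1; j1 = under x1;
          s2 = sign x2; i2 = over x2; j2 = under x2
      in map_crossing rational_position `
           (X - {x1, x2} \<union> {Crossing s2 j1 j2, Crossing s1 i1 i2}) \<union>
         {Crossing (s1 * s2) (shift i1 (- s1)) (shift j2 s2),
          Crossing (- (s1 * s2)) (shift i1 s1) (shift j2 (- s2))})"

definition glide :: "diagram \<Rightarrow> diagram \<Rightarrow> bool" where
  "glide D E \<longleftrightarrow>
     (\<exists>x1\<in>crossings D. \<exists>x2\<in>crossings D.
        x1 \<noteq> x2 \<and>
        over x2 = (fst (under x1), snd (under x1) + 1) \<and>
        E = Diagram (strands D) (boundary D) (renumber (glide_crossings (crossings D) x1 x2)))"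


text \<open>A cascade path is a sequence of consecutive arcs: at the end of an arc one stays on the strand or, at an over
  passage, drops to the arc that leaves the crossing along the under strand.\<close>

definition cascade :: "diagram \<Rightarrow> ((nat \<times> nat) \<times> (nat \<times> nat)) set" where
  "cascade D =
     {((k, i), (k, i + 1)) | k i. (k, i) \<in> positions (crossings D)} \<union>
     {((k, i), (l, j + 1)) | s k i l j. Crossing s (k, i) (l, j) \<in> crossings D}"

definition acyclic_diagram :: "diagram \<Rightarrow> bool" where
  "acyclic_diagram D \<longleftrightarrow> acyclic (cascade D)"

end

(*
  A diagram is encoded by Gauss words, in which a glide move becomes a substitution of tokens.
  For crossings c, d let c -> d if the under passage of c precedes the over passage of d on some
  strand.  A diagram is acyclic iff this relation is acyclic, and OU iff it is empty; a glide move at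
  (x1, x2) deletes the edge x1 -> x2 and adds two crossings with the predecessors of x1 and
  the successors of x2, so that acyclicity does not change in either direction.  For an acyclic
  diagram the sum over all chains c1 -> ... -> cr of 2 ^ (r - 1) is invariant while the number of
  crossings grows by 2, so that glide moves terminate.  Uniqueness is Newman's lemma: two glide moves
  without a common crossing commute, and two glide moves at x1 -> x2 -> x3 are joined by three
  further moves on each side, since the composed substitutions agree on every token.  A glide move
  adds two crossings and exactly two regions (triangles), hence preserves planarity.
*)

theory Submission
  imports Defs "HOL-Library.Sublist"
begin

section \<open>Gauss words\<close>

text \<open>Positions shift with every move, which makes composed moves hard to compare. Named
  crossings avoid this: a substitution acts on each token by itself, and a diagram forgets the
  names, so that the names of new crossings can be chosen to suit when two moves are joined. The
  weight 2 ^ (r - 1) balances the two new crossings: a chain of r crossings through the edge x1 ->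
  x2 disappears, and two chains of r - 1 crossings replace it, in which one of the new crossings
  stands for the pair x1, x2. Acyclicity enters beyond termination. Two moves at x1 -> x2 and x2 ->
  x1 would overlap in both crossings, which is a cycle; and an adjacent pair of an under and an over
  passage is a site of a move only if it belongs to two different crossings. The strands of a move
  may coincide, and an arc leaving the picture may return to it. The count of regions therefore
  assumes nothing about the outer sides being distinct, and treats the picture with abstract sides
  named by compass directions, which do not depend on the signs.\<close>

datatype token = Over nat | Under nat

definition expand :: "(token \<Rightarrow> token list) \<Rightarrow> token list \<Rightarrow> token list" where
  "expand \<sigma> w = concat (map \<sigma> w)"

lemma expand_simps [simp]:
  "expand \<sigma> [] = []"
  "expand \<sigma> (t # w) = \<sigma> t @ expand \<sigma> w"
  "expand \<sigma> (u @ v) = expand \<sigma> u @ expand \<sigma> v"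
  by (simp_all add: expand_def)

lemma set_expand: "set (expand \<sigma> w) = (\<Union>t\<in>set w. set (\<sigma> t))"
  by (simp add: expand_def)

lemma concat_map_expand: "concat (map (expand \<sigma>) Ws) = expand \<sigma> (concat Ws)"
  by (induction Ws) auto

lemma expand_cong: "(\<And>t. t \<in> set w \<Longrightarrow> \<sigma> t = \<tau> t) \<Longrightarrow> expand \<sigma> w = expand \<tau> w"
  by (induction w) auto

lemma expand_expand: "expand \<tau> (expand \<sigma> w) = expand (\<lambda>t. expand \<tau> (\<sigma> t)) w"
  by (induction w) auto

lemma distinct_expand:
  assumes "distinct w" "\<And>t. t \<in> set w \<Longrightarrow> distinct (\<sigma> t)"
    and "\<And>t t'. t \<in> set w \<Longrightarrow> t' \<in> set w \<Longrightarrow> t \<noteq> t' \<Longrightarrow> set (\<sigma> t) \<inter> set (\<sigma> t') = {}"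
  shows "distinct (expand \<sigma> w)"
  using assms
proof (induction w)
  case (Cons t w)
  have "set (\<sigma> t) \<inter> set (expand \<sigma> w) = {}"
    using Cons.prems(1) Cons.prems(3)[of t] by (fastforce simp: set_expand)
  moreover have "distinct (expand \<sigma> w)"
    using Cons.prems by (intro Cons.IH) auto
  ultimately show ?case using Cons.prems(2)[of t] by simp
qed auto

lemma sublist_expand: "sublist u w \<Longrightarrow> sublist (expand \<sigma> u) (expand \<sigma> w)"
  unfolding sublist_def by (metis expand_simps(3))

primrec before :: "token list \<Rightarrow> token \<Rightarrow> token \<Rightarrow> bool" where
  "before [] p q = False"
| "before (t # w) p q = (p = t \<and> q \<in> set w \<or> before w p q)"

lemma before_append:
  "before (u @ v) p q \<longleftrightarrow> before u p q \<or> before v p q \<or> p \<in> set u \<and> q \<in> set v"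
  by (induction u) auto

lemma before_set: "before w p q \<Longrightarrow> p \<in> set w \<and> q \<in> set w"
  by (induction w) auto

lemma before_expand:
  "before (expand \<sigma> w) p q \<longleftrightarrow>
     (\<exists>t t'. before w t t' \<and> p \<in> set (\<sigma> t) \<and> q \<in> set (\<sigma> t')) \<or> (\<exists>t\<in>set w. before (\<sigma> t) p q)"
  by (induction w) (auto simp: before_append set_expand)

lemma before_irrefl: "distinct w \<Longrightarrow> \<not> before w p p"
  by (induction w) (auto dest: before_set)

lemma before_adjacent:
  assumes "distinct w" "sublist [p, q] w"
  shows "before w x q \<longleftrightarrow> x = p \<or> before w x p"
  using assms by (auto simp: sublist_def before_append dest: before_set)

lemma before_nth:
  "before w p q \<longleftrightarrow> (\<exists>i j. i < j \<and> j < length w \<and> w ! i = p \<and> w ! j = q)"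
proof (induction w)
  case (Cons t w)
  show ?case
  proof
    assume "before (t # w) p q"
    then consider "p = t" "q \<in> set w" | "before w p q" by auto
    then show "\<exists>i j. i < j \<and> j < length (t # w) \<and> (t # w) ! i = p \<and> (t # w) ! j = q"
    proof cases
      case 1
      then obtain j where "j < length w" "w ! j = q" by (auto simp: in_set_conv_nth)
      with 1 show ?thesis by (intro exI[of _ 0] exI[of _ "Suc j"]) auto
    next
      case 2
      then obtain i j where "i < j" "j < length w" "w ! i = p" "w ! j = q" using Cons by auto
      then show ?thesis by (intro exI[of _ "Suc i"] exI[of _ "Suc j"]) auto
    qed
  next
    assume "\<exists>i j. i < j \<and> j < length (t # w) \<and> (t # w) ! i = p \<and> (t # w) ! j = q"
    then obtain i j where *: "i < j" "j < length (t # w)" "(t # w) ! i = p" "(t # w) ! j = q"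
      by blast
    then obtain j' where j': "j = Suc j'" by (cases j) auto
    show "before (t # w) p q"
    proof (cases i)
      case 0
      then show ?thesis using * j' by auto
    next
      case (Suc i')
      then show ?thesis using * j' Cons by auto
    qed
  qed
qed auto

text \<open>A glide move along the piece with the passages \<open>Under a\<close> and \<open>Over b\<close> as a substitution: the
  tokens are unique, so that moving \<open>Over b\<close> into the image of \<open>Under a\<close> exchanges the two passages.
  The crossings \<open>y\<close> and \<open>z\<close> are the new ones, of sign \<open>s a * s b\<close> and \<open>- (s a * s b)\<close>.\<close>

definition glide_token ::
  "(nat \<Rightarrow> int) \<Rightarrow> nat \<Rightarrow> nat \<Rightarrow> nat \<Rightarrow> nat \<Rightarrow> token \<Rightarrow> token list" where
  "glide_token s a b y z t =
     (if t = Under a then [Over b, Under a]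
      else if t = Over b then []
      else if t = Over a then (if s a = 1 then [Over y, Over a, Over z] else [Over z, Over a, Over y])
      else if t = Under b then (if s b = 1 then [Under z, Under b, Under y] else [Under y, Under b, Under z])
      else [t])"

definition glide_sign :: "(nat \<Rightarrow> int) \<Rightarrow> nat \<Rightarrow> nat \<Rightarrow> nat \<Rightarrow> nat \<Rightarrow> nat \<Rightarrow> int" where
  "glide_sign s a b y z = s(y := s a * s b, z := - (s a * s b))"

definition glide_words ::
  "(nat \<Rightarrow> int) \<Rightarrow> nat \<Rightarrow> nat \<Rightarrow> nat \<Rightarrow> nat \<Rightarrow> token list list \<Rightarrow> token list list" where
  "glide_words s a b y z Ws = map (expand (glide_token s a b y z)) Ws"

definition names :: "token list list \<Rightarrow> nat set" where
  "names Ws = {c. Over c \<in> set (concat Ws)}"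

text \<open>Every number has a sign, whether or not it names a crossing, so that signs can be looked
  up without a membership condition.\<close>

definition gauss_word :: "(nat \<Rightarrow> int) \<Rightarrow> token list list \<Rightarrow> bool" where
  "gauss_word s Ws \<longleftrightarrow> distinct (concat Ws) \<and>
     (\<forall>c. Under c \<in> set (concat Ws) \<longleftrightarrow> Over c \<in> set (concat Ws)) \<and> (\<forall>c. s c = 1 \<or> s c = -1)"

definition redex :: "token list list \<Rightarrow> nat \<Rightarrow> nat \<Rightarrow> bool" where
  "redex Ws a b \<longleftrightarrow> a \<noteq> b \<and> (\<exists>w\<in>set Ws. sublist [Under a, Over b] w)"

text \<open>The relation c -> d of the overview. It contains (c, c) if a strand passes under and
  later over at the same crossing.\<close>

definition chain :: "token list list \<Rightarrow> (nat \<times> nat) set" where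
  "chain Ws = {(c, d). \<exists>w\<in>set Ws. before w (Under c) (Over d)}"

definition fresh :: "nat \<Rightarrow> nat \<Rightarrow> token list list \<Rightarrow> bool" where
  "fresh y z Ws \<longleftrightarrow> y \<noteq> z \<and> y \<notin> names Ws \<and> z \<notin> names Ws"

lemma finite_names [simp]: "finite (names Ws)"
proof -
  have "Over ` names Ws \<subseteq> set (concat Ws)" by (auto simp: names_def)
  then have "finite (Over ` names Ws)" by (rule finite_subset) simp
  then show ?thesis by (rule finite_imageD) (simp add: inj_on_def)
qed

lemma Over_in_names: "w \<in> set Ws \<Longrightarrow> Over c \<in> set w \<Longrightarrow> c \<in> names Ws"
  by (auto simp: names_def)

lemma Under_in_names: "gauss_word s Ws \<Longrightarrow> w \<in> set Ws \<Longrightarrow> Under c \<in> set w \<Longrightarrow> c \<in> names Ws"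
  by (auto simp: names_def gauss_word_def)

lemma set_gauss_word: "gauss_word s Ws \<Longrightarrow> set (concat Ws) = Over ` names Ws \<union> Under ` names Ws"
proof (intro set_eqI iffI)
  fix t assume "gauss_word s Ws" "t \<in> set (concat Ws)"
  then show "t \<in> Over ` names Ws \<union> Under ` names Ws"
    by (cases t) (auto simp: names_def gauss_word_def)
qed (auto simp: names_def gauss_word_def)

lemma redexD:
  assumes "gauss_word s Ws" "redex Ws a b"
  shows "a \<noteq> b" "a \<in> names Ws" "b \<in> names Ws" "(a, b) \<in> chain Ws"
proof -
  obtain w where w: "w \<in> set Ws" "sublist [Under a, Over b] w" "a \<noteq> b"
    using assms(2) by (auto simp: redex_def)
  then have "Under a \<in> set w" "Over b \<in> set w" "before w (Under a) (Over b)"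
    by (auto simp: sublist_def before_append)
  then show "a \<noteq> b" "a \<in> names Ws" "b \<in> names Ws" "(a, b) \<in> chain Ws"
    using w Under_in_names[OF assms(1)] Over_in_names by (auto simp: chain_def)
qed

lemma chain_names: "gauss_word s Ws \<Longrightarrow> chain Ws \<subseteq> names Ws \<times> names Ws"
  by (auto simp: chain_def dest!: before_set intro: Under_in_names Over_in_names)

lemma sign_cases: "gauss_word s Ws \<Longrightarrow> s c = 1 \<or> s c = -1"
  unfolding gauss_word_def by blast

lemma same_word:
  assumes "distinct (concat Ws)" "w \<in> set Ws" "w' \<in> set Ws" "t \<in> set w" "t \<in> set w'"
  shows "w = w'"
  using assms by (induction Ws) auto

lemma distinct_word: "distinct (concat Ws) \<Longrightarrow> w \<in> set Ws \<Longrightarrow> distinct w"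
  by (induction Ws) auto

context
  fixes s Ws a b y z
  assumes g: "gauss_word s Ws" and r: "redex Ws a b" and f: "fresh y z Ws"
begin

text \<open>Each passage of the new words stems from a unique old token, computed here. The
  exception for \<open>b\<close> reflects that \<open>Over b\<close> is written into the image of
  \<open>Under a\<close>. Distinctness, names and chains after a move all follow from this and its
  counterpart for under passages.\<close>

lemma glide_token_Over:
  "t \<in> set (concat Ws) \<Longrightarrow> Over q \<in> set (glide_token s a b y z t) \<longleftrightarrow>
     (if q = b then t = Under a else t = Over (if q \<in> {y, z} then a else q))"
  using redexD[OF g r] f set_gauss_word[OF g]
  by (auto simp: glide_token_def fresh_def split: if_splits)

lemma glide_token_Under:
  "t \<in> set (concat Ws) \<Longrightarrow> Under q \<in> set (glide_token s a b y z t) \<longleftrightarrow>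
     t = Under (if q \<in> {y, z} then b else q)"
  using redexD[OF g r] f set_gauss_word[OF g]
  by (auto simp: glide_token_def fresh_def split: if_splits)

lemma names_glide_words: "names (glide_words s a b y z Ws) = names Ws \<union> {y, z}"
proof -
  have "Over q \<in> set (concat (glide_words s a b y z Ws)) \<longleftrightarrow> q \<in> names Ws \<union> {y, z}" for q
  proof -
    have "Over q \<in> set (concat (glide_words s a b y z Ws)) \<longleftrightarrow>
        (\<exists>t\<in>set (concat Ws). Over q \<in> set (glide_token s a b y z t))"
      unfolding glide_words_def concat_map_expand set_expand by blast
    also have "\<dots> \<longleftrightarrow>
        (\<exists>t\<in>set (concat Ws). if q = b then t = Under a else t = Over (if q \<in> {y, z} then a else q))"
      using glide_token_Over by (intro bex_cong) auto
    also have "\<dots> \<longleftrightarrow> q \<in> names Ws \<union> {y, z}"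
      unfolding set_gauss_word[OF g] using redexD[OF g r] by auto
    finally show ?thesis .
  qed
  then show ?thesis by (auto simp: names_def)
qed

lemma gauss_word_glide: "gauss_word (glide_sign s a b y z) (glide_words s a b y z Ws)"
proof -
  have d: "distinct (expand (glide_token s a b y z) (concat Ws))"
  proof (rule distinct_expand)
    show "distinct (concat Ws)" using g by (simp add: gauss_word_def)
    show "distinct (glide_token s a b y z t)" if "t \<in> set (concat Ws)" for t
      using that redexD[OF g r] f set_gauss_word[OF g]
      by (auto simp: glide_token_def fresh_def)
    show "set (glide_token s a b y z t) \<inter> set (glide_token s a b y z t') = {}"
      if tt: "t \<in> set (concat Ws)" "t' \<in> set (concat Ws)" "t \<noteq> t'" for t t'
    proof -
      have "q \<notin> set (glide_token s a b y z t')" if q: "q \<in> set (glide_token s a b y z t)" for q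
      proof (cases q)
        case (Over c)
        have "u = (if c = b then Under a else Over (if c \<in> {y, z} then a else c))"
          if "u \<in> set (concat Ws)" "Over c \<in> set (glide_token s a b y z u)" for u
          using that(2) unfolding glide_token_Over[OF that(1)] by (simp split: if_splits)
        then show ?thesis using q tt unfolding Over by metis
      next
        case (Under c)
        show ?thesis
          using q tt(3) unfolding Under glide_token_Under[OF tt(1)] glide_token_Under[OF tt(2)] by simp
      qed
      then show ?thesis by blast
    qed
  qed
  have n: "Under q \<in> set (concat (glide_words s a b y z Ws)) \<longleftrightarrow> q \<in> names Ws \<union> {y, z}" for q
  proof -
    have "Under q \<in> set (concat (glide_words s a b y z Ws)) \<longleftrightarrow>
        (\<exists>t\<in>set (concat Ws). Under q \<in> set (glide_token s a b y z t))"
      unfolding glide_words_def concat_map_expand set_expand by blast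
    also have "\<dots> \<longleftrightarrow> (\<exists>t\<in>set (concat Ws). t = Under (if q \<in> {y, z} then b else q))"
      using glide_token_Under by (intro bex_cong) auto
    also have "\<dots> \<longleftrightarrow> q \<in> names Ws \<union> {y, z}"
      unfolding set_gauss_word[OF g] using redexD[OF g r] by auto
    finally show ?thesis .
  qed
  have "s a * s b \<in> {1, -1}"
    using sign_cases[OF g, of a] sign_cases[OF g, of b] by auto
  then have sg: "\<forall>c. glide_sign s a b y z c = 1 \<or> glide_sign s a b y z c = -1"
    using g by (auto simp: glide_sign_def gauss_word_def)
  show ?thesis
    unfolding gauss_word_def
    using d n sg names_glide_words by (simp add: glide_words_def concat_map_expand names_def) blast
qed

text \<open>The over passages of \<open>y\<close> and \<open>z\<close> lie in one block with
  \<open>Over a\<close>, and their under passages in one block with \<open>Under b\<close>, so they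
  compare with all other passages as these do. Exchanging \<open>Under a\<close> and
  \<open>Over b\<close> reverses this one pair.\<close>

lemma chain_glide_words:
  "(p, q) \<in> chain (glide_words s a b y z Ws) \<longleftrightarrow>
     (if p \<in> {y, z} then b else p, if q \<in> {y, z} then a else q) \<in> chain Ws \<and> \<not> (p = a \<and> q = b)"
proof -
  let ?\<sigma> = "glide_token s a b y z"
  let ?p = "if p \<in> {y, z} then b else p" and ?q = "if q \<in> {y, z} then a else q"
  have key: "before (expand ?\<sigma> w) (Under p) (Over q) \<longleftrightarrow>
      before w (Under ?p) (Over ?q) \<and> \<not> (p = a \<and> q = b)" if w: "w \<in> set Ws" for w
  proof -
    have sub: "t \<in> set (concat Ws)" if "t \<in> set w" for t using that w by auto
    \<comment> \<open>The one image with passages of both kinds is that of \<open>Under a\<close>,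
      and there the over passage comes first.\<close>
    have no: "\<not> before (?\<sigma> t) (Under p) (Over q)" for t by (auto simp: glide_token_def)
    have "before (expand ?\<sigma> w) (Under p) (Over q) \<longleftrightarrow>
        (\<exists>t t'. before w t t' \<and> Under p \<in> set (?\<sigma> t) \<and> Over q \<in> set (?\<sigma> t'))"
      unfolding before_expand using no by blast
    also have "\<dots> \<longleftrightarrow> (\<exists>t t'. before w t t' \<and> t = Under ?p \<and> (if q = b then t' = Under a else t' = Over ?q))"
    proof -
      have "before w t t' \<and> Under p \<in> set (?\<sigma> t) \<and> Over q \<in> set (?\<sigma> t') \<longleftrightarrow>
          before w t t' \<and> t = Under ?p \<and> (if q = b then t' = Under a else t' = Over ?q)" for t t'
        using glide_token_Over[OF sub, of t' q] glide_token_Under[OF sub, of t p] before_set[of w t t']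
        by blast
      then show ?thesis by simp
    qed
    also have "\<dots> \<longleftrightarrow> (if q = b then before w (Under ?p) (Under a) else before w (Under ?p) (Over ?q))"
      by auto
    also have "\<dots> \<longleftrightarrow> before w (Under ?p) (Over ?q) \<and> \<not> (p = a \<and> q = b)"
    \<comment> \<open>For q = b the over passage stems from \<open>Under a\<close>, while the claim
      speaks of \<open>Over b\<close>. The two tokens are adjacent, so the two conditions differ
      only for p = a.\<close>
    proof (cases "q = b")
      case True
      then have q: "?q = b" using redexD[OF g r] f by (auto simp: fresh_def)
      have dw: "distinct w" using distinct_word w g by (auto simp: gauss_word_def)
      have "before w (Under ?p) (Under a) \<longleftrightarrow> before w (Under ?p) (Over b) \<and> p \<noteq> a"
      proof (cases "Under a \<in> set w \<or> Over b \<in> set w")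
        case True
        obtain w' where w': "w' \<in> set Ws" "sublist [Under a, Over b] w'" using r by (auto simp: redex_def)
        then have "Under a \<in> set w'" "Over b \<in> set w'" by (auto simp: sublist_def)
        then have "w = w'" using same_word g w w' True by (metis gauss_word_def)
        then have "before w (Under ?p) (Over b) \<longleftrightarrow> Under ?p = Under a \<or> before w (Under ?p) (Under a)"
          using before_adjacent dw w' by blast
        moreover have "?p = a \<longleftrightarrow> p = a" using redexD[OF g r] f by (auto simp: fresh_def)
        ultimately show ?thesis using before_irrefl[OF dw] by auto
      qed (auto dest: before_set)
      then show ?thesis using True q by simp
    qed auto
    finally show ?thesis .
  qed
  show ?thesis using key by (auto simp: chain_def glide_words_def)
qed

end

section \<open>Acyclicity and termination\<close>

text \<open>A potential of a finite acyclic relation counts chains \<open>p\<^sub>1, \<dots>, p\<^sub>r\<close> from \<open>p\<close> with weight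
  at least \<open>2 ^ (r - 1)\<close>.  Its total survives a glide move and bounds the number of crossings.\<close>

definition potential :: "'a set \<Rightarrow> ('a \<times> 'a) set \<Rightarrow> ('a \<Rightarrow> nat) \<Rightarrow> bool" where
  "potential N R f \<longleftrightarrow> (\<forall>p\<in>N. 1 + 2 * sum f (R `` {p}) \<le> f p)"

text \<open>Instead of counting chains, take powers of a large base. The exponent \<open>h p\<close>
  counts the elements reachable from \<open>p\<close> and drops along every edge; with at most
  \<open>card N\<close> successors, the base 2 * card N + 1 leaves room for the factor 2 and the
  summand 1.\<close>

lemma potential_exists:
  assumes "finite N" "R \<subseteq> N \<times> N" "acyclic R"
  shows "\<exists>f. potential N R f"
proof -
  define h where "h p = card (R\<^sup>+ `` {p})" for p
  define B where "B = 2 * card N + 1"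
  have fin: "finite (R\<^sup>+ `` {p})" for p
  proof -
    have "R\<^sup>+ \<subseteq> N \<times> N" using assms(2) by (rule trancl_subset_Sigma)
    then have "R\<^sup>+ `` {p} \<subseteq> N" by auto
    then show ?thesis using assms(1) finite_subset by blast
  qed
  have less: "h q < h p" if "(p, q) \<in> R" for p q
  proof -
    have "R\<^sup>+ `` {q} \<subset> R\<^sup>+ `` {p}"
      using that assms(3) by (auto simp: acyclic_def intro: trancl_into_trancl2)
    then show ?thesis unfolding h_def using fin by (intro psubset_card_mono)
  qed
  have "1 + 2 * (\<Sum>q\<in>R `` {p}. B ^ h q) \<le> B ^ h p" if "p \<in> N" for p
  proof (cases "R `` {p} = {}")
    case True
    then show ?thesis by (simp add: B_def)
  next
    case False
    then obtain q where "(p, q) \<in> R" by auto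
    then obtain m where m: "h p = Suc m" using less[of p q] by (cases "h p") auto
    have "(\<Sum>q\<in>R `` {p}. B ^ h q) \<le> (\<Sum>q\<in>R `` {p}. B ^ m)"
    proof (rule sum_mono)
      fix q assume "q \<in> R `` {p}"
      then have "h q \<le> m" using less[of p q] m by simp
      then show "B ^ h q \<le> B ^ m" by (intro power_increasing) (simp_all add: B_def)
    qed
    also have "\<dots> = card (R `` {p}) * B ^ m" by simp
    also have "\<dots> \<le> card N * B ^ m"
      using assms(1,2) by (intro mult_right_mono card_mono) auto
    finally have "1 + 2 * (\<Sum>q\<in>R `` {p}. B ^ h q) \<le> 1 + 2 * card N * B ^ m" by simp
    also have "\<dots> \<le> B ^ m + 2 * card N * B ^ m" by (simp add: B_def)
    also have "\<dots> = B ^ h p" by (simp add: m B_def algebra_simps)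
    finally show ?thesis .
  qed
  then show ?thesis unfolding potential_def by blast
qed

lemma acyclic_descending:
  fixes f :: "'a \<Rightarrow> nat"
  assumes "\<And>p q. (p, q) \<in> R \<Longrightarrow> f q < f p"
  shows "acyclic R"
proof -
  have "R\<inverse> \<subseteq> measure f" using assms by auto
  then have "wf (R\<inverse>)" by (rule wf_subset[OF wf_measure])
  then show ?thesis using wf_acyclic acyclic_converse by blast
qed

lemma acyclic_descending_exists:
  assumes "finite N" "R \<subseteq> N \<times> N" "acyclic R"
  obtains h :: "'a \<Rightarrow> nat" where "\<And>p q. (p, q) \<in> R \<Longrightarrow> h q < h p"
proof -
  obtain f where f: "potential N R f" using potential_exists[OF assms] by blast
  have "f q < f p" if "(p, q) \<in> R" for p q
  proof -
    have "finite (R `` {p})" using assms by (meson finite_Image finite_SigmaI finite_subset)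
    then have "f q \<le> sum f (R `` {p})" using that by (intro member_le_sum) auto
    moreover have "1 + 2 * sum f (R `` {p}) \<le> f p"
      using f that assms(2) by (auto simp: potential_def)
    ultimately show ?thesis by linarith
  qed
  then show ?thesis using that by blast
qed

lemma potential_acyclic:
  assumes "finite N" "R \<subseteq> N \<times> N" "potential N R f"
  shows "acyclic R"
proof (rule acyclic_descending)
  fix p q assume pq: "(p, q) \<in> R"
  have "finite (R `` {p})" using assms by (meson finite_Image finite_SigmaI finite_subset)
  then have "f q \<le> sum f (R `` {p})" using pq by (intro member_le_sum) auto
  moreover have "1 + 2 * sum f (R `` {p}) \<le> f p"
    using pq assms by (auto simp: potential_def)
  ultimately show "f q < f p" by linarith
qed

text \<open>The effect of a move on the chain relation with the words forgotten, which is all that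
  termination and acyclicity depend on.\<close>

locale chain_glide =
  fixes N :: "'a set" and R R' :: "('a \<times> 'a) set" and a b y z :: 'a
  assumes fin: "finite N" and R: "R \<subseteq> N \<times> N" and R': "R' \<subseteq> (N \<union> {y, z}) \<times> (N \<union> {y, z})"
    and ab: "(a, b) \<in> R" "a \<noteq> b" and yz: "y \<notin> N" "z \<notin> N" "y \<noteq> z"
    and R'_iff: "\<And>p q. (p, q) \<in> R' \<longleftrightarrow>
      (if p \<in> {y, z} then b else p, if q \<in> {y, z} then a else q) \<in> R \<and> \<not> (p = a \<and> q = b)"
begin

text \<open>Chains that start with the edge from \<open>a\<close> to \<open>b\<close> contribute 2 *
  f b to \<open>f a\<close>. This amount is taken from \<open>a\<close> and given in equal parts to
  \<open>y\<close> and \<open>z\<close>, whose successors are those of \<open>b\<close>.\<close>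

lemma potential_glide:
  assumes f: "potential N R f"
  defines "f' \<equiv> f(a := f a - 2 * f b, y := f b, z := f b)"
  shows "potential (N \<union> {y, z}) R' f'" "sum f' (N \<union> {y, z}) = sum f N"
proof -
  have in_N: "a \<in> N" "b \<in> N" using ab R by auto
  have dist: "y \<noteq> a" "y \<noteq> b" "z \<noteq> a" "z \<noteq> b" using yz in_N by auto
  have finR: "finite (R `` {p})" for p using fin R by (meson finite_Image finite_SigmaI finite_subset)
  have sub: "R `` {p} \<subseteq> N" for p using R by auto
  have acyc: "acyclic R" using potential_acyclic[OF fin R f] .
  then have aa: "(a, a) \<notin> R" by (auto simp: acyclic_def)
  have fa: "1 + 2 * sum f (R `` {a}) \<le> f a" using f in_N by (auto simp: potential_def)
  have fb_le: "f b \<le> sum f (R `` {a})" using ab finR by (intro member_le_sum) auto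
  \<comment> \<open>By \<open>fa\<close> and \<open>fb_le\<close> the truncated subtraction in
    \<open>f' a\<close> is exact, so what \<open>a\<close> loses reappears at \<open>y\<close> and
    \<open>z\<close>. For p other than \<open>a\<close>, the successors of p include
    \<open>y\<close> and \<open>z\<close> exactly if they include \<open>a\<close>.\<close>
  have S: "sum f' (A \<union> {y, z}) = sum f A" if "finite A" "a \<in> A" "A \<subseteq> N" for A
  proof -
    have "sum f' (A \<union> {y, z}) = sum f' A + sum f' {y, z}"
      using that yz by (intro sum.union_disjoint) auto
    moreover have "sum f' {y, z} = 2 * f b" using yz by (simp add: f'_def)
    moreover have "sum f' A = f' a + sum f' (A - {a})" using that by (simp add: sum.remove)
    moreover have "sum f' (A - {a}) = sum f (A - {a})"
      using that yz by (intro sum.cong) (auto simp: f'_def)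
    moreover have "sum f A = f a + sum f (A - {a})" using that by (simp add: sum.remove)
    moreover have "f' a = f a - 2 * f b" using dist by (simp add: f'_def)
    ultimately show ?thesis using fa fb_le by linarith
  qed
  show "sum f' (N \<union> {y, z}) = sum f N" using S[OF fin in_N(1)] by simp
  have T: "sum f' A = sum f A" if "a \<notin> A" "A \<subseteq> N" for A
    using that yz by (intro sum.cong) (auto simp: f'_def)
  have out: "sum f' (R' `` {p}) = sum f (R `` {if p \<in> {y, z} then b else p})" if "p \<noteq> a" for p
  proof (cases "(if p \<in> {y, z} then b else p, a) \<in> R")
    case True
    have "R' `` {p} = R `` {if p \<in> {y, z} then b else p} \<union> {y, z}"
      using that True yz R by (auto simp: R'_iff split: if_splits)
    then show ?thesis using True by (simp only: S[OF finR _ sub] Image_singleton_iff)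
  next
    case False
    have "R' `` {p} = R `` {if p \<in> {y, z} then b else p}"
      using that False yz R by (auto simp: R'_iff split: if_splits)
    then show ?thesis using False by (simp only: T[OF _ sub] Image_singleton_iff not_False_eq_True)
  qed
  have out_a: "sum f' (R' `` {a}) + f b = sum f (R `` {a})"
  proof -
    have "R' `` {a} = R `` {a} - {b}"
      using aa yz R dist by (auto simp: R'_iff split: if_splits)
    moreover have "sum f' (R `` {a} - {b}) = sum f (R `` {a} - {b})" using aa R by (intro T) auto
    moreover have "sum f (R `` {a}) = f b + sum f (R `` {a} - {b})"
      using ab finR by (intro sum.remove) auto
    ultimately show ?thesis by simp
  qed
  show "potential (N \<union> {y, z}) R' f'"
    unfolding potential_def
  proof
    fix p assume p: "p \<in> N \<union> {y, z}"
    show "1 + 2 * sum f' (R' `` {p}) \<le> f' p"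
    proof (cases "p = a")
      case True
      have "f' a = f a - 2 * f b" using dist by (simp add: f'_def)
      then show ?thesis using True out_a fa by simp
    next
      case False
      have "f' p = f (if p \<in> {y, z} then b else p)" using False by (auto simp: f'_def)
      moreover have "(if p \<in> {y, z} then b else p) \<in> N" using p in_N by auto
      ultimately show ?thesis using f out[OF False] by (auto simp: potential_def)
    qed
  qed
qed

text \<open>The successors of \<open>b\<close>, \<open>y\<close> and \<open>z\<close> in \<open>R'\<close> are those of \<open>b\<close> in \<open>R\<close>, and the predecessors
  of \<open>a\<close>, \<open>y\<close> and \<open>z\<close> in \<open>R'\<close> are those of \<open>a\<close> in \<open>R\<close>; hence the minimum and the maximum.\<close>

lemma acyclic_glide_iff: "acyclic R' \<longleftrightarrow> acyclic R"
proof
  assume "acyclic R"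
  then obtain f where "potential N R f" using potential_exists fin R by blast
  then show "acyclic R'" using potential_glide(1) potential_acyclic[OF _ R'] fin by blast
next
  assume ac: "acyclic R'"
  obtain h where h: "\<And>p q. (p, q) \<in> R' \<Longrightarrow> h q < (h p :: nat)"
    using acyclic_descending_exists[OF _ R' ac] fin by blast
  define l u where "l = min (h b) (min (h y) (h z))" and "u = max (h a) (max (h y) (h z))"
  \<comment> \<open>Doubling leaves an odd value free just above 2 * u: \<open>a\<close> then lies
    below its predecessors, whose heights exceed \<open>u\<close>, and above \<open>b\<close>, since
    l \<le> u. The value 2 * l keeps \<open>b\<close> above its successors.\<close>
  define g where "g p = (if p = a then 2 * u + 1 else if p = b then 2 * l else 2 * h p)" for p
  have lu: "l \<le> u" by (auto simp: l_def u_def)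
  have dist: "y \<noteq> a" "y \<noteq> b" "z \<noteq> a" "z \<noteq> b" using yz ab R by auto
  show "acyclic R"
  proof (rule acyclic_descending)
    fix p q assume pq: "(p, q) \<in> R"
    then have pqN: "p \<notin> {y, z}" "q \<notin> {y, z}" using R yz by auto
    \<comment> \<open>The edge from \<open>b\<close> to \<open>a\<close> would become a loop at
      \<open>y\<close>, which succeeds what precedes \<open>a\<close> and precedes what succeeds
      \<open>b\<close>.\<close>
    have no: "\<not> (p = b \<and> q = a)"
    proof
      assume "p = b \<and> q = a"
      then have "(y, y) \<in> R'" using pq dist by (auto simp: R'_iff)
      then show False using h by blast
    qed
    consider "p = a" "q = b" | "p = a" "q \<noteq> b" | "p = b" "q \<noteq> a" "q \<noteq> b" | "p = b" "q = b"
      | "p \<noteq> a" "p \<noteq> b" "q = a" | "p \<noteq> a" "p \<noteq> b" "q \<noteq> a"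
      using no by blast
    then show "g q < g p"
    proof cases
      case 1
      then show ?thesis using lu ab by (simp add: g_def)
    next
      case 2
      have "(a, q) \<in> R'" using 2 pq pqN dist by (auto simp: R'_iff)
      moreover then have "q \<noteq> a" using h by blast
      ultimately show ?thesis using 2 h[of a q] by (auto simp: g_def u_def)
    next
      case 3
      have "(b, q) \<in> R'" "(y, q) \<in> R'" "(z, q) \<in> R'" using 3 pq pqN dist ab by (auto simp: R'_iff)
      then have "h q < l" using h by (auto simp: l_def)
      then show ?thesis using 3 ab by (auto simp: g_def)
    next
      case 4
      then have "(b, b) \<in> R'" using pq dist ab by (auto simp: R'_iff)
      then show ?thesis using h by blast
    next
      case 5
      have "(p, a) \<in> R'" "(p, y) \<in> R'" "(p, z) \<in> R'" using 5 pq pqN dist ab by (auto simp: R'_iff)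
      then have "u < h p" using h by (auto simp: u_def)
      then show ?thesis using 5 by (auto simp: g_def)
    next
      case 6
      have "(p, q) \<in> R'" using 6 pq pqN by (auto simp: R'_iff)
      then have "h q < h p" using h by blast
      then show ?thesis using 6 by (auto simp: g_def l_def)
    qed
  qed
qed

end

lemma chain_glide_words_locale:
  assumes g: "gauss_word s Ws" and r: "redex Ws a b" and f: "fresh y z Ws"
  shows "chain_glide (names Ws) (chain Ws) (chain (glide_words s a b y z Ws)) a b y z"
proof
  show "finite (names Ws)" by simp
  show "chain Ws \<subseteq> names Ws \<times> names Ws" using chain_names[OF g] .
  show "chain (glide_words s a b y z Ws) \<subseteq> (names Ws \<union> {y, z}) \<times> (names Ws \<union> {y, z})"
    using chain_names[OF gauss_word_glide[OF g r f]] names_glide_words[OF g r f] by simp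
  show "(a, b) \<in> chain Ws" "a \<noteq> b" using redexD[OF g r] by auto
  show "y \<notin> names Ws" "z \<notin> names Ws" "y \<noteq> z" using f by (auto simp: fresh_def)
qed (rule chain_glide_words[OF g r f])

section \<open>Local confluence\<close>

definition word_step ::
  "(nat \<Rightarrow> int) \<times> token list list \<Rightarrow> (nat \<Rightarrow> int) \<times> token list list \<Rightarrow> bool" where
  "word_step S S' \<longleftrightarrow> (\<exists>a b y z. redex (snd S) a b \<and> fresh y z (snd S) \<and>
     S' = (glide_sign (fst S) a b y z, glide_words (fst S) a b y z (snd S)))"

text \<open>Substitutions carry infixes along, so a longer pattern records several redexes that
  become available one after the other.\<close>

definition infix_of :: "token list \<Rightarrow> token list list \<Rightarrow> bool" where
  "infix_of u Ws \<longleftrightarrow> (\<exists>w\<in>set Ws. sublist u w)"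

lemma redex_infix: "redex Ws a b \<longleftrightarrow> a \<noteq> b \<and> infix_of [Under a, Over b] Ws"
  by (simp add: redex_def infix_of_def)

lemma infix_of_append: "infix_of (u @ v @ w) Ws \<Longrightarrow> infix_of v Ws"
  unfolding infix_of_def by (meson sublist_appendI sublist_order.order.trans)

lemma infix_of_glide:
  "infix_of u Ws \<Longrightarrow> infix_of (expand (glide_token s a b y z) u) (glide_words s a b y z Ws)"
  by (auto simp: infix_of_def glide_words_def intro: sublist_expand)

lemma glide_word_step:
  assumes "gauss_word s Ws" "infix_of [Under a, Over b] Ws" "a \<noteq> b" "fresh y z Ws"
  defines "s' \<equiv> glide_sign s a b y z" and "Ws' \<equiv> glide_words s a b y z Ws"
  shows "word_step (s, Ws) (s', Ws')" "gauss_word s' Ws'" "names Ws' = names Ws \<union> {y, z}"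
proof -
  have r: "redex Ws a b" using assms by (simp add: redex_infix)
  show "word_step (s, Ws) (s', Ws')"
    unfolding word_step_def s'_def Ws'_def using r assms(4) by force
  show "gauss_word s' Ws'" "names Ws' = names Ws \<union> {y, z}"
    unfolding s'_def Ws'_def
    using gauss_word_glide[OF assms(1) r assms(4)] names_glide_words[OF assms(1) r assms(4)] by auto
qed

text \<open>After the move at \<open>(b, c)\<close> the passage \<open>Under a\<close> is followed by the three over passages of
  \<open>d1, b, d2\<close>, and after the move at \<open>(a, b)\<close> the passage \<open>Over c\<close> is preceded by the three under
  passages of \<open>e2, b, e1\<close>.  Three more moves on either side exchange them; the fresh names
  are distributed such that both sides end with the same crossings.\<close>

lemma join_critical:
  fixes a b c d1 d2 e1 e2 p1 q1 p2 q2 :: nat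
  assumes g: "gauss_word s Ws"
    and ab: "infix_of [Under a, Over b] Ws" and bc: "infix_of [Under b, Over c] Ws"
    and dist: "distinct [a, b, c, d1, d2, e1, e2, p1, q1, p2, q2]"
    and fr: "{d1, d2, e1, e2, p1, q1, p2, q2} \<inter> names Ws = {}"
  defines "y1 \<equiv> if s b = 1 then d1 else d2" and "z1 \<equiv> if s b = 1 then d2 else d1"
    and "y2 \<equiv> if s b = 1 then e1 else e2" and "z2 \<equiv> if s b = 1 then e2 else e1"
  shows "\<exists>S. word_step\<^sup>*\<^sup>* (glide_sign s a b y2 z2, glide_words s a b y2 z2 Ws) S \<and>
             word_step\<^sup>*\<^sup>* (glide_sign s b c y1 z1, glide_words s b c y1 z1 Ws) S"
proof -
  \<comment> \<open>The moves at \<open>(a, d1)\<close>, \<open>(a, d2)\<close> and those at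
    \<open>(e1, c)\<close>, \<open>(e2, c)\<close> must create the same four crossings. Of these,
    \<open>p1\<close> and \<open>q2\<close> have the sign s a * s c, and \<open>q1\<close> and
    \<open>p2\<close> the opposite one; which of two equal signs comes first on its strands depends
    on \<open>s b\<close>.\<close>
  define f1 g1 f2 g2 where "f1 = (if s b = 1 then p1 else q2)" and "g1 = (if s b = 1 then p2 else q1)"
    and "f2 = (if s b = 1 then q1 else p2)" and "g2 = (if s b = 1 then q2 else p1)"
  note defs = y1_def z1_def y2_def z2_def f1_def g1_def f2_def g2_def
  \<comment> \<open>The reversed list yields every inequality in its other orientation, for
    rewriting.\<close>
  have "distinct (rev [a, b, c, d1, d2, e1, e2, p1, q1, p2, q2])"
    using dist unfolding distinct_rev .
  note neqs = dist[simplified] this[simplified]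
  have sb: "s b = 1 \<or> s b = -1" and sa: "s a = 1 \<or> s a = -1" and sc: "s c = 1 \<or> s c = -1"
    using sign_cases[OF g] by auto
  have fr1: "fresh y1 z1 Ws" and fr2: "fresh y2 z2 Ws"
    using fr neqs by (auto simp: fresh_def y1_def z1_def y2_def z2_def)

  define s1 W1 where "s1 = glide_sign s b c y1 z1" and "W1 = glide_words s b c y1 z1 Ws"
  have st: "gauss_word s1 W1" "names W1 = names Ws \<union> {d1, d2}"
    "infix_of [Under a, Over d1, Over b, Over d2] W1"
    using glide_word_step[OF g bc _ fr1] infix_of_glide[OF ab, of s b c y1 z1] neqs
    by (auto simp: s1_def W1_def glide_token_def y1_def z1_def)
  \<comment> \<open>The factor \<open>s b\<close> cancels: \<open>d1\<close> is the crossing of sign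
    s b * s c or the one of opposite sign, according to \<open>s b\<close>.\<close>
  have sg1: "s1 d1 = s c" "s1 d2 = - s c" "s1 a = s a"
    using sb neqs by (auto simp: s1_def glide_sign_def y1_def z1_def)
  define s2 W2 where "s2 = glide_sign s1 a d1 p1 q1" and "W2 = glide_words s1 a d1 p1 q1 W1"
  have i: "infix_of [Under a, Over d1] W1" using infix_of_append[of "[]" _ "[Over b, Over d2]"] st by simp
  have fr3: "fresh p1 q1 W1" using fr neqs st by (auto simp: fresh_def)
  have st2: "word_step (s1, W1) (s2, W2)" "gauss_word s2 W2" "names W2 = names Ws \<union> {d1, d2, p1, q1}"
    "infix_of [Over d1, Under a, Over b, Over d2] W2"
    using glide_word_step[OF st(1) i _ fr3] infix_of_glide[OF st(3), of s1 a d1 p1 q1] neqs st(2)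
    by (auto simp: s2_def W2_def glide_token_def)
  define s3 W3 where "s3 = glide_sign s2 a b y2 z2" and "W3 = glide_words s2 a b y2 z2 W2"
  have i: "infix_of [Under a, Over b] W2"
    using infix_of_append[of "[Over d1]" _ "[Over d2]"] st2 by simp
  have fr4: "fresh y2 z2 W2" using fr neqs st2 by (auto simp: fresh_def y2_def z2_def)
  have st3: "word_step (s2, W2) (s3, W3)" "gauss_word s3 W3"
    "names W3 = names Ws \<union> {d1, d2, p1, q1, e1, e2}"
    "infix_of [Over d1, Over b, Under a, Over d2] W3"
    using glide_word_step[OF st2(2) i _ fr4] infix_of_glide[OF st2(4), of s2 a b y2 z2] neqs st2(3)
    by (auto simp: s3_def W3_def glide_token_def y2_def z2_def)
  define s4 W4 where "s4 = glide_sign s3 a d2 p2 q2" and "W4 = glide_words s3 a d2 p2 q2 W3"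
  have i: "infix_of [Under a, Over d2] W3"
    using infix_of_append[of "[Over d1, Over b]" _ "[]"] st3 by simp
  have fr5: "fresh p2 q2 W3" using fr neqs st3 by (auto simp: fresh_def)
  have st4: "word_step (s3, W3) (s4, W4)"
    using glide_word_step(1)[OF st3(2) i _ fr5] neqs by (auto simp: s4_def W4_def)
  have A: "word_step\<^sup>*\<^sup>* (s1, W1) (s4, W4)" using st2(1) st3(1) st4 by (blast intro: converse_rtranclp_into_rtranclp)

  define t1 V1 where "t1 = glide_sign s a b y2 z2" and "V1 = glide_words s a b y2 z2 Ws"
  have sv: "gauss_word t1 V1" "names V1 = names Ws \<union> {e1, e2}"
    "infix_of [Under e2, Under b, Under e1, Over c] V1"
    using glide_word_step[OF g ab _ fr2] infix_of_glide[OF bc, of s a b y2 z2] neqs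
    by (auto simp: t1_def V1_def glide_token_def y2_def z2_def)
  \<comment> \<open>The mirror image of the moves above: \<open>Over c\<close> is pulled back past
    the under passages of \<open>e1\<close>, \<open>b\<close> and \<open>e2\<close>, the nearest one
    first.\<close>
  define t2 V2 where "t2 = glide_sign t1 e1 c f1 g1" and "V2 = glide_words t1 e1 c f1 g1 V1"
  have i: "infix_of [Under e1, Over c] V1"
    using infix_of_append[of "[Under e2, Under b]" _ "[]"] sv by simp
  have fr3: "fresh f1 g1 V1" using fr neqs sv by (auto simp: fresh_def f1_def g1_def)
  have sv2: "word_step (t1, V1) (t2, V2)" "gauss_word t2 V2" "names V2 = names Ws \<union> {e1, e2, f1, g1}"
    "infix_of [Under e2, Under b, Over c, Under e1] V2"
    using glide_word_step[OF sv(1) i _ fr3] infix_of_glide[OF sv(3), of t1 e1 c f1 g1] neqs sv(2)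
    by (auto simp: t2_def V2_def glide_token_def)
  define t3 V3 where "t3 = glide_sign t2 b c y1 z1" and "V3 = glide_words t2 b c y1 z1 V2"
  have i: "infix_of [Under b, Over c] V2"
    using infix_of_append[of "[Under e2]" _ "[Under e1]"] sv2 by simp
  have fr4: "fresh y1 z1 V2" using fr neqs sv2 by (auto simp: fresh_def y1_def z1_def f1_def g1_def)
  have sv3: "word_step (t2, V2) (t3, V3)" "gauss_word t3 V3"
    "names V3 = names Ws \<union> {e1, e2, f1, g1, d1, d2}"
    "infix_of [Under e2, Over c, Under b, Under e1] V3"
    using glide_word_step[OF sv2(2) i _ fr4] infix_of_glide[OF sv2(4), of t2 b c y1 z1] neqs sv2(3)
    by (auto simp: t3_def V3_def glide_token_def y1_def z1_def)
  define t4 V4 where "t4 = glide_sign t3 e2 c f2 g2" and "V4 = glide_words t3 e2 c f2 g2 V3"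
  have i: "infix_of [Under e2, Over c] V3"
    using infix_of_append[of "[]" _ "[Under b, Under e1]"] sv3 by simp
  have fr5: "fresh f2 g2 V3" using fr neqs sv3 by (auto simp: fresh_def f1_def g1_def f2_def g2_def)
  have sv4: "word_step (t3, V3) (t4, V4)"
    using glide_word_step(1)[OF sv3(2) i _ fr5] neqs by (auto simp: t4_def V4_def)
  have B: "word_step\<^sup>*\<^sup>* (t1, V1) (t4, V4)" using sv2(1) sv3(1) sv4 by (blast intro: converse_rtranclp_into_rtranclp)

  \<comment> \<open>Once \<open>s b\<close> is fixed, all names are constants, and signs and
    substitutions are compared by evaluation.\<close>
  have sb_cases: "s b = 1 \<and> y1 = d1 \<and> z1 = d2 \<and> y2 = e1 \<and> z2 = e2 \<and> f1 = p1 \<and> g1 = p2 \<and> f2 = q1 \<and> g2 = q2 \<or>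
      s b = -1 \<and> y1 = d2 \<and> z1 = d1 \<and> y2 = e2 \<and> z2 = e1 \<and> f1 = q2 \<and> g1 = q1 \<and> f2 = p2 \<and> g2 = p1"
    using sb by (auto simp: defs)
  note signs = s4_def s3_def s2_def s1_def t4_def t3_def t2_def t1_def glide_sign_def
  have "s4 = t4"
  proof
    fix x
    consider "x = d1" | "x = d2" | "x = e1" | "x = e2" | "x = p1" | "x = q1" | "x = p2" | "x = q2"
      | "x \<notin> {d1, d2, e1, e2, p1, q1, p2, q2}" by blast
    then show "s4 x = t4 x"
      by (cases; insert sb_cases; elim disjE conjE; simp add: signs neqs)
  qed
  moreover have "W4 = V4"
  proof -
    have "s1 a = s a" "s1 d1 = s c" "s2 a = s a" "s2 b = s b" "s3 a = s a" "s3 d2 = - s c"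
      "t1 e1 = s a" "t1 c = s c" "t2 b = s b" "t2 c = s c" "t3 e2 = - s a" "t3 c = s c"
      by (insert sb_cases; elim disjE conjE; simp add: signs neqs)+
    note gt = this
    have "expand (glide_token s3 a d2 p2 q2) (expand (glide_token s2 a b y2 z2)
          (expand (glide_token s1 a d1 p1 q1) (glide_token s b c y1 z1 t))) =
        expand (glide_token t3 e2 c f2 g2) (expand (glide_token t2 b c y1 z1)
          (expand (glide_token t1 e1 c f1 g1) (glide_token s a b y2 z2 t)))"
      if "t \<in> set (concat Ws)" for t
    proof -
      have "t \<notin> Over ` {d1, d2, e1, e2, p1, q1, p2, q2} \<union> Under ` {d1, d2, e1, e2, p1, q1, p2, q2}"
        using that fr unfolding set_gauss_word[OF g] by auto
      then have "t \<noteq> Over x" "t \<noteq> Under x" if "x \<in> {d1, d2, e1, e2, p1, q1, p2, q2}" for x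
        using that by auto
      note new = this(1)[of d1] this(1)[of d2] this(1)[of e1] this(1)[of e2] this(2)[of d1]
        this(2)[of d2] this(2)[of e1] this(2)[of e2]
      consider "t = Over a" | "t = Over b" | "t = Over c" | "t = Under a" | "t = Under b"
        | "t = Under c" | "t \<notin> {Over a, Over b, Over c, Under a, Under b, Under c}" by blast
      then show ?thesis
        by (cases; insert sb_cases sa sc; elim disjE conjE; simp add: glide_token_def neqs new gt)
    qed
    then show ?thesis
      unfolding W4_def W3_def W2_def W1_def V4_def V3_def V2_def V1_def glide_words_def map_map
      by (intro map_cong refl) (auto simp: expand_expand intro!: expand_cong)
  qed
  ultimately show ?thesis using A B unfolding s1_def W1_def t1_def V1_def by metis
qed


text \<open>Neither substitution changes a token or a sign that the other one reads, so each redex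
  survives the other move and the substitutions commute. The two sites may lie on the same strands;
  only the four crossings must differ.\<close>

lemma join_disjoint:
  fixes a b c d y1 z1 y2 z2 :: nat
  assumes g: "gauss_word s Ws"
    and ab: "infix_of [Under a, Over b] Ws" and cd: "infix_of [Under c, Over d] Ws"
    and dist: "distinct [a, b, c, d, y1, z1, y2, z2]"
    and fr: "{y1, z1, y2, z2} \<inter> names Ws = {}"
  shows "\<exists>S. word_step\<^sup>*\<^sup>* (glide_sign s a b y1 z1, glide_words s a b y1 z1 Ws) S \<and>
             word_step\<^sup>*\<^sup>* (glide_sign s c d y2 z2, glide_words s c d y2 z2 Ws) S"
proof -
  have "distinct (rev [a, b, c, d, y1, z1, y2, z2])"
    using dist unfolding distinct_rev .
  note neqs = dist[simplified] this[simplified]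
  have fr1: "fresh y1 z1 Ws" and fr2: "fresh y2 z2 Ws" using fr neqs by (auto simp: fresh_def)
  define s1 W1 s2 W2 where "s1 = glide_sign s a b y1 z1" and "W1 = glide_words s a b y1 z1 Ws"
    and "s2 = glide_sign s c d y2 z2" and "W2 = glide_words s c d y2 z2 Ws"
  note defs = s1_def W1_def s2_def W2_def
  have st: "gauss_word s1 W1" "names W1 = names Ws \<union> {y1, z1}" "infix_of [Under c, Over d] W1"
    using glide_word_step[OF g ab _ fr1] infix_of_glide[OF cd, of s a b y1 z1] neqs
    by (auto simp: defs glide_token_def)
  have sv: "gauss_word s2 W2" "names W2 = names Ws \<union> {y2, z2}" "infix_of [Under a, Over b] W2"
    using glide_word_step[OF g cd _ fr2] infix_of_glide[OF ab, of s c d y2 z2] neqs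
    by (auto simp: defs glide_token_def)
  have A: "word_step (s1, W1) (glide_sign s1 c d y2 z2, glide_words s1 c d y2 z2 W1)"
    using fr neqs st by (intro glide_word_step(1)[OF st(1,3)]) (auto simp: fresh_def)
  have B: "word_step (s2, W2) (glide_sign s2 a b y1 z1, glide_words s2 a b y1 z1 W2)"
    using fr neqs sv by (intro glide_word_step(1)[OF sv(1,3)]) (auto simp: fresh_def)
  have "glide_sign s1 c d y2 z2 = glide_sign s2 a b y1 z1"
    by (simp add: defs glide_sign_def neqs fun_eq_iff)
  moreover have "glide_words s1 c d y2 z2 W1 = glide_words s2 a b y1 z1 W2"
  proof -
    have gt: "s1 c = s c" "s1 d = s d" "s2 a = s a" "s2 b = s b"
      by (simp_all add: defs glide_sign_def neqs)
    have "expand (glide_token s1 c d y2 z2) (glide_token s a b y1 z1 t) =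
        expand (glide_token s2 a b y1 z1) (glide_token s c d y2 z2 t)"
      if "t \<in> set (concat Ws)" for t
    proof -
      consider "t = Over a" | "t = Over b" | "t = Over c" | "t = Over d" | "t = Under a"
        | "t = Under b" | "t = Under c" | "t = Under d"
        | "t \<notin> {Over a, Over b, Over c, Over d, Under a, Under b, Under c, Under d}" by blast
      then show ?thesis
        by (cases; simp add: glide_token_def neqs gt)
    qed
    then show ?thesis
      unfolding W1_def W2_def glide_words_def map_map
      by (intro map_cong refl) (auto simp: expand_expand intro!: expand_cong)
  qed
  ultimately show ?thesis using A B by (metis defs r_into_rtranclp)
qed

section \<open>From words to diagrams\<close>

text \<open>The relation behind \<open>pos\<close>. It passes through substitutions without assuming
  that tokens are distinct.\<close>

definition token_at :: "token list list \<Rightarrow> nat \<times> nat \<Rightarrow> token \<Rightarrow> bool" where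
  "token_at Ws p t \<longleftrightarrow> fst p < length Ws \<and> snd p < length (Ws ! fst p) \<and> Ws ! fst p ! snd p = t"

definition pos :: "token list list \<Rightarrow> token \<Rightarrow> nat \<times> nat" where
  "pos Ws t = (THE p. token_at Ws p t)"

definition diag :: "endpoint list \<Rightarrow> (nat \<Rightarrow> int) \<Rightarrow> token list list \<Rightarrow> diagram" where
  "diag bd s Ws = Diagram (length Ws) bd
     ((\<lambda>c. Crossing (s c) (pos Ws (Over c)) (pos Ws (Under c))) ` names Ws)"

lemma token_at_exists: "t \<in> set (concat Ws) \<longleftrightarrow> (\<exists>p. token_at Ws p t)"
  by (force simp: token_at_def in_set_conv_nth)

lemma token_at_inj:
  assumes "distinct (concat Ws)" "token_at Ws p t" "token_at Ws q t"
  shows "p = q"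
proof -
  have "fst p = fst q"
  proof (rule ccontr)
    assume "fst p \<noteq> fst q"
    moreover have "set (Ws ! i) \<inter> set (Ws ! j) = {}" if "i < j" "j < length Ws" for i j
    proof -
      have "concat Ws = concat (take j Ws) @ Ws ! j @ concat (drop (Suc j) Ws)"
        using that by (metis id_take_nth_drop concat.simps(2) concat_append)
      then have "set (concat (take j Ws)) \<inter> set (Ws ! j) = {}"
        using assms(1) by (metis distinct_append Int_Un_distrib Un_empty set_append)
      moreover have "Ws ! i \<in> set (take j Ws)"
        using that by (auto simp: in_set_conv_nth intro!: exI[of _ i])
      ultimately show ?thesis by auto
    qed
    ultimately show False
      using assms(2,3) unfolding token_at_def by (metis disjoint_iff linorder_neqE_nat nth_mem)
  qed
  moreover have "distinct (Ws ! fst p)"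
    using assms(2) distinct_word[OF assms(1) nth_mem] by (auto simp: token_at_def)
  ultimately show ?thesis
    using assms(2,3) by (auto simp: token_at_def prod_eq_iff nth_eq_iff_index_eq)
qed

lemma token_at_fun: "token_at Ws p t \<Longrightarrow> token_at Ws p t' \<Longrightarrow> t = t'"
  by (auto simp: token_at_def)

lemma token_at_iff_pos:
  assumes "distinct (concat Ws)"
  shows "token_at Ws p t \<longleftrightarrow> t \<in> set (concat Ws) \<and> p = pos Ws t"
proof
  assume "token_at Ws p t"
  then show "t \<in> set (concat Ws) \<and> p = pos Ws t"
    using token_at_exists token_at_inj[OF assms] unfolding pos_def by (metis the_equality)
next
  assume "t \<in> set (concat Ws) \<and> p = pos Ws t"
  then show "token_at Ws p t"
    using token_at_exists token_at_inj[OF assms] unfolding pos_def by (metis the_equality)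
qed

text \<open>Start of the image of the i-th token. It serves for arcs, too: these number the gaps
  between passages, so i = length w is meaningful.\<close>

definition offset :: "(token \<Rightarrow> token list) \<Rightarrow> token list \<Rightarrow> nat \<Rightarrow> nat" where
  "offset \<sigma> w i = length (expand \<sigma> (take i w))"

lemma offset_sum: "i \<le> length w \<Longrightarrow> offset \<sigma> w i = (\<Sum>j<i. length (\<sigma> (w ! j)))"
  by (induction i) (auto simp: offset_def take_Suc_conv_app_nth)

lemma offset_Suc: "i < length w \<Longrightarrow> offset \<sigma> w (Suc i) = offset \<sigma> w i + length (\<sigma> (w ! i))"
  by (simp add: offset_def take_Suc_conv_app_nth)

lemma offset_0 [simp]: "offset \<sigma> w 0 = 0"
  by (simp add: offset_def)

lemma offset_length: "offset \<sigma> w (length w) = length (expand \<sigma> w)"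
  by (simp add: offset_def)

lemma nth_expand:
  assumes "i < length w" "m < length (\<sigma> (w ! i))"
  shows "offset \<sigma> w i + m < length (expand \<sigma> w)" "expand \<sigma> w ! (offset \<sigma> w i + m) = \<sigma> (w ! i) ! m"
proof -
  have "expand \<sigma> w = expand \<sigma> (take i w) @ \<sigma> (w ! i) @ expand \<sigma> (drop (Suc i) w)"
    using assms(1) by (metis id_take_nth_drop expand_simps(2,3))
  then show "offset \<sigma> w i + m < length (expand \<sigma> w)"
    "expand \<sigma> w ! (offset \<sigma> w i + m) = \<sigma> (w ! i) ! m"
    using assms(2) by (simp_all add: offset_def nth_append)
qed

lemma expand_index:
  "n < length (expand \<sigma> w) \<Longrightarrow>
     \<exists>i m. i < length w \<and> m < length (\<sigma> (w ! i)) \<and> n = offset \<sigma> w i + m"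
proof (induction w rule: rev_induct)
  case (snoc t w)
  show ?case
  proof (cases "n < length (expand \<sigma> w)")
    case True
    then obtain i m where im: "i < length w" "m < length (\<sigma> (w ! i))" "n = offset \<sigma> w i + m"
      using snoc by blast
    then show ?thesis
      by (intro exI[of _ i] exI[of _ m]) (auto simp: nth_append offset_def)
  next
    case False
    then show ?thesis
      using snoc.prems
      by (intro exI[of _ "length w"] exI[of _ "n - length (expand \<sigma> w)"])
        (auto simp: offset_def)
  qed
qed auto

lemma token_at_expand:
  "token_at (map (expand \<sigma>) Ws) q t' \<longleftrightarrow>
     (\<exists>k i m t. token_at Ws (k, i) t \<and> m < length (\<sigma> t) \<and> q = (k, offset \<sigma> (Ws ! k) i + m) \<and> t' = \<sigma> t ! m)"
proof
  assume a: "token_at (map (expand \<sigma>) Ws) q t'"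
  then obtain i m where "i < length (Ws ! fst q)" "m < length (\<sigma> (Ws ! fst q ! i))"
    "snd q = offset \<sigma> (Ws ! fst q) i + m"
    using expand_index[of "snd q" \<sigma> "Ws ! fst q"] by (auto simp: token_at_def)
  then show "\<exists>k i m t. token_at Ws (k, i) t \<and> m < length (\<sigma> t) \<and> q = (k, offset \<sigma> (Ws ! k) i + m) \<and> t' = \<sigma> t ! m"
    using a nth_expand(2)[of i "Ws ! fst q" m \<sigma>]
    by (intro exI[of _ "fst q"] exI[of _ i] exI[of _ m] exI[of _ "Ws ! fst q ! i"])
      (auto simp: token_at_def prod_eq_iff)
next
  assume "\<exists>k i m t. token_at Ws (k, i) t \<and> m < length (\<sigma> t) \<and> q = (k, offset \<sigma> (Ws ! k) i + m) \<and> t' = \<sigma> t ! m"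
  then show "token_at (map (expand \<sigma>) Ws) q t'"
    using nth_expand by (auto simp: token_at_def)
qed

text \<open>The position, relative to a passage, of the \<open>m\<close>-th of the \<open>l\<close> passages that replace it.\<close>

definition rational_offset :: "nat \<Rightarrow> nat \<Rightarrow> rat" where
  "rational_offset l m = (if l = 3 then (of_nat m - 1) / 3 else 0)"

text \<open>Offsets stay within 1/3 of their integer, so blocks at different integers do not overlap
  and the order is lexicographic. One position holds one block, hence the assumption for i =
  i'.\<close>

lemma rational_offset_less:
  assumes "l = 1 \<or> l = 3" "l' = 1 \<or> l' = 3" "m < l" "m' < l'" "i = i' \<Longrightarrow> l = l'"
  shows "of_nat i + rational_offset l m < of_nat i' + rational_offset l' m' \<longleftrightarrow>
    i < i' \<or> i = i' \<and> m < m'"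
proof -
  have bd: "\<bar>rational_offset k n\<bar> \<le> 1 / 3" if "k = 1 \<or> k = 3" "n < k" for k n
  proof -
    have "n = 0 \<or> n = 1 \<or> n = 2" using that by auto
    then show ?thesis by (auto simp: rational_offset_def)
  qed
  note b = bd[OF assms(1,3)] bd[OF assms(2,4)]
  consider "i < i'" | "i = i'" | "i' < i" by linarith
  then show ?thesis
  proof cases
    case 1
    then have "of_nat i + 1 \<le> (of_nat i' :: rat)"
      by (metis Suc_leI of_nat_Suc of_nat_le_iff add.commute)
    then show ?thesis using 1 b by linarith
  next
    case 2
    then show ?thesis using assms by (auto simp: rational_offset_def)
  next
    case 3
    then have "of_nat i' + 1 \<le> (of_nat i :: rat)"
      by (metis Suc_leI of_nat_Suc of_nat_le_iff add.commute)
    then show ?thesis using 3 b by linarith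
  qed
qed

text \<open>The stage of a move between the substitution and the renumbering; for
  \<open>swap_token\<close> the positions are those of \<open>glide_crossings\<close>.\<close>

definition rational_at ::
  "(token \<Rightarrow> token list) \<Rightarrow> token list list \<Rightarrow> nat \<times> rat \<Rightarrow> token \<Rightarrow> bool" where
  "rational_at \<sigma> Ws p t' \<longleftrightarrow> (\<exists>q m t. token_at Ws q t \<and> m < length (\<sigma> t) \<and>
     p = (fst q, of_nat (snd q) + rational_offset (length (\<sigma> t)) m) \<and> t' = \<sigma> t ! m)"

text \<open>By the lexicographic order, the positions below the m-th passage of block i are the
  blocks before i and m passages of block i, which is how \<open>offset\<close> counts. Blocks have
  one or three passages; the images of length two and zero under \<open>glide_token\<close> would
  not fit.\<close>

lemma rank_rational_at:
  assumes l: "\<And>t. length (\<sigma> t) = 1 \<or> length (\<sigma> t) = 3"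
    and p: "rational_at \<sigma> Ws p t'"
  shows "token_at (map (expand \<sigma>) Ws) (rank {p. \<exists>t. rational_at \<sigma> Ws p t} p) t'"
proof -
  obtain k i m t where t: "token_at Ws (k, i) t" "m < length (\<sigma> t)" "t' = \<sigma> t ! m"
    and p: "p = (k, of_nat i + rational_offset (length (\<sigma> t)) m)"
    using p unfolding rational_at_def by (metis prod.collapse)
  let ?w = "Ws ! k"
  let ?l = "\<lambda>i. length (\<sigma> (?w ! i))"
  let ?r = "\<lambda>(i, m). of_nat i + rational_offset (?l i) m :: rat"
  let ?S = "Sigma {..<length ?w} (\<lambda>i. {..<?l i})"
  have ik: "i < length ?w" "k < length Ws" "?w ! i = t" using t by (auto simp: token_at_def)
  have less: "?r x < ?r y \<longleftrightarrow> fst x < fst y \<or> fst x = fst y \<and> snd x < snd y"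
    if "x \<in> ?S" "y \<in> ?S" for x y
    using that rational_offset_less[OF l l, of "snd x" "?w ! fst x" "snd y" "?w ! fst y" "fst x" "fst y"]
    by (auto simp: case_prod_beta)
  have inj: "inj_on ?r ?S"
  proof (rule inj_onI)
    fix x y assume xy: "x \<in> ?S" "y \<in> ?S" "?r x = ?r y"
    then have "\<not> ?r x < ?r y" "\<not> ?r y < ?r x" by simp_all
    then show "x = y" using less[OF xy(1,2)] less[OF xy(2,1)] by (auto simp: prod_eq_iff)
  qed
  have im: "(i, m) \<in> ?S" using ik t by auto
  have "{q. (k, q) \<in> {p. \<exists>t. rational_at \<sigma> Ws p t} \<and> q < snd p} = ?r ` {x \<in> ?S. ?r x < ?r (i, m)}"
    using ik unfolding p rational_at_def token_at_def by (fastforce simp: image_iff)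
  also have "{x \<in> ?S. ?r x < ?r (i, m)} = {x \<in> ?S. fst x < i \<or> fst x = i \<and> snd x < m}"
    using less[OF _ im] by auto
  also have "\<dots> = Sigma {..<i} (\<lambda>i. {..<?l i}) \<union> {i} \<times> {..<m}"
    using ik t by auto
  finally have "card {q. (k, q) \<in> {p. \<exists>t. rational_at \<sigma> Ws p t} \<and> q < snd p} =
      card (?r ` (Sigma {..<i} (\<lambda>i. {..<?l i}) \<union> {i} \<times> {..<m}))" by simp
  also have "\<dots> = card (Sigma {..<i} (\<lambda>i. {..<?l i}) \<union> {i} \<times> {..<m})"
    using ik t by (intro card_image inj_on_subset[OF inj]) auto
  also have "\<dots> = offset \<sigma> ?w i + m"
    using ik by (subst card_Un_disjoint) (auto simp: offset_sum)
  finally show ?thesis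
    using t unfolding token_at_expand rank_def p by auto
qed


text \<open>Gives the same words as \<open>glide_token\<close>, but every passage is replaced by passages next to it.\<close>

definition swap_token ::
  "(nat \<Rightarrow> int) \<Rightarrow> nat \<Rightarrow> nat \<Rightarrow> nat \<Rightarrow> nat \<Rightarrow> token \<Rightarrow> token list" where
  "swap_token s a b y z t =
     (if t = Under a then [Over b] else if t = Over b then [Under a] else glide_token s a b y z t)"

lemma length_swap_token:
  "length (swap_token s a b y z t) = (if a \<noteq> b \<and> (t = Over a \<or> t = Under b) then 3 else 1)"
  by (auto simp: swap_token_def glide_token_def)

section \<open>Glide moves of diagrams as substitutions\<close>

definition crossing_of :: "(nat \<Rightarrow> int) \<Rightarrow> token list list \<Rightarrow> nat \<Rightarrow> (nat \<times> nat) crossing" where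
  "crossing_of s Ws c = Crossing (s c) (pos Ws (Over c)) (pos Ws (Under c))"

lemma diag_eq: "diag bd s Ws = Diagram (length Ws) bd (crossing_of s Ws ` names Ws)"
  by (simp add: diag_def crossing_of_def[abs_def])

lemma pos_eq_iff:
  assumes "gauss_word s Ws" "t \<in> set (concat Ws)" "t' \<in> set (concat Ws)"
  shows "pos Ws t = pos Ws t' \<longleftrightarrow> t = t'"
proof -
  have d: "distinct (concat Ws)" using assms by (simp add: gauss_word_def)
  show ?thesis
    using token_at_iff_pos[OF d] assms(2,3) token_at_fun by metis
qed

lemma inj_on_crossing_of: "gauss_word s Ws \<Longrightarrow> inj_on (crossing_of s Ws) (names Ws)"
  by (auto simp: inj_on_def crossing_of_def pos_eq_iff set_gauss_word simp del: set_concat)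

lemma redex_pos:
  assumes g: "gauss_word s Ws"
  shows "redex Ws a b \<longleftrightarrow> a \<in> names Ws \<and> b \<in> names Ws \<and> a \<noteq> b \<and>
    pos Ws (Over b) = (fst (pos Ws (Under a)), snd (pos Ws (Under a)) + 1)"
proof -
  have d: "distinct (concat Ws)" using g by (simp add: gauss_word_def)
  show ?thesis
  proof
    assume r: "redex Ws a b"
    then obtain k u v where k: "k < length Ws" "Ws ! k = u @ [Under a, Over b] @ v"
      by (auto simp: redex_def sublist_def in_set_conv_nth)
    then have "token_at Ws (k, length u) (Under a)" "token_at Ws (k, length u + 1) (Over b)"
      by (auto simp: token_at_def nth_append)
    then show "a \<in> names Ws \<and> b \<in> names Ws \<and> a \<noteq> b \<and>
        pos Ws (Over b) = (fst (pos Ws (Under a)), snd (pos Ws (Under a)) + 1)"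
      using redexD[OF g r] token_at_iff_pos[OF d] by (metis fst_conv snd_conv)
  next
    assume a: "a \<in> names Ws \<and> b \<in> names Ws \<and> a \<noteq> b \<and>
        pos Ws (Over b) = (fst (pos Ws (Under a)), snd (pos Ws (Under a)) + 1)"
    obtain k i where p: "pos Ws (Under a) = (k, i)" by (cases "pos Ws (Under a)")
    have "token_at Ws (k, i) (Under a)" "token_at Ws (k, i + 1) (Over b)"
      using a p unfolding token_at_iff_pos[OF d] set_gauss_word[OF g] by auto
    then have k: "k < length Ws" "i + 1 < length (Ws ! k)" "Ws ! k ! i = Under a" "Ws ! k ! (i + 1) = Over b"
      by (auto simp: token_at_def)
    then have "Ws ! k = take i (Ws ! k) @ [Under a, Over b] @ drop (i + 2) (Ws ! k)"
      using id_take_nth_drop[of i "Ws ! k"] Cons_nth_drop_Suc[of "i + 1" "Ws ! k"] by simp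
    then have "sublist [Under a, Over b] (Ws ! k)" unfolding sublist_def by blast
    then show "redex Ws a b" using a k by (auto simp: redex_def)
  qed
qed

context
  fixes s Ws a b y z
  assumes g: "gauss_word s Ws" and r: "redex Ws a b" and f: "fresh y z Ws"
begin

text \<open>The substitutions differ on \<open>Under a\<close> and \<open>Over b\<close> alone.
  These tokens are adjacent, and both substitutions turn the pair into \<open>Over b\<close>,
  \<open>Under a\<close>.\<close>

lemma glide_words_swap: "glide_words s a b y z Ws = map (expand (swap_token s a b y z)) Ws"
proof -
  have "expand (glide_token s a b y z) w = expand (swap_token s a b y z) w" if w: "w \<in> set Ws" for w
  proof (cases "Under a \<in> set w \<or> Over b \<in> set w")
    case True
    obtain w' where w': "w' \<in> set Ws" "sublist [Under a, Over b] w'" using r by (auto simp: redex_def)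
    then have "Under a \<in> set w'" "Over b \<in> set w'" by (auto simp: sublist_def)
    then have "w = w'" using same_word g w w' True by (metis gauss_word_def)
    then obtain u v where uv: "w = u @ [Under a, Over b] @ v" using w' by (auto simp: sublist_def)
    have "distinct w" using distinct_word w g by (auto simp: gauss_word_def)
    then have "expand (glide_token s a b y z) u = expand (swap_token s a b y z) u"
      "expand (glide_token s a b y z) v = expand (swap_token s a b y z) v"
      using uv by (auto intro!: expand_cong simp: swap_token_def)
    then show ?thesis using uv by (simp add: swap_token_def glide_token_def)
  next
    case False
    then show ?thesis by (intro expand_cong) (auto simp: swap_token_def)
  qed
  then show ?thesis by (simp add: glide_words_def)
qed

text \<open>Read off from \<open>glide_crossings\<close>: \<open>b\<close> goes over where
  \<open>a\<close> went under, \<open>a\<close> goes under where \<open>b\<close> went over, and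
  \<open>y\<close>, \<open>z\<close> are the new crossings of sign s a * s b and its
  opposite.\<close>

fun new_position :: "token \<Rightarrow> nat \<times> rat" where
  "new_position (Over c) =
     (if c = b then rational_position (pos Ws (Under a))
      else if c = y then shift (pos Ws (Over a)) (- s a)
      else if c = z then shift (pos Ws (Over a)) (s a)
      else rational_position (pos Ws (Over c)))"
| "new_position (Under c) =
     (if c = a then rational_position (pos Ws (Over b))
      else if c = y then shift (pos Ws (Under b)) (s b)
      else if c = z then shift (pos Ws (Under b)) (- s b)
      else rational_position (pos Ws (Under c)))"

text \<open>This ties the thirds of the glide move to the order in \<open>glide_token\<close>: for
  sign 1 the shift of \<open>y\<close> is -1/3 on the over strand, where it is listed first, and
  +1/3 on the under strand, where it is listed last.\<close>

lemma new_position_block: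
  assumes t: "t \<in> set (concat Ws)" and m: "m < length (swap_token s a b y z t)"
  shows "new_position (swap_token s a b y z t ! m) =
    (fst (pos Ws t), of_nat (snd (pos Ws t)) + rational_offset (length (swap_token s a b y z t)) m)"
proof -
  have n: "t \<in> Over ` names Ws \<union> Under ` names Ws" using t unfolding set_gauss_word[OF g] .
  then have new: "t \<noteq> Over y" "t \<noteq> Over z" "t \<noteq> Under y" "t \<noteq> Under z"
    using f by (auto simp: fresh_def)
  note ab = redexD[OF g r]
  then have ne: "y \<noteq> a" "z \<noteq> a" "y \<noteq> b" "z \<noteq> b" "y \<noteq> z" "a \<noteq> b" using f by (auto simp: fresh_def)
  show ?thesis
  proof (cases "t = Over a \<or> t = Under b")
    case True
    then have m: "m \<in> {0, 1, 2}" using m ne unfolding length_swap_token by auto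
    have l: "length (swap_token s a b y z t) = 3" using True ne(6) by (auto simp: length_swap_token)
    show ?thesis
      using True
    proof
      assume t: "t = Over a"
      have "swap_token s a b y z t =
          (if s a = 1 then [Over y, Over a, Over z] else [Over z, Over a, Over y])"
        using ne by (simp add: swap_token_def glide_token_def t)
      then show ?thesis
        unfolding l using m ne sign_cases[OF g, of a]
        by (auto simp: t rational_offset_def shift_def rational_position_def)
    next
      assume t: "t = Under b"
      have "swap_token s a b y z t =
          (if s b = 1 then [Under z, Under b, Under y] else [Under y, Under b, Under z])"
        using ne by (simp add: swap_token_def glide_token_def t)
      then show ?thesis
        unfolding l using m ne sign_cases[OF g, of b]
        by (auto simp: t rational_offset_def shift_def rational_position_def)
    qed
  next
    case False
    then have "m = 0" using m ne unfolding length_swap_token by auto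
    then show ?thesis
      by (insert False ne new, cases t) (auto simp: swap_token_def glide_token_def rational_offset_def rational_position_def)
  qed
qed

lemma rational_at_iff:
  "rational_at (swap_token s a b y z) Ws p t \<longleftrightarrow>
     t \<in> set (concat (glide_words s a b y z Ws)) \<and> p = new_position t"
proof -
  have d: "distinct (concat Ws)" using g by (simp add: gauss_word_def)
  let ?\<sigma> = "swap_token s a b y z"
  have "rational_at ?\<sigma> Ws p t \<longleftrightarrow> (\<exists>u\<in>set (concat Ws). \<exists>m<length (?\<sigma> u).
      p = (fst (pos Ws u), of_nat (snd (pos Ws u)) + rational_offset (length (?\<sigma> u)) m) \<and> t = ?\<sigma> u ! m)"
    unfolding rational_at_def token_at_iff_pos[OF d] by blast
  also have "\<dots> \<longleftrightarrow> (\<exists>u\<in>set (concat Ws). \<exists>m<length (?\<sigma> u). p = new_position (?\<sigma> u ! m) \<and> t = ?\<sigma> u ! m)"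
    by (intro bex_cong refl ex_cong1) (metis new_position_block)
  also have "\<dots> \<longleftrightarrow> t \<in> set (concat (glide_words s a b y z Ws)) \<and> p = new_position t"
    unfolding glide_words_swap concat_map_expand set_expand by (auto simp: in_set_conv_nth)
  finally show ?thesis .
qed

lemma glide_crossings_eq:
  "glide_crossings (crossing_of s Ws ` names Ws) (crossing_of s Ws a) (crossing_of s Ws b) =
     (\<lambda>c. Crossing (glide_sign s a b y z c) (new_position (Over c)) (new_position (Under c))) `
       (names Ws \<union> {y, z})"
  (is "?L = ?f ` _")
proof -
  note ab = redexD[OF g r]
  have yz: "y \<notin> names Ws" "z \<notin> names Ws" "y \<noteq> z" using f by (auto simp: fresh_def)
  then have ne: "y \<noteq> a" "z \<noteq> a" "y \<noteq> b" "z \<noteq> b" using ab by auto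
  have "crossing_of s Ws ` names Ws - {crossing_of s Ws a, crossing_of s Ws b} =
      crossing_of s Ws ` (names Ws - {a, b})"
    using ab inj_on_crossing_of[OF g] by (auto simp: inj_on_def)
  moreover have "map_crossing rational_position ` crossing_of s Ws ` (names Ws - {a, b}) =
      ?f ` (names Ws - {a, b})"
    unfolding image_image using yz
    by (intro image_cong) (auto simp: crossing_of_def glide_sign_def)
  moreover have "names Ws \<union> {y, z} = (names Ws - {a, b}) \<union> {b, a} \<union> {y, z}" using ab by auto
  ultimately show ?thesis
    using ne ne[symmetric] yz(3) yz(3)[symmetric] ab(1) ab(1)[symmetric]
    by (simp add: glide_crossings_def Let_def image_Un crossing_of_def glide_sign_def)
qed

text \<open>The positions to be ranked are those of \<open>rational_at\<close>, so the rank of each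
  is its place in the new word. As \<open>y\<close> and \<open>z\<close> are absent on the left, the
  new diagram does not depend on their names.\<close>

lemma renumber_glide_crossings:
  "renumber (glide_crossings (crossing_of s Ws ` names Ws) (crossing_of s Ws a) (crossing_of s Ws b)) =
     crossing_of (glide_sign s a b y z) (glide_words s a b y z Ws) ` names (glide_words s a b y z Ws)"
proof -
  let ?W = "glide_words s a b y z Ws"
  let ?\<sigma> = "swap_token s a b y z"
  let ?P = "{p. \<exists>t. rational_at ?\<sigma> Ws p t}"
  have g': "gauss_word (glide_sign s a b y z) ?W" using gauss_word_glide[OF g r f] .
  have d: "distinct (concat ?W)" using g' by (simp add: gauss_word_def)
  have P: "positions (glide_crossings (crossing_of s Ws ` names Ws) (crossing_of s Ws a) (crossing_of s Ws b)) = ?P"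
  proof -
    have "?P = new_position ` set (concat ?W)" unfolding rational_at_iff by blast
    then show ?thesis
      unfolding glide_crossings_eq positions_def set_gauss_word[OF g'] names_glide_words[OF g r f]
      by (simp add: image_image image_Un del: new_position.simps)
  qed
  have "rank ?P (new_position t) = pos ?W t" if "t \<in> set (concat ?W)" for t
  proof -
    have "token_at ?W (rank ?P (new_position t)) t"
      unfolding glide_words_swap
      by (rule rank_rational_at) (use that in \<open>auto simp: length_swap_token rational_at_iff simp del: new_position.simps set_concat\<close>)
    then show ?thesis unfolding token_at_iff_pos[OF d] by simp
  qed
  then have "map_crossing (rank ?P) (Crossing (glide_sign s a b y z c) (new_position (Over c))
      (new_position (Under c))) = crossing_of (glide_sign s a b y z) ?W c"
    if "c \<in> names ?W" for c
    using that unfolding set_gauss_word[OF g'] crossing_of_def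
    by (simp del: new_position.simps)
  then show ?thesis
    unfolding renumber_def P unfolding glide_crossings_eq image_image names_glide_words[OF g r f, symmetric]
    by (rule image_cong[OF refl])
qed

end

lemma exists_fresh: "\<exists>y z. fresh y z Ws"
proof -
  obtain y where "y \<notin> names Ws" using ex_new_if_finite[OF infinite_UNIV_nat finite_names] by blast
  moreover obtain z where "z \<notin> insert y (names Ws)"
    using ex_new_if_finite[OF infinite_UNIV_nat, of "insert y (names Ws)"] by auto
  ultimately show ?thesis by (auto simp: fresh_def)
qed

lemma glide_diag:
  assumes "gauss_word s Ws" "redex Ws a b" "fresh y z Ws"
  shows "glide (diag bd s Ws) (diag bd (glide_sign s a b y z) (glide_words s a b y z Ws))"
proof -
  have "crossing_of s Ws a \<noteq> crossing_of s Ws b"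
    using redexD[OF assms(1,2)] inj_on_crossing_of[OF assms(1)] by (auto simp: inj_on_def)
  moreover have "over (crossing_of s Ws b) =
      (fst (under (crossing_of s Ws a)), snd (under (crossing_of s Ws a)) + 1)"
    using assms(2) unfolding redex_pos[OF assms(1)] by (simp add: crossing_of_def)
  moreover have "length (glide_words s a b y z Ws) = length Ws" by (simp add: glide_words_def)
  ultimately show ?thesis
    using redexD[OF assms(1,2)] renumber_glide_crossings[OF assms]
    unfolding glide_def diag_eq
    by (intro bexI[of _ "crossing_of s Ws a"] bexI[of _ "crossing_of s Ws b"]) auto
qed

text \<open>The conclusion covers all fresh names, so that two diverging moves can be given
  coordinated names when they are joined.\<close>

lemma glide_diagE:
  assumes g: "gauss_word s Ws" and E: "glide (diag bd s Ws) E"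
  obtains a b where "redex Ws a b"
    "\<And>y z. fresh y z Ws \<Longrightarrow> E = diag bd (glide_sign s a b y z) (glide_words s a b y z Ws)"
proof -
  obtain a b where ab: "a \<in> names Ws" "b \<in> names Ws" "crossing_of s Ws a \<noteq> crossing_of s Ws b"
    "over (crossing_of s Ws b) =
      (fst (under (crossing_of s Ws a)), snd (under (crossing_of s Ws a)) + 1)"
    and E: "E = Diagram (length Ws) bd
      (renumber (glide_crossings (crossing_of s Ws ` names Ws) (crossing_of s Ws a) (crossing_of s Ws b)))"
    using E unfolding glide_def diag_eq diagram.sel by blast
  then have r: "redex Ws a b" unfolding redex_pos[OF g] by (auto simp: crossing_of_def)
  show ?thesis
  proof (rule that[OF r])
    fix y z assume "fresh y z Ws"
    from renumber_glide_crossings[OF g r this]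
    show "E = diag bd (glide_sign s a b y z) (glide_words s a b y z Ws)"
      unfolding E diag_eq by (simp add: glide_words_def)
  qed
qed

section \<open>Gauss data, OU and acyclicity in terms of words\<close>

lemma positions_diag:
  assumes g: "gauss_word s Ws"
  shows "positions (crossings (diag bd s Ws)) = {(k, i). k < length Ws \<and> i < length (Ws ! k)}"
proof -
  have d: "distinct (concat Ws)" using g by (simp add: gauss_word_def)
  have "positions (crossings (diag bd s Ws)) = pos Ws ` set (concat Ws)"
    unfolding set_gauss_word[OF g]
    by (simp add: diag_def positions_def image_image image_Un)
  also have "\<dots> = {p. \<exists>t. token_at Ws p t}" unfolding token_at_iff_pos[OF d] by blast
  also have "\<dots> = {(k, i). k < length Ws \<and> i < length (Ws ! k)}" by (auto simp: token_at_def)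
  finally show ?thesis .
qed

lemma passages_diag:
  assumes "gauss_word s Ws" "k < length Ws"
  shows "passages (diag bd s Ws) k = length (Ws ! k)"
  using assms by (simp add: passages_def positions_diag)

lemma gauss_diag:
  assumes g: "gauss_word s Ws"
    and bd: "distinct bd" "set bd = Start ` {..<length Ws} \<union> End ` {..<length Ws}"
  shows "gauss_diagram (diag bd s Ws)"
proof -
  have "inj_on over (crossing_of s Ws ` names Ws)" "inj_on under (crossing_of s Ws ` names Ws)"
    "over ` crossing_of s Ws ` names Ws \<inter> under ` crossing_of s Ws ` names Ws = {}"
    using pos_eq_iff[OF g] unfolding set_gauss_word[OF g]
    by (auto simp: inj_on_def crossing_of_def)
  moreover have "sign ` crossing_of s Ws ` names Ws \<subseteq> {1, -1}"
    using g by (auto simp: crossing_of_def gauss_word_def)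
  moreover have "positions (crossings (diag bd s Ws)) =
      {(k, i). k < strands (diag bd s Ws) \<and> i < passages (diag bd s Ws) k}"
    using positions_diag[OF g] passages_diag[OF g] by (auto simp: diag_def)
  ultimately show ?thesis using bd by (simp add: gauss_diagram_def diag_eq)
qed

lemma distinct_pairs: "distinct (concat (map (\<lambda>k. map (Pair k) [0..<p k]) [0..<n]))"
  by (induction n) (auto simp: distinct_map inj_on_def)

lemma gauss_diagram_word:
  assumes D: "gauss_diagram D"
  shows "\<exists>s Ws. gauss_word s Ws \<and> D = diag (boundary D) s Ws"
proof -
  let ?X = "crossings D"
  have X: "finite ?X" "sign ` ?X \<subseteq> {1, -1}" "inj_on over ?X" "inj_on under ?X"
    "over ` ?X \<inter> under ` ?X = {}"
    and P: "positions ?X = {(k, i). k < strands D \<and> i < passages D k}"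
    using D by (auto simp: gauss_diagram_def)
  \<comment> \<open>The names of the crossings: any injection into the natural numbers.\<close>
  obtain f :: "(nat \<times> nat) crossing \<Rightarrow> nat" where f: "inj_on f ?X"
    using finite_imp_inj_to_nat_seg[OF X(1)] by blast
  define T where "T p = (if p \<in> over ` ?X then Over (f (inv_into ?X over p))
    else Under (f (inv_into ?X under p)))" for p
  define Ws where "Ws = map (\<lambda>k. map (\<lambda>i. T (k, i)) [0..<passages D k]) [0..<strands D]"
  \<comment> \<open>The default 1 is there because \<open>gauss_word\<close> asks for a sign of
    every number.\<close>
  define s where "s c = (if c \<in> f ` ?X then sign (inv_into ?X f c) else 1)" for c
  have T: "T (over x) = Over (f x)" "T (under x) = Under (f x)" if "x \<in> ?X" for x
    using that X(5) inv_into_f_f[OF X(3) that] inv_into_f_f[OF X(4) that] unfolding T_def by auto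
  have inj: "inj_on T (positions ?X)"
    unfolding positions_def
    by (rule inj_onI, elim UnE imageE) (simp_all add: T inj_on_eq_iff[OF f])
  have c: "concat Ws = map T (concat (map (\<lambda>k. map (Pair k) [0..<passages D k]) [0..<strands D]))"
    by (simp add: Ws_def map_concat comp_def)
  have sp: "set (concat (map (\<lambda>k. map (Pair k) [0..<passages D k]) [0..<strands D])) = positions ?X"
    unfolding P by auto
  have dist: "distinct (concat Ws)"
    unfolding c distinct_map sp using distinct_pairs inj by blast
  have set: "set (concat Ws) = Over ` f ` ?X \<union> Under ` f ` ?X"
    unfolding c set_map sp by (simp add: positions_def T image_Un image_image)
  have "s c = 1 \<or> s c = -1" for c
    using X(2) inv_into_into[of c f ?X] unfolding s_def by auto
  then have g: "gauss_word s Ws"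
    using dist unfolding gauss_word_def set by blast
  have names: "names Ws = f ` ?X" unfolding names_def set by auto
  have at: "token_at Ws p (T p)" if p: "p \<in> positions ?X" for p
  proof -
    obtain k i where ki: "p = (k, i)" by (cases p)
    then have "k < strands D" "i < passages D k" using p unfolding P by simp_all
    then show ?thesis unfolding ki token_at_def Ws_def by simp
  qed
  have "crossing_of s Ws (f x) = x" if x: "x \<in> ?X" for x
  proof -
    have "pos Ws (Over (f x)) = over x" "pos Ws (Under (f x)) = under x"
      using at[of "over x"] at[of "under x"] x unfolding token_at_iff_pos[OF dist]
      by (auto simp: positions_def T)
    moreover have "s (f x) = sign x" using x f by (simp add: s_def)
    ultimately show ?thesis by (simp add: crossing_of_def)
  qed
  then have "crossing_of s Ws ` names Ws = ?X" unfolding names image_image by simp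
  then have "D = diag (boundary D) s Ws" unfolding diag_eq by (cases D) (simp add: Ws_def)
  then show ?thesis using g by blast
qed

lemma chain_pos:
  assumes g: "gauss_word s Ws"
  shows "(c, d) \<in> chain Ws \<longleftrightarrow> c \<in> names Ws \<and> d \<in> names Ws \<and>
    fst (pos Ws (Under c)) = fst (pos Ws (Over d)) \<and> snd (pos Ws (Under c)) < snd (pos Ws (Over d))"
proof -
  have dist: "distinct (concat Ws)" using g by (simp add: gauss_word_def)
  have "(c, d) \<in> chain Ws \<longleftrightarrow> (\<exists>k<length Ws. before (Ws ! k) (Under c) (Over d))"
    by (simp add: chain_def Bex_def in_set_conv_nth) blast
  also have "\<dots> \<longleftrightarrow> (\<exists>k i j. i < j \<and> token_at Ws (k, i) (Under c) \<and> token_at Ws (k, j) (Over d))"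
    unfolding before_nth token_at_def fst_conv snd_conv by (blast intro: less_trans)
  also have "\<dots> \<longleftrightarrow> c \<in> names Ws \<and> d \<in> names Ws \<and>
      fst (pos Ws (Under c)) = fst (pos Ws (Over d)) \<and> snd (pos Ws (Under c)) < snd (pos Ws (Over d))"
    unfolding token_at_iff_pos[OF dist] set_gauss_word[OF g]
    by (auto simp: prod_eq_iff) 
  finally show ?thesis .
qed

lemma OU_diag:
  assumes g: "gauss_word s Ws"
  shows "OU (diag bd s Ws) \<longleftrightarrow> chain Ws = {}"
proof -
  have o: "over ` crossings (diag bd s Ws) = (\<lambda>c. pos Ws (Over c)) ` names Ws"
    and u: "under ` crossings (diag bd s Ws) = (\<lambda>c. pos Ws (Under c)) ` names Ws"
    by (simp_all add: diag_def image_image)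
  have "OU (diag bd s Ws) \<longleftrightarrow> (\<forall>c\<in>names Ws. \<forall>d\<in>names Ws.
      fst (pos Ws (Under c)) = fst (pos Ws (Over d)) \<longrightarrow> snd (pos Ws (Over d)) < snd (pos Ws (Under c)))"
    (is "_ \<longleftrightarrow> ?R")
  proof
    assume ou: "OU (diag bd s Ws)"
    show ?R
    proof (intro ballI impI)
      fix c d assume n: "c \<in> names Ws" "d \<in> names Ws"
        and e: "fst (pos Ws (Under c)) = fst (pos Ws (Over d))"
      have "(fst (pos Ws (Over d)), snd (pos Ws (Over d))) \<in> over ` crossings (diag bd s Ws)"
        "(fst (pos Ws (Over d)), snd (pos Ws (Under c))) \<in> under ` crossings (diag bd s Ws)"
        unfolding o u e[symmetric] unfolding e unfolding prod.collapse using n e[symmetric] by auto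
      then show "snd (pos Ws (Over d)) < snd (pos Ws (Under c))" using ou unfolding OU_def by blast
    qed
  next
    assume r: ?R
    show "OU (diag bd s Ws)"
      unfolding OU_def o u
    proof (intro allI impI, elim imageE)
      fix k i j d c
      assume "(k, i) = pos Ws (Over d)" "d \<in> names Ws" "(k, j) = pos Ws (Under c)" "c \<in> names Ws"
      then show "i < j" using r by (metis fst_conv snd_conv)
    qed
  qed
  also have "\<dots> \<longleftrightarrow> (\<forall>c\<in>names Ws. \<forall>d\<in>names Ws.
      fst (pos Ws (Under c)) = fst (pos Ws (Over d)) \<longrightarrow> \<not> snd (pos Ws (Under c)) < snd (pos Ws (Over d)))"
  proof (intro ball_cong refl)
    fix c d assume "c \<in> names Ws" "d \<in> names Ws"
    \<comment> \<open>Over and under passages never share a position, so one strict inequality is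
      the negation of the reversed one, also for c = d.\<close>
    then have "pos Ws (Under c) \<noteq> pos Ws (Over d)"
      using pos_eq_iff[OF g] unfolding set_gauss_word[OF g] by auto
    then show "(fst (pos Ws (Under c)) = fst (pos Ws (Over d)) \<longrightarrow> snd (pos Ws (Over d)) < snd (pos Ws (Under c)))
      = (fst (pos Ws (Under c)) = fst (pos Ws (Over d)) \<longrightarrow> \<not> snd (pos Ws (Under c)) < snd (pos Ws (Over d)))"
      by (auto simp: prod_eq_iff)
  qed
  also have "\<dots> \<longleftrightarrow> chain Ws = {}"
    using chain_pos[OF g] by auto
  finally show ?thesis .
qed

lemma cascade_diag:
  assumes g: "gauss_word s Ws"
  shows "cascade (diag bd s Ws) =
    {((k, i), (k, i + 1)) | k i. k < length Ws \<and> i < length (Ws ! k)} \<union>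
    {(pos Ws (Over c), (fst (pos Ws (Under c)), snd (pos Ws (Under c)) + 1)) | c. c \<in> names Ws}"
proof -
  have "{((k, i), (l, j + 1)) | s' k i l j. Crossing s' (k, i) (l, j) \<in> crossings (diag bd s Ws)} =
    {(pos Ws (Over c), (fst (pos Ws (Under c)), snd (pos Ws (Under c)) + 1)) | c. c \<in> names Ws}"
    (is "?L = ?R")
  proof (intro equalityI subsetI)
    fix x assume "x \<in> ?L"
    then obtain s' k i l j where x: "x = ((k, i), (l, j + 1))"
      "Crossing s' (k, i) (l, j) \<in> crossings (diag bd s Ws)" by blast
    then obtain c where "c \<in> names Ws" "(k, i) = pos Ws (Over c)" "(l, j) = pos Ws (Under c)"
      by (auto simp: diag_def)
    then show "x \<in> ?R" unfolding x(1) by (metis (mono_tags, lifting) CollectI fst_conv snd_conv)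
  next
    fix x assume "x \<in> ?R"
    then obtain c where c: "c \<in> names Ws"
      "x = (pos Ws (Over c), (fst (pos Ws (Under c)), snd (pos Ws (Under c)) + 1))" by blast
    obtain k i l j where p: "pos Ws (Over c) = (k, i)" "pos Ws (Under c) = (l, j)" by fastforce
    then have "Crossing (s c) (k, i) (l, j) \<in> crossings (diag bd s Ws)"
      using c(1) by (force simp: diag_def)
    then show "x \<in> ?L" unfolding c(2) p fst_conv snd_conv by blast
  qed
  then show ?thesis unfolding cascade_def positions_diag[OF g] by auto
qed

text \<open>An edge c -> d lifts to a cascade path: from the arc behind \<open>Under c\<close> along
  the strand to \<open>Over d\<close>, then down. Conversely, a height function of the chain
  relation yields a lexicographic measure that falls along every cascade step.\<close>

lemma acyclic_diag:
  assumes g: "gauss_word s Ws"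
  shows "acyclic_diagram (diag bd s Ws) \<longleftrightarrow> acyclic (chain Ws)"
proof (rule iffI)
  let ?C = "cascade (diag bd s Ws)"
  have dist: "distinct (concat Ws)" using g by (simp add: gauss_word_def)
  have range: "fst (pos Ws t) < length Ws" "snd (pos Ws t) < length (Ws ! fst (pos Ws t))"
    if "t \<in> set (concat Ws)" for t
    using that token_at_iff_pos[OF dist, of "pos Ws t" t] by (auto simp: token_at_def)
  \<comment> \<open>The arc reached by dropping at \<open>c\<close>.\<close>
  define u where "u c = (fst (pos Ws (Under c)), snd (pos Ws (Under c)) + 1)" for c
  show "acyclic (chain Ws)" if ac: "acyclic_diagram (diag bd s Ws)"
  proof -
    have along: "((k, i), (k, j)) \<in> ?C\<^sup>*" if "i \<le> j" "k < length Ws" "j < length (Ws ! k)" for k i j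
      using that(1,3)
    proof (induction j rule: dec_induct)
      case (step n)
      then have "((k, n), (k, n + 1)) \<in> ?C" using that(2,3) unfolding cascade_diag[OF g] by auto
      then show ?case using step by (simp add: rtrancl_into_rtrancl)
    qed simp
    have step: "(u c, u d) \<in> ?C\<^sup>+" if cd: "(c, d) \<in> chain Ws" for c d
    proof -
      have n: "d \<in> names Ws" "fst (pos Ws (Under c)) = fst (pos Ws (Over d))"
        "snd (pos Ws (Under c)) < snd (pos Ws (Over d))"
        using cd chain_pos[OF g] by auto
      then have "(u c, (fst (pos Ws (Over d)), snd (pos Ws (Over d)))) \<in> ?C\<^sup>*"
        using range[of "Over d"] unfolding u_def set_gauss_word[OF g] n by (intro along) auto
      moreover have "(pos Ws (Over d), u d) \<in> ?C" using n by (auto simp: cascade_diag[OF g] u_def)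
      ultimately show ?thesis by (simp add: rtrancl_into_trancl1)
    qed
    have "(u c, u d) \<in> ?C\<^sup>+" if "(c, d) \<in> (chain Ws)\<^sup>+" for c d
      using that by (induction rule: trancl.induct) (blast intro: step trancl_trans)+
    then show ?thesis
      using ac unfolding acyclic_diagram_def acyclic_def by blast
  qed
  show "acyclic_diagram (diag bd s Ws)" if ac: "acyclic (chain Ws)"
  proof -
    obtain h :: "nat \<Rightarrow> nat" where h: "\<And>c d. (c, d) \<in> chain Ws \<Longrightarrow> h d < h c"
      using acyclic_descending_exists[OF _ chain_names[OF g] ac] by auto
    \<comment> \<open>Heights of the crossings at which the path can still drop from its present
      strand; the arc (k, i) lies before passage i, hence the weak inequality. Adding 1 keeps them
      above the default 0 of a strand without further drops.\<close>
    define S where "S p = {h c + 1 | c. c \<in> names Ws \<and> fst (pos Ws (Over c)) = fst p \<and>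
      snd p \<le> snd (pos Ws (Over c))}" for p
    define H where "H p = Max (insert 0 (S p))" for p
    have fin: "finite (insert 0 (S p))" for p
    proof -
      have "S p \<subseteq> (\<lambda>c. h c + 1) ` names Ws" by (auto simp: S_def)
      then have "finite (S p)" by (rule finite_subset) simp
      then show ?thesis by simp
    qed
    have mono: "H (k, Suc i) \<le> H (k, i)" for k i
      unfolding H_def by (rule Max_mono[OF _ _ fin]) (auto simp: S_def)
    have drop: "H (u c) < H (pos Ws (Over c))" if c: "c \<in> names Ws" for c
    proof -
      have "h c + 1 \<le> H (pos Ws (Over c))"
        unfolding H_def using c by (intro Max_ge[OF fin]) (auto simp: S_def)
      moreover have "x \<le> h c" if "x \<in> insert 0 (S (u c))" for x
      proof (cases "x = 0")
        case False
        then obtain d where "x = h d + 1" "d \<in> names Ws" "fst (pos Ws (Over d)) = fst (u c)"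
          "snd (u c) \<le> snd (pos Ws (Over d))"
          using \<open>x \<in> insert 0 (S (u c))\<close> by (auto simp: S_def)
        moreover from this have "(c, d) \<in> chain Ws" using c unfolding chain_pos[OF g] u_def by simp
        ultimately show ?thesis using h[of c d] by simp
      qed simp
      then have "H (u c) \<le> h c" unfolding H_def using fin by (subst Max_le_iff) auto
      ultimately show ?thesis by linarith
    qed
    \<comment> \<open>A drop lowers \<open>H\<close>, because the over passages behind
      \<open>Under c\<close> belong to chain successors of \<open>c\<close>. Staying on the strand
      does not raise \<open>H\<close> and uses up a passage.\<close>
    have "?C\<inverse> \<subseteq> inv_image (less_than <*lex*> less_than) (\<lambda>p. (H p, length (Ws ! fst p) - snd p))"
    proof
      fix x assume "x \<in> ?C\<inverse>"
      then consider k i where "x = ((k, Suc i), (k, i))" "i < length (Ws ! k)"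
        | c where "x = (u c, pos Ws (Over c))" "c \<in> names Ws"
        unfolding cascade_diag[OF g] u_def[symmetric] by auto
      then show "x \<in> inv_image (less_than <*lex*> less_than) (\<lambda>p. (H p, length (Ws ! fst p) - snd p))"
      proof cases
        case (1 k i)
        then show ?thesis using mono[of k i] by (auto simp: le_less)
      next
        case (2 c)
        then show ?thesis using drop by simp
      qed
    qed
    then have "wf (?C\<inverse>)" by (rule wf_subset[rotated]) (intro wf_inv_image wf_lex_prod wf_less_than)
    then show ?thesis
      unfolding acyclic_diagram_def using wf_acyclic acyclic_converse by blast
  qed
qed

section \<open>Regions\<close>

text \<open>Choosing successors gives an injective map of the finite forward orbit of e into itself,
  hence a surjective one; the preimage of e in the orbit must be d. Thus the classes in
  \<open>regions\<close> are those of an equivalence relation.\<close>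

lemma sym_rtrancl_permutation:
  assumes "finite S" "R \<subseteq> S \<times> S" and total: "\<And>d. d \<in> S \<Longrightarrow> \<exists>d'. (d, d') \<in> R"
    and inj: "\<And>d d' e. (d, e) \<in> R \<Longrightarrow> (d', e) \<in> R \<Longrightarrow> d = d'"
  shows "sym (R\<^sup>*)"
proof -
  have backwards: "(e, d) \<in> R\<^sup>*" if de: "(d, e) \<in> R" for d e
  proof -
    define A where "A = R\<^sup>* `` {e}"
    have "x \<in> S" if "(e, x) \<in> R\<^sup>*" for x
      using that
    proof (induction rule: rtrancl_induct)
      case base
      then show ?case using de assms(2) by blast
    next
      case (step y z)
      then show ?case using assms(2) by blast
    qed
    then have A: "A \<subseteq> S" by (auto simp: A_def)
    then have "finite A" using assms(1) by (rule finite_subset)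
    define g where "g x = (SOME y. (x, y) \<in> R)" for x
    have g: "(x, g x) \<in> R" if "x \<in> A" for x
      unfolding g_def by (rule someI_ex, rule total) (use that A in blast)
    have "g x \<in> A" if "x \<in> A" for x
      using rtrancl_into_rtrancl[of e x R "g x"] g[OF that] that by (simp add: A_def)
    then have "g ` A \<subseteq> A" by blast
    moreover have "inj_on g A"
    proof (rule inj_onI)
      fix x y assume "x \<in> A" "y \<in> A" "g x = g y"
      then show "x = y" using g[of x] g[of y] inj[of x "g y" y] by simp
    qed
    ultimately have "g ` A = A" using \<open>finite A\<close> by (simp add: endo_inj_surj)
    moreover have "e \<in> A" by (simp add: A_def)
    ultimately have "e \<in> g ` A" by simp
    then obtain x where "x \<in> A" "g x = e" by blast
    then have "x = d" using g[of x] inj[of x e d] de by simp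
    then show ?thesis using \<open>x \<in> A\<close> by (simp add: A_def)
  qed
  show ?thesis
  proof (rule symI)
    fix x y assume "(x, y) \<in> R\<^sup>*"
    then show "(y, x) \<in> R\<^sup>*"
    proof (induction rule: rtrancl_induct)
      case (step y z)
      then show ?case using backwards[of y z] rtrancl_trans[of z y R x] by simp
    qed simp
  qed
qed

lemma class_eq_iff:
  assumes "sym (R\<^sup>*)"
  shows "R\<^sup>* `` {x} = R\<^sup>* `` {y} \<longleftrightarrow> (x, y) \<in> R\<^sup>*"
proof
  assume "(x, y) \<in> R\<^sup>*"
  moreover then have "(y, x) \<in> R\<^sup>*" using assms by (simp add: symD)
  ultimately show "R\<^sup>* `` {x} = R\<^sup>* `` {y}" by (blast intro: rtrancl_trans)
qed auto

text \<open>For counting classes of two quotients that agree on common representatives, without an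
  explicit map between the classes.\<close>

lemma card_image_kernel:
  assumes "\<And>x y. x \<in> K \<Longrightarrow> y \<in> K \<Longrightarrow> f x = f y \<longleftrightarrow> g x = g y"
  shows "card (f ` K) = card (g ` K)"
proof -
  have "bij_betw (\<lambda>c. g (inv_into K f c)) (f ` K) (g ` K)"
    unfolding bij_betw_def
  proof
    have inv: "inv_into K f c \<in> K" "f (inv_into K f c) = c" if "c \<in> f ` K" for c
      using that by (simp_all add: inv_into_into f_inv_into_f)
    show "inj_on (\<lambda>c. g (inv_into K f c)) (f ` K)"
    proof (rule inj_onI)
      fix c d assume cd: "c \<in> f ` K" "d \<in> f ` K" "g (inv_into K f c) = g (inv_into K f d)"
      then have "f (inv_into K f c) = f (inv_into K f d)" using assms inv(1) by simp
      then show "c = d" using cd inv(2) by simp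
    qed
    have "g (inv_into K f (f x)) = g x" if "x \<in> K" for x
      using assms[of "inv_into K f (f x)" x] inv[of "f x"] that by simp
    then show "(\<lambda>c. g (inv_into K f c)) ` f ` K = g ` K"
      unfolding image_image by (rule image_cong[OF refl])
  qed
  then show ?thesis by (rule bij_betw_same_card)
qed

text \<open>
  The regions near a glide move, drawn with the piece 3 running upwards and with \<open>x\<^sub>1\<close> below \<open>x\<^sub>2\<close>.
  The sides leaving the picture are \<open>W1\<close>, \<open>E1\<close> (strand 1, to the west and to the east),
  \<open>W2\<close>, \<open>E2\<close> (strand 2) and \<open>S1\<close>, \<open>N1\<close> (strand 3, down and up), and \<open>M\<close> runs up between the two
  crossings on 3.  After the move, \<open>P\<close> and \<open>Q\<close> leave the crossing of 3 with strand 1 to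
  the west and to the east, and so do \<open>U\<close> and \<open>V\<close> with strand 2.  A prime reverses a side.  The new
  regions are the triangles of \<open>M, P, U'\<close> and of \<open>M', V, Q'\<close>.
\<close>

locale glide_regions =
  fixes S :: "'a set" and R0 :: "('a \<times> 'a) set" and \<phi> :: "'a \<Rightarrow> 'b"
    and E1 E1' W1 W1' S1 S1' N1 N1' E2 E2' W2 W2' M M' :: 'a
    and P P' Q Q' U U' V V' :: 'b
  fixes RD RE SE K
  defines "K \<equiv> S - {M, M'}"
  assumes RD: "RD = R0 \<union> {(M', E1), (W1', M), (S1', W1), (E1', S1),
      (N1', E2), (W2', N1), (M, W2), (E2', M')}"
    and RE: "RE = map_prod \<phi> \<phi> ` R0 \<union>
      {(\<phi> M', V), (U', \<phi> M), (\<phi> S1', U), (V', \<phi> S1),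
       (\<phi> N1', Q), (P', \<phi> N1), (\<phi> M, P), (Q', \<phi> M'),
       (\<phi> W2', P'), (\<phi> W1', \<phi> W2), (U, \<phi> W1), (P, U'),
       (Q, \<phi> E2), (V, Q'), (\<phi> E1', V'), (\<phi> E2', \<phi> E1)}"
    and SE: "SE = \<phi> ` S \<union> {P, P', Q, Q', U, U', V, V'}"
  assumes fin: "finite S" and M: "M \<in> S" "M' \<in> S" "M \<noteq> M'" and R0: "R0 \<subseteq> K \<times> K"
    and ends: "{E1, E1', W1, W1', S1, S1', N1, N1', E2, E2', W2, W2'} \<subseteq> K"
    and inj: "inj_on \<phi> S" and dist: "distinct [P, P', Q, Q', U, U', V, V']"
    and new: "{P, P', Q, Q', U, U', V, V'} \<inter> \<phi> ` S = {}"
    and sym: "sym (RD\<^sup>*)" "sym (RE\<^sup>*)"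
begin

lemma KS: "K \<subseteq> S" by (auto simp: K_def)

lemma phi_M: "d \<in> K \<Longrightarrow> \<phi> d \<noteq> \<phi> M" "d \<in> K \<Longrightarrow> \<phi> d \<noteq> \<phi> M'"
  using inj M by (auto simp: K_def inj_on_def)

lemma new_neq: "d \<in> S \<Longrightarrow> \<phi> d \<notin> {P, P', Q, Q', U, U', V, V'}"
  using new by auto

text \<open>The list gives the single successor of every side outside the image of
  \<open>K\<close>.\<close>

lemma RE_source:
  assumes "(e, e') \<in> RE"
  shows "e \<in> \<phi> ` K \<or>
    (e, e') \<in> {(\<phi> M', V), (U', \<phi> M), (V', \<phi> S1), (P', \<phi> N1), (\<phi> M, P), (Q', \<phi> M'),
      (U, \<phi> W1), (P, U'), (Q, \<phi> E2), (V, Q')}" (is "_ \<or> _ \<in> ?L")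
proof -
  have R: "\<phi> S1' \<in> \<phi> ` K" "\<phi> N1' \<in> \<phi> ` K" "\<phi> W2' \<in> \<phi> ` K" "\<phi> W1' \<in> \<phi> ` K" "\<phi> E1' \<in> \<phi> ` K"
    "\<phi> E2' \<in> \<phi> ` K"
    using ends by simp_all
  have "(e, e') \<in> map_prod \<phi> \<phi> ` R0 \<or> (e, e') \<in> ?L \<or> e = \<phi> S1' \<or> e = \<phi> N1' \<or> e = \<phi> W2' \<or>
      e = \<phi> W1' \<or> e = \<phi> E1' \<or> e = \<phi> E2'"
    using assms unfolding RE Un_iff insert_iff prod.inject empty_iff by argo
  moreover have "e \<in> \<phi> ` K" if "(e, e') \<in> map_prod \<phi> \<phi> ` R0" using that R0 by auto
  ultimately show ?thesis using R by (elim disjE) simp_all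
qed

text \<open>The edges from \<phi> M to \<open>P\<close> to \<open>U'\<close> and back close up and
  no others leave these sides; likewise for \<phi> M', \<open>V\<close>, \<open>Q'\<close>.\<close>

lemma RE_triangle:
  "(\<phi> M, e) \<in> RE\<^sup>* \<Longrightarrow> e \<in> {\<phi> M, P, U'}" "(\<phi> M', e) \<in> RE\<^sup>* \<Longrightarrow> e \<in> {\<phi> M', V, Q'}"
proof -
  have MM: "\<phi> M \<noteq> \<phi> M'" using inj M by (auto simp: inj_on_def)
  have k: "\<phi> d \<notin> {\<phi> M, P, U'}" "\<phi> d \<notin> {\<phi> M', V, Q'}" if "d \<in> K" for d
    using phi_M[OF that] new_neq[of d] KS that by auto
  have 1: "e' \<in> {\<phi> M, P, U'}" if "(e, e') \<in> RE" "e \<in> {\<phi> M, P, U'}" for e e'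
    using RE_source[OF that(1)] that(2) k(1) MM dist new_neq[OF M(1)] new_neq[OF M(2)] by auto
  show "(\<phi> M, e) \<in> RE\<^sup>* \<Longrightarrow> e \<in> {\<phi> M, P, U'}"
    by (induction rule: rtrancl_induct) (simp, rule 1)
  have 2: "e' \<in> {\<phi> M', V, Q'}" if "(e, e') \<in> RE" "e \<in> {\<phi> M', V, Q'}" for e e'
    using RE_source[OF that(1)] that(2) k(2) MM dist new_neq[OF M(1)] new_neq[OF M(2)] by auto
  show "(\<phi> M', e) \<in> RE\<^sup>* \<Longrightarrow> e \<in> {\<phi> M', V, Q'}"
    by (induction rule: rtrancl_induct) (simp, rule 2)
qed

text \<open>Pulls a walk after the move back to one before it. The new sides \<open>P'\<close>,
  \<open>U\<close>, \<open>Q\<close>, \<open>V'\<close> subdivide the turns from \<open>W2'\<close>,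
  \<open>S1'\<close>, \<open>N1'\<close>, \<open>E1'\<close>, so the walk before the move waits at
  these. The sides of the triangles have no shadow.\<close>

definition shadow :: "'b \<Rightarrow> 'a \<Rightarrow> bool" where
  "shadow e d \<longleftrightarrow> e = \<phi> d \<and> d \<in> K \<or> e = P' \<and> d = W2' \<or> e = U \<and> d = S1' \<or> e = Q \<and> d = N1' \<or>
     e = V' \<and> d = E1'"

lemma shadow_phi: "x \<in> S \<Longrightarrow> shadow (\<phi> x) d \<longleftrightarrow> d \<in> K \<and> d = x"
  using new_neq[of x] inj_on_eq_iff[OF inj, of x d] KS by (auto simp: shadow_def)

lemma shadow_new: "shadow P' d \<longleftrightarrow> d = W2'" "shadow U d \<longleftrightarrow> d = S1'" "shadow Q d \<longleftrightarrow> d = N1'"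
  "shadow V' d \<longleftrightarrow> d = E1'" "\<not> shadow P d" "\<not> shadow U' d" "\<not> shadow Q' d" "\<not> shadow V d"
  using new_neq[of d] KS dist by (auto simp: shadow_def)

lemma shadow_step:
  assumes "(e, e') \<in> RE" "shadow e d"
  shows "\<exists>d'. shadow e' d' \<and> (d, d') \<in> RD\<^sup>*"
proof -
  have sub: "x \<in> S" if "x \<in> {E1, E1', W1, W1', S1, S1', N1, N1', E2, E2', W2, W2'}" for x
    using that ends KS by blast
  have kk: "x \<in> K" if "x \<in> {E1, E1', W1, W1', S1, S1', N1, N1', E2, E2', W2, W2'}" for x
    using that ends by blast
  have MK: "M \<notin> K" "M' \<notin> K" by (auto simp: K_def)
  have one: "(x, y) \<in> RD\<^sup>*" if "(x, y) \<in> RD" for x y using that by blast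
  have "(W1', M) \<in> RD" "(M, W2) \<in> RD" "(E2', M') \<in> RD" "(M', E1) \<in> RD"
    unfolding RD by simp_all
  \<comment> \<open>In the two turns opposite to those that are subdivided, the move removes a side:
    \<open>M\<close> between \<open>W1'\<close> and \<open>W2\<close>, and \<open>M'\<close> between
    \<open>E2'\<close> and \<open>E1\<close>.\<close>
  then have two: "(W1', W2) \<in> RD\<^sup>*" "(E2', E1) \<in> RD\<^sup>*" by (simp_all add: r_into_rtrancl rtrancl_into_rtrancl)
  have "(e, e') \<in> map_prod \<phi> \<phi> ` R0 \<or> e \<in> {\<phi> M', U', \<phi> M, Q', P, V} \<or>
      e = \<phi> S1' \<and> e' = U \<or> e = V' \<and> e' = \<phi> S1 \<or> e = \<phi> N1' \<and> e' = Q \<or> e = P' \<and> e' = \<phi> N1 \<or>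
      e = \<phi> W2' \<and> e' = P' \<or> e = \<phi> W1' \<and> e' = \<phi> W2 \<or> e = U \<and> e' = \<phi> W1 \<or>
      e = Q \<and> e' = \<phi> E2 \<or> e = \<phi> E1' \<and> e' = V' \<or> e = \<phi> E2' \<and> e' = \<phi> E1"
    using assms(1) unfolding RE Un_iff insert_iff prod.inject empty_iff by argo
  moreover have ?thesis if r: "(e, e') \<in> map_prod \<phi> \<phi> ` R0"
  proof -
    obtain x y where xy: "e = \<phi> x" "e' = \<phi> y" "(x, y) \<in> R0" using r by auto
    then have "x \<in> S" "y \<in> S" "y \<in> K" using R0 KS by auto
    then show ?thesis using xy assms(2) one[of x y] by (auto simp: shadow_phi RD)
  qed
  moreover have "\<not> e \<in> {\<phi> M', U', \<phi> M, Q', P, V}"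
    using assms(2) M MK by (auto simp: shadow_phi shadow_new)
  moreover have edges: "(S1', W1) \<in> RD\<^sup>*" "(E1', S1) \<in> RD\<^sup>*" "(N1', E2) \<in> RD\<^sup>*" "(W2', N1) \<in> RD\<^sup>*"
    by (rule one, simp add: RD)+
  ultimately show ?thesis
    using assms(2) sub kk two
    by (elim disjE conjE) (simp_all add: shadow_phi shadow_new)
qed

lemma RE_RD:
  assumes "x \<in> K" "y \<in> K" "(\<phi> x, \<phi> y) \<in> RE\<^sup>*"
  shows "(x, y) \<in> RD\<^sup>*"
proof -
  have *: "\<exists>d. shadow e d \<and> (x, d) \<in> RD\<^sup>*" if "(\<phi> x, e) \<in> RE\<^sup>*" for e
    using that
  proof (induction rule: rtrancl_induct)
    case base
    then show ?case using assms(1) KS by (auto simp: shadow_phi)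
  next
    case (step e e')
    then show ?case using shadow_step by (meson rtrancl_trans)
  qed
  show ?thesis using *[OF assms(3)] assms(2) KS by (auto simp: shadow_phi)
qed

text \<open>Since \<open>M\<close> is entered from \<open>W1'\<close> and \<open>M'\<close> from
  \<open>E2'\<close>, the walk after the move waits at the image of the preceding side until the
  walk before the move has passed \<open>M\<close> or \<open>M'\<close>.\<close>

lemma RD_RE:
  assumes "x \<in> K" "(x, y) \<in> RD\<^sup>*"
  shows "y \<in> K \<and> (\<phi> x, \<phi> y) \<in> RE\<^sup>* \<or> y = M \<and> (\<phi> x, \<phi> W1') \<in> RE\<^sup>* \<or> y = M' \<and> (\<phi> x, \<phi> E2') \<in> RE\<^sup>*"
  using assms(2)
proof (induction rule: rtrancl_induct)
  case base
  then show ?case using assms(1) by simp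
next
  case (step d e)
  have e: "(\<phi> W1', \<phi> W2) \<in> RE" "(\<phi> E2', \<phi> E1) \<in> RE"
    "(\<phi> S1', U) \<in> RE" "(U, \<phi> W1) \<in> RE" "(\<phi> E1', V') \<in> RE" "(V', \<phi> S1) \<in> RE"
    "(\<phi> N1', Q) \<in> RE" "(Q, \<phi> E2) \<in> RE" "(\<phi> W2', P') \<in> RE" "(P', \<phi> N1) \<in> RE"
    unfolding RE by simp_all
  note into = rtrancl_into_rtrancl[of "\<phi> x" _ RE]
  note steps = into[OF _ e(1)] into[OF _ e(2)] into[OF into[OF _ e(3)] e(4)]
    into[OF into[OF _ e(5)] e(6)] into[OF into[OF _ e(7)] e(8)] into[OF into[OF _ e(9)] e(10)]
  have MK: "M \<notin> K" "M' \<notin> K" by (auto simp: K_def)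
  have "(d, e) \<in> R0 \<or> d = M' \<and> e = E1 \<or> d = W1' \<and> e = M \<or> d = S1' \<and> e = W1 \<or> d = E1' \<and> e = S1 \<or>
      d = N1' \<and> e = E2 \<or> d = W2' \<and> e = N1 \<or> d = M \<and> e = W2 \<or> d = E2' \<and> e = M'"
    using step(2) unfolding RD Un_iff insert_iff prod.inject empty_iff by argo
  moreover have ?case if "(d, e) \<in> R0"
  proof -
    have "d \<in> K" "e \<in> K" using that R0 by auto
    moreover have "(\<phi> d, \<phi> e) \<in> RE" using imageI[OF that, of "map_prod \<phi> \<phi>"] unfolding RE by simp
    ultimately show ?thesis using step(3) MK into[of "\<phi> d" "\<phi> e"] by auto
  qed
  ultimately show ?case
    using step(3) MK M(3) M(3)[symmetric] ends steps
    by (elim disjE conjE) simp_all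
qed

text \<open>\<open>M\<close> shares its region with \<open>W1'\<close> and \<open>M'\<close> with
  \<open>E2'\<close>, so before the move sides in \<open>K\<close> represent all regions. After the
  move they represent as many, and only the two triangles are missed.\<close>

lemma card_regions: "card (SE // RE\<^sup>*) = card (S // RD\<^sup>*) + 2"
proof -
  let ?cD = "\<lambda>x. RD\<^sup>* `` {x}" and ?cE = "\<lambda>x. RE\<^sup>* `` {x}"
  note eqD = class_eq_iff[OF sym(1)] and eqE = class_eq_iff[OF sym(2)]
  have S_eq: "S = K \<union> {M, M'}" using M by (auto simp: K_def)
  have stepD: "?cD x = ?cD y" if "(x, y) \<in> RD" for x y unfolding eqD using that by (rule r_into_rtrancl)
  have stepE: "?cE x = ?cE y" if "(x, y) \<in> RE" for x y unfolding eqE using that by (rule r_into_rtrancl)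
  have "?cD W1' = ?cD M" "?cD E2' = ?cD M'" by (rule stepD, simp add: RD)+
  moreover have "W1' \<in> K" "E2' \<in> K" using ends by simp_all
  ultimately have "?cD M \<in> ?cD ` K" "?cD M' \<in> ?cD ` K" by (metis imageI)+
  moreover have "S // RD\<^sup>* = ?cD ` S" by (auto simp: quotient_def)
  ultimately have D: "S // RD\<^sup>* = ?cD ` K" unfolding S_eq image_Un by auto
  have "?cE (\<phi> W2') = ?cE P'" "?cE (\<phi> S1') = ?cE U" "?cE (\<phi> N1') = ?cE Q" "?cE (\<phi> E1') = ?cE V'"
    by (rule stepE, simp add: RE)+
  moreover have "\<phi> W2' \<in> \<phi> ` K" "\<phi> S1' \<in> \<phi> ` K" "\<phi> N1' \<in> \<phi> ` K" "\<phi> E1' \<in> \<phi> ` K"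
    using ends by simp_all
  ultimately have o: "?cE P' \<in> ?cE ` \<phi> ` K" "?cE U \<in> ?cE ` \<phi> ` K" "?cE Q \<in> ?cE ` \<phi> ` K"
    "?cE V' \<in> ?cE ` \<phi> ` K"
    by (metis imageI)+
  have tri: "?cE U' = ?cE (\<phi> M)" "?cE (\<phi> M) = ?cE P" "?cE Q' = ?cE (\<phi> M')" "?cE (\<phi> M') = ?cE V"
    by (rule stepE, simp add: RE)+
  have "SE // RE\<^sup>* = ?cE ` SE" by (auto simp: quotient_def)
  also have "\<dots> = ?cE ` \<phi> ` K \<union> {?cE (\<phi> M), ?cE (\<phi> M')}"
    unfolding SE S_eq image_Un using o by (simp add: tri insert_absorb insert_commute)
  finally have E: "SE // RE\<^sup>* = ?cE ` \<phi> ` K \<union> {?cE (\<phi> M), ?cE (\<phi> M')}" .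
  have notK: "?cE (\<phi> M) \<notin> ?cE ` \<phi> ` K" "?cE (\<phi> M') \<notin> ?cE ` \<phi> ` K"
  proof -
    have "\<phi> x \<notin> {\<phi> M, P, U'}" "\<phi> x \<notin> {\<phi> M', V, Q'}" if "x \<in> K" for x
      using phi_M[OF that] new_neq[of x] KS that by auto
    then have "?cE (\<phi> M) \<noteq> ?cE (\<phi> x)" "?cE (\<phi> M') \<noteq> ?cE (\<phi> x)" if "x \<in> K" for x
      unfolding eqE using RE_triangle[of "\<phi> x"] that by blast+
    then show "?cE (\<phi> M) \<notin> ?cE ` \<phi> ` K" "?cE (\<phi> M') \<notin> ?cE ` \<phi> ` K" by blast+
  qed
  moreover have "?cE (\<phi> M) \<noteq> ?cE (\<phi> M')"
    unfolding eqE using RE_triangle(1)[of "\<phi> M'"] inj M new_neq[OF M(2)] by (auto simp: inj_on_def)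
  moreover have "finite (?cE ` \<phi> ` K)" using fin by (simp add: K_def)
  ultimately have "card (SE // RE\<^sup>*) = card (?cE ` \<phi> ` K) + 2" unfolding E by simp
  also have "card (?cE ` \<phi> ` K) = card (?cD ` K)"
    unfolding image_image
  proof (rule card_image_kernel)
    fix x y assume xy: "x \<in> K" "y \<in> K"
    have "y \<noteq> M" "y \<noteq> M'" using xy by (auto simp: K_def)
    then show "?cE (\<phi> x) = ?cE (\<phi> y) \<longleftrightarrow> ?cD x = ?cD y"
      unfolding eqE eqD using RE_RD[OF xy] RD_RE[OF xy(1)] by blast
  qed
  finally show ?thesis by (simp add: D)
qed

end

section \<open>The left-turn permutation of a diagram\<close>

definition star_turns :: "side list \<Rightarrow> (side \<times> side) set" where
  "star_turns v = {(reverse_side (v ! ((m + 1) mod length v)), v ! m) | m. m < length v}"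

lemma reverse_reverse_side [simp]: "reverse_side (reverse_side d) = d"
  by (cases d) auto

lemma reverse_side_iff: "reverse_side d = e \<longleftrightarrow> d = reverse_side e"
  by auto

lemma left_turn_stars: "left_turn D = (\<Union>v\<in>stars D. star_turns v)"
  unfolding left_turn_def star_turns_def reverse_side_iff by blast

lemma star_turns_4: "star_turns [a, b, c, d] =
    {(reverse_side b, a), (reverse_side c, b), (reverse_side d, c), (reverse_side a, d)}"
proof -
  have "star_turns [a, b, c, d] =
      (\<lambda>m. (reverse_side ([a, b, c, d] ! ((m + 1) mod 4)), [a, b, c, d] ! m)) ` {..<4}"
    by (auto simp: star_turns_def image_iff)
  also have "{..<4} = {0, 1, 2, 3 :: nat}" by auto
  finally show ?thesis by simp
qed

lemma star_turns_map:
  assumes "\<And>d. \<phi> (reverse_side d) = reverse_side (\<phi> d)"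
  shows "star_turns (map \<phi> v) = map_prod \<phi> \<phi> ` star_turns v"
proof -
  have "star_turns w = (\<lambda>m. (reverse_side (w ! ((m + 1) mod length w)), w ! m)) ` {..<length w}" for w
    by (auto simp: star_turns_def)
  moreover have "(m + 1) mod length v < length v" if "m < length v" for m
    using that by (intro mod_less_divisor) auto
  ultimately show ?thesis by (simp add: image_image assms)
qed

lemma star_turns_sides:
  assumes "(d, e) \<in> star_turns v"
  shows "reverse_side d \<in> set v" "e \<in> set v"
proof -
  obtain m where "m < length v" "d = reverse_side (v ! ((m + 1) mod length v))" "e = v ! m"
    using assms by (auto simp: star_turns_def)
  moreover from this have "(m + 1) mod length v < length v" by (intro mod_less_divisor) auto
  ultimately show "reverse_side d \<in> set v" "e \<in> set v" by simp_all
qed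

definition boundary_star :: "diagram \<Rightarrow> side list" where
  "boundary_star D = rev (map (endpoint_side D) (boundary D))"

text \<open>The passage from which a side departs, or \<open>None\<close> for departure from the
  boundary circle. It tells the vertices apart.\<close>

fun origin :: "diagram \<Rightarrow> side \<Rightarrow> (nat \<times> nat) option" where
  "origin D (Along k a) = (if a = 0 then None else Some (k, a - 1))"
| "origin D (Against k a) = (if a < passages D k then Some (k, a) else None)"

lemma reverse_side_in_sides: "d \<in> sides D \<Longrightarrow> reverse_side d \<in> sides D"
  by (auto simp: sides_def)

lemma finite_sides: "finite (sides D)"
  by (simp add: sides_def)

context
  fixes D
  assumes D: "gauss_diagram D"
begin

lemma position_bounds: "(k, i) \<in> positions (crossings D) \<longleftrightarrow> k < strands D \<and> i < passages D k"
  using D by (auto simp: gauss_diagram_def)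

lemma crossing_star_origin:
  assumes "x \<in> crossings D" "d \<in> set (crossing_star x)"
  shows "d \<in> sides D" "origin D d = Some (over x) \<or> origin D d = Some (under x)"
proof -
  obtain s k i l j where x: "x = Crossing s (k, i) (l, j)" by (metis crossing.exhaust prod.collapse)
  have "over x \<in> positions (crossings D)" "under x \<in> positions (crossings D)"
    using assms(1) by (auto simp: positions_def)
  then have b: "k < strands D" "i < passages D k" "l < strands D" "j < passages D l"
    by (auto simp: x position_bounds)
  have d: "d = Along k (i + 1) \<or> d = Against k i \<or> d = Along l (j + 1) \<or> d = Against l j"
    using assms(2) by (auto simp: x split: if_splits)
  then show "d \<in> sides D" using b by (elim disjE) (auto simp: sides_def)
  show "origin D d = Some (over x) \<or> origin D d = Some (under x)"
    using d b by (elim disjE) (auto simp: x)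
qed

lemma boundary_star_origin:
  assumes "d \<in> set (boundary_star D)"
  shows "d \<in> sides D" "origin D d = None"
proof -
  have bd: "set (boundary D) = Start ` {..<strands D} \<union> End ` {..<strands D}"
    using D by (simp add: gauss_diagram_def)
  then have "(\<exists>k<strands D. d = Along k 0) \<or> (\<exists>k<strands D. d = Against k (passages D k))"
    using assms unfolding boundary_star_def set_rev set_map bd by auto
  then show "d \<in> sides D" "origin D d = None" by (auto simp: sides_def)
qed

lemma stars_eq: "stars D = insert (boundary_star D) (crossing_star ` crossings D)"
  by (simp add: stars_def boundary_star_def)

text \<open>By \<open>origin\<close>, a common side gives a common passage, and no passage belongs
  to two crossings or lies on the boundary.\<close>

lemma star_unique:
  assumes "v \<in> stars D" "v' \<in> stars D" "d \<in> set v" "d \<in> set v'"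
  shows "v = v'"
proof -
  have "x = x'" if "x \<in> crossings D" "x' \<in> crossings D" "d \<in> set (crossing_star x)"
    "d \<in> set (crossing_star x')" for x x'
  proof -
    have "over x = over x' \<or> over x = under x' \<or> under x = over x' \<or> under x = under x'"
      using crossing_star_origin(2)[OF that(1,3)] crossing_star_origin(2)[OF that(2,4)] by auto
    moreover have "over x \<noteq> under x'" "under x \<noteq> over x'"
      using D that(1,2) unfolding gauss_diagram_def disjoint_iff by (metis imageI)+
    ultimately show ?thesis using D that(1,2) by (auto simp: gauss_diagram_def inj_on_def)
  qed
  moreover have "d \<notin> set (boundary_star D)" if "x \<in> crossings D" "d \<in> set (crossing_star x)" for x
    using crossing_star_origin(2)[OF that] boundary_star_origin(2)[of d] by auto
  ultimately show ?thesis using assms unfolding stars_eq by blast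
qed

lemma star_distinct:
  assumes "v \<in> stars D"
  shows "distinct v"
proof (cases "v = boundary_star D")
  case True
  have "distinct (boundary D)" using D by (simp add: gauss_diagram_def)
  moreover have "inj (endpoint_side D)"
  proof (rule injI)
    fix e e' assume "endpoint_side D e = endpoint_side D e'"
    then show "e = e'" by (cases e; cases e') auto
  qed
  ultimately show ?thesis
    unfolding True boundary_star_def by (simp add: distinct_map inj_on_subset[OF _ subset_UNIV])
next
  case False
  then obtain x where x: "x \<in> crossings D" "v = crossing_star x" using assms stars_eq by auto
  obtain s k i l j where c: "x = Crossing s (k, i) (l, j)" by (metis crossing.exhaust prod.collapse)
  have "over ` crossings D \<inter> under ` crossings D = {}" using D by (simp add: gauss_diagram_def)
  then have "over x \<noteq> under x" using x(1) by auto
  then show ?thesis unfolding x(2) by (auto simp: c)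
qed

lemma side_in_star:
  assumes "d \<in> sides D"
  shows "\<exists>v\<in>stars D. d \<in> set v"
proof (cases "origin D d")
  case None
  have bd: "set (boundary D) = Start ` {..<strands D} \<union> End ` {..<strands D}"
    using D by (simp add: gauss_diagram_def)
  have "d \<in> set (boundary_star D)"
    using assms None unfolding boundary_star_def set_rev set_map bd image_Un image_image
    by (auto simp: sides_def split: if_splits)
  then show ?thesis by (auto simp: stars_eq)
next
  case (Some p)
  then have p: "d = Along (fst p) (snd p + 1) \<or> d = Against (fst p) (snd p)"
    by (cases d) (auto split: if_splits)
  have "(fst p, snd p) \<in> positions (crossings D)"
    using assms Some p unfolding position_bounds by (auto simp: sides_def split: if_splits)
  then obtain x where x: "x \<in> crossings D" "p = over x \<or> p = under x" by (auto simp: positions_def)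
  have "d \<in> set (crossing_star x)"
    using x(2) p by (cases x; cases "over x"; cases "under x") auto
  then show ?thesis using x by (auto simp: stars_eq)
qed

lemma star_sides: "v \<in> stars D \<Longrightarrow> d \<in> set v \<Longrightarrow> d \<in> sides D"
  using crossing_star_origin(1) boundary_star_origin(1) by (auto simp: stars_eq)

text \<open>Each side occurs in exactly one star and only once there, so every side has a left turn
  and no two sides have the same.\<close>

lemma sym_left_turn: "sym ((left_turn D)\<^sup>*)"
proof (rule sym_rtrancl_permutation)
  show "finite (sides D)" by (rule finite_sides)
  show "left_turn D \<subseteq> sides D \<times> sides D"
  proof clarify
    fix d e assume "(d, e) \<in> left_turn D"
    then obtain v where "v \<in> stars D" "(d, e) \<in> star_turns v" by (auto simp: left_turn_stars)
    then have "reverse_side d \<in> sides D" "e \<in> sides D" using star_turns_sides star_sides by blast+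
    then show "d \<in> sides D \<and> e \<in> sides D" using reverse_side_in_sides[of "reverse_side d"] by simp
  qed
  show "\<exists>e. (d, e) \<in> left_turn D" if d: "d \<in> sides D" for d
  proof -
    obtain v where v: "v \<in> stars D" "reverse_side d \<in> set v"
      using side_in_star[OF reverse_side_in_sides[OF d]] by blast
    then obtain n where n: "n < length v" "v ! n = reverse_side d" by (auto simp: in_set_conv_nth)
    \<comment> \<open>The cyclic predecessor of n; adding \<open>length v\<close> avoids truncation
      at n = 0.\<close>
    let ?m = "(n + length v - 1) mod length v"
    have "(?m + 1) mod length v = (n + length v - 1 + 1) mod length v" by (simp only: mod_add_left_eq)
    also have "n + length v - 1 + 1 = n + length v" using n by simp
    also have "\<dots> mod length v = n" using n by simp
    finally have "(?m + 1) mod length v = n" .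
    moreover have "?m < length v" using n by (intro mod_less_divisor) auto
    moreover have "d = reverse_side (v ! n)" using n by simp
    ultimately have "(d, v ! ?m) \<in> star_turns v"
      unfolding star_turns_def by (intro CollectI exI[of _ ?m]) (simp only: simp_thms)
    then show ?thesis using v by (auto simp: left_turn_stars)
  qed
  show "d = d'" if de: "(d, e) \<in> left_turn D" "(d', e) \<in> left_turn D" for d d' e
  proof -
    obtain v v' where v: "v \<in> stars D" "v' \<in> stars D" "(d, e) \<in> star_turns v" "(d', e) \<in> star_turns v'"
      using de by (auto simp: left_turn_stars)
    then have "v' = v" using star_unique star_turns_sides(2) by blast
    then obtain m m' where m: "m < length v" "d = reverse_side (v ! ((m + 1) mod length v))" "e = v ! m"
      "m' < length v" "d' = reverse_side (v ! ((m' + 1) mod length v))" "e = v ! m'"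
      using v(3,4) by (auto simp: star_turns_def)
    then have "m = m'" using star_distinct[OF v(1)] by (metis nth_eq_iff_index_eq)
    then show ?thesis using m by simp
  qed
qed

end

section \<open>The sides of a diagram before and after a glide move\<close>

fun map_side :: "(nat \<Rightarrow> nat \<Rightarrow> nat) \<Rightarrow> side \<Rightarrow> side" where
  "map_side h (Along k a) = Along k (h k a)"
| "map_side h (Against k a) = Against k (h k a)"

lemma map_side_reverse [simp]: "map_side h (reverse_side d) = reverse_side (map_side h d)"
  by (cases d) auto

lemma offset_gap:
  assumes "i < i'" "i' \<le> length w"
  shows "offset \<sigma> w i + length (\<sigma> (w ! i)) \<le> offset \<sigma> w i'"
  using assms
proof (induction i')
  case (Suc i')
  then show ?case using offset_Suc[of i' w \<sigma>] by (cases "i = i'") auto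
qed simp

text \<open>A move in coordinates. The strands \<open>k1\<close>, \<open>k2\<close>,
  \<open>k3\<close> may coincide; the position of \<open>Over b\<close> is that of
  \<open>Under a\<close> plus one.\<close>

locale glide_site =
  fixes s Ws a b y z k1 i1 k2 j2 k3 j3 bd
  assumes g: "gauss_word s Ws" and r: "redex Ws a b" and f: "fresh y z Ws"
    and p: "pos Ws (Over a) = (k1, i1)" "pos Ws (Under b) = (k2, j2)" "pos Ws (Under a) = (k3, j3)"
    and bd: "distinct bd" "set bd = Start ` {..<length Ws} \<union> End ` {..<length Ws}"
begin

abbreviation "\<sigma> \<equiv> swap_token s a b y z"
abbreviation "off k i \<equiv> offset \<sigma> (Ws ! k) i"
abbreviation "\<phi> \<equiv> map_side (\<lambda>k i. off k i)"
abbreviation "s' \<equiv> glide_sign s a b y z"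
abbreviation "Ws' \<equiv> glide_words s a b y z Ws"
abbreviation "A \<equiv> off k1 i1"
abbreviation "B \<equiv> off k3 j3"
abbreviation "C \<equiv> off k2 j2"
abbreviation "D \<equiv> diag bd s Ws"
abbreviation "E \<equiv> diag bd s' Ws'"

lemmas ab = redexD[OF g r]
lemmas g' = gauss_word_glide[OF g r f]
lemmas W' = glide_words_swap[OF g r f]

lemma yz: "y \<noteq> z" "y \<notin> names Ws" "z \<notin> names Ws" "y \<noteq> a" "y \<noteq> b" "z \<noteq> a" "z \<noteq> b"
  using f ab by (auto simp: fresh_def)

lemma dist: "distinct (concat Ws)" "distinct (concat Ws')"
  using g g' by (auto simp: gauss_word_def)

lemma tokens: "Over c \<in> set (concat Ws) \<longleftrightarrow> c \<in> names Ws" "Under c \<in> set (concat Ws) \<longleftrightarrow> c \<in> names Ws"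
  unfolding set_gauss_word[OF g] by auto

lemma pOb: "pos Ws (Over b) = (k3, j3 + 1)"
  using r p(3) unfolding redex_pos[OF g] by simp

lemma token_at_pos: "t \<in> set (concat Ws) \<Longrightarrow> token_at Ws (pos Ws t) t"
  using token_at_iff_pos[OF dist(1)] by blast

lemma sites: "token_at Ws (k1, i1) (Over a)" "token_at Ws (k2, j2) (Under b)"
  "token_at Ws (k3, j3) (Under a)" "token_at Ws (k3, j3 + 1) (Over b)"
  using token_at_pos[of "Over a"] token_at_pos[of "Under b"] token_at_pos[of "Under a"]
    token_at_pos[of "Over b"] unfolding tokens p pOb using ab by auto

lemma off_Suc: "token_at Ws (k, i) t \<Longrightarrow> off k (i + 1) = off k i + length (\<sigma> t)"
  using offset_Suc[of i "Ws ! k" \<sigma>] by (auto simp: token_at_def)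

lemma new_pos:
  assumes "token_at Ws (k, i) t" "m < length (\<sigma> t)"
  shows "pos Ws' (\<sigma> t ! m) = (k, off k i + m)"
proof -
  have "token_at Ws' (k, off k i + m) (\<sigma> t ! m)"
    unfolding W' token_at_expand using assms by blast
  then show ?thesis using token_at_iff_pos[OF dist(2)] by auto
qed

lemma length_\<sigma>: "length (\<sigma> t) = (if t = Over a \<or> t = Under b then 3 else 1)"
  using ab by (simp add: length_swap_token)

lemma offs: "off k1 (i1 + 1) = A + 3" "off k2 (j2 + 1) = C + 3" "off k3 (j3 + 1) = B + 1"
  "off k3 (j3 + 2) = B + 2"
  using off_Suc[OF sites(1)] off_Suc[OF sites(2)] off_Suc[OF sites(3)] off_Suc[OF sites(4)] ab
  by (auto simp: length_\<sigma>)

lemma \<sigma>_sites: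
  "\<sigma> (Over a) = (if s a = 1 then [Over y, Over a, Over z] else [Over z, Over a, Over y])"
  "\<sigma> (Under b) = (if s b = 1 then [Under z, Under b, Under y] else [Under y, Under b, Under z])"
  "\<sigma> (Under a) = [Over b]" "\<sigma> (Over b) = [Under a]"
  using ab by (auto simp: swap_token_def glide_token_def)

lemma signs: "s a = 1 \<or> s a = -1" "s b = 1 \<or> s b = -1"
  using sign_cases[OF g] by auto

lemma new_positions:
  "pos Ws' (Over b) = (k3, B)" "pos Ws' (Under a) = (k3, B + 1)"
  "pos Ws' (Over a) = (k1, A + 1)" "pos Ws' (Under b) = (k2, C + 1)"
  "pos Ws' (Over y) = (k1, if s a = 1 then A else A + 2)"
  "pos Ws' (Over z) = (k1, if s a = 1 then A + 2 else A)"
  "pos Ws' (Under y) = (k2, if s b = 1 then C + 2 else C)"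
  "pos Ws' (Under z) = (k2, if s b = 1 then C else C + 2)"
proof -
  have 1: "pos Ws' (\<sigma> (Over a) ! m) = (k1, A + m)" if "m < 3" for m
    using new_pos[OF sites(1), of m] that length_\<sigma>[of "Over a"] by simp
  have 2: "pos Ws' (\<sigma> (Under b) ! m) = (k2, C + m)" if "m < 3" for m
    using new_pos[OF sites(2), of m] that length_\<sigma>[of "Under b"] by simp
  show "pos Ws' (Over b) = (k3, B)"
    using new_pos[OF sites(3), of 0] by (simp add: \<sigma>_sites)
  show "pos Ws' (Under a) = (k3, B + 1)"
    using new_pos[OF sites(4), of 0] offs(3) by (simp add: \<sigma>_sites)
  show "pos Ws' (Over a) = (k1, A + 1)" "pos Ws' (Over y) = (k1, if s a = 1 then A else A + 2)"
    "pos Ws' (Over z) = (k1, if s a = 1 then A + 2 else A)"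
    using 1[of 0] 1[of 1] 1[of 2] unfolding \<sigma>_sites by (simp_all split: if_splits)
  show "pos Ws' (Under b) = (k2, C + 1)" "pos Ws' (Under y) = (k2, if s b = 1 then C + 2 else C)"
    "pos Ws' (Under z) = (k2, if s b = 1 then C else C + 2)"
    using 2[of 0] 2[of 1] 2[of 2] unfolding \<sigma>_sites by (simp_all split: if_splits)
qed

lemma other_positions:
  assumes "c \<in> names Ws" "c \<noteq> a" "c \<noteq> b" "t = Over c \<or> t = Under c" "pos Ws t = (k, i)"
  shows "pos Ws' t = (k, off k i)" "off k (i + 1) = off k i + 1"
proof -
  have "token_at Ws (k, i) t" using token_at_pos[of t] tokens assms by auto
  moreover have "\<sigma> t = [t]" using assms by (auto simp: swap_token_def glide_token_def)
  ultimately show "pos Ws' t = (k, off k i)" "off k (i + 1) = off k i + 1"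
    using new_pos[of k i t 0] off_Suc[of k i t] by auto
qed

lemma lengths: "length Ws' = length Ws" "k < length Ws \<Longrightarrow> length (Ws' ! k) = off k (length (Ws ! k))"
  by (simp_all add: W' offset_length)

text \<open>Only a block of three passages has inner arcs; all other arcs lie at the start of a
  block or at the end of the strand and are renumbered old arcs.\<close>

lemma arcs:
  assumes "k < length Ws" "x \<le> length (Ws' ! k)"
  shows "(\<exists>i\<le>length (Ws ! k). x = off k i) \<or> (k = k1 \<and> (x = A + 1 \<or> x = A + 2)) \<or>
    (k = k2 \<and> (x = C + 1 \<or> x = C + 2))"
proof (cases "x = length (Ws' ! k)")
  case True
  then show ?thesis using lengths(2)[OF assms(1)] by blast
next
  case False
  then have "x < length (expand \<sigma> (Ws ! k))" using assms by (simp add: W')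
  then obtain i m where im: "i < length (Ws ! k)" "m < length (\<sigma> (Ws ! k ! i))" "x = off k i + m"
    using expand_index by blast
  have at: "token_at Ws (k, i) (Ws ! k ! i)" using im assms by (simp add: token_at_def)
  consider "m = 0" | "m = 1 \<or> m = 2" "Ws ! k ! i = Over a" | "m = 1 \<or> m = 2" "Ws ! k ! i = Under b"
    using im(2) unfolding length_\<sigma> by (fastforce split: if_splits)
  then show ?thesis
  proof cases
    case 1
    then have "i \<le> length (Ws ! k) \<and> x = off k i" using im by simp
    then show ?thesis by blast
  next
    case 2
    then have "(k, i) = (k1, i1)" using at token_at_inj[OF dist(1) _ sites(1)] by simp
    then show ?thesis using 2 im by auto
  next
    case 3
    then have "(k, i) = (k2, j2)" using at token_at_inj[OF dist(1) _ sites(2)] by simp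
    then show ?thesis using 3 im by auto
  qed
qed

lemma off_inj: "i \<le> length (Ws ! k) \<Longrightarrow> i' \<le> length (Ws ! k) \<Longrightarrow> off k i = off k i' \<Longrightarrow> i = i'"
proof (induction i i' rule: linorder_wlog)
  case (le i i')
  show ?case
  proof (rule ccontr)
    assume "i \<noteq> i'"
    then have "off k i + length (\<sigma> (Ws ! k ! i)) \<le> off k i'" using le by (intro offset_gap) auto
    then show False using le by (simp add: length_\<sigma> split: if_splits)
  qed
qed simp

lemma gap:
  assumes "token_at Ws (k, i) t" "length (\<sigma> t) = 3" "i' \<le> length (Ws ! k)"
  shows "off k i' \<le> off k i \<or> off k i + 3 \<le> off k i'"
proof (cases "i' \<le> i")
  case True
  then show ?thesis
    using offset_gap[of i' i "Ws ! k" \<sigma>] assms(1) by (cases "i' = i") (auto simp: token_at_def)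
next
  case False
  then show ?thesis
    using offset_gap[of i i' "Ws ! k" \<sigma>] assms by (auto simp: token_at_def)
qed

text \<open>Old arcs go to the borders of blocks, never to their interior, and the two blocks of
  three do not overlap even on a common strand.\<close>

lemma off_new:
  "i \<le> length (Ws ! k1) \<Longrightarrow> off k1 i \<noteq> A + 1 \<and> off k1 i \<noteq> A + 2"
  "i \<le> length (Ws ! k2) \<Longrightarrow> off k2 i \<noteq> C + 1 \<and> off k2 i \<noteq> C + 2"
  "k1 = k2 \<Longrightarrow> C + 3 \<le> A \<or> A + 3 \<le> C"
proof -
  show "i \<le> length (Ws ! k1) \<Longrightarrow> off k1 i \<noteq> A + 1 \<and> off k1 i \<noteq> A + 2"
    using gap[OF sites(1), of i] by (auto simp: length_\<sigma>)
  show "i \<le> length (Ws ! k2) \<Longrightarrow> off k2 i \<noteq> C + 1 \<and> off k2 i \<noteq> C + 2"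
    using gap[OF sites(2), of i] by (auto simp: length_\<sigma>)
  assume "k1 = k2"
  moreover have "i1 \<noteq> j2 \<or> k1 \<noteq> k2" using token_at_fun[OF sites(1)] sites(2) by auto
  ultimately have "i1 < j2 \<or> j2 < i1" by auto
  then show "C + 3 \<le> A \<or> A + 3 \<le> C"
    using offset_gap[of i1 j2 "Ws ! k1" \<sigma>] offset_gap[of j2 i1 "Ws ! k1" \<sigma>] sites(1,2) \<open>k1 = k2\<close>
    by (auto simp: token_at_def length_\<sigma>)
qed

lemma sides_D: "Along k i \<in> sides D \<longleftrightarrow> k < length Ws \<and> i \<le> length (Ws ! k)"
  "Against k i \<in> sides D \<longleftrightarrow> k < length Ws \<and> i \<le> length (Ws ! k)"
  using passages_diag[OF g, of k bd] by (auto simp: sides_def diag_def)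

lemma sides_E: "Along k i \<in> sides E \<longleftrightarrow> k < length Ws \<and> i \<le> length (Ws' ! k)"
  "Against k i \<in> sides E \<longleftrightarrow> k < length Ws \<and> i \<le> length (Ws' ! k)"
  using passages_diag[OF g', of k bd] lengths(1) by (auto simp: sides_def diag_def)

text \<open>With 3 running up, strand 1 runs east if \<open>a\<close> is positive and strand 2 runs
  west if \<open>b\<close> is positive. The conditionals pick the direction of the arc that points
  to the named side of the picture.\<close>

definition "W1 = (if s a = 1 then Against k1 i1 else Along k1 (i1 + 1))"
definition "E1 = (if s a = 1 then Along k1 (i1 + 1) else Against k1 i1)"
definition "W2 = (if s b = 1 then Along k2 (j2 + 1) else Against k2 j2)"
definition "E2 = (if s b = 1 then Against k2 j2 else Along k2 (j2 + 1))"
definition "P = (if s a = 1 then Against k1 (A + 1) else Along k1 (A + 2))"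
definition "Q = (if s a = 1 then Along k1 (A + 2) else Against k1 (A + 1))"
definition "U = (if s b = 1 then Along k2 (C + 2) else Against k2 (C + 1))"
definition "V = (if s b = 1 then Against k2 (C + 1) else Along k2 (C + 2))"
abbreviation "S1 \<equiv> Against k3 j3"
abbreviation "N1 \<equiv> Along k3 (j3 + 2)"
abbreviation "M \<equiv> Along k3 (j3 + 1)"

lemmas side_defs = W1_def E1_def W2_def E2_def P_def Q_def U_def V_def

abbreviation "star c \<equiv> crossing_star (crossing_of s Ws c)"
abbreviation "star' c \<equiv> crossing_star (crossing_of s' Ws' c)"

lemma star_a: "star a = (if s a = 1 then [E1, M, W1, S1] else [W1, S1, E1, M])"
  by (simp add: crossing_of_def p side_defs)

lemma star_b: "star b = [N1, W2, reverse_side M, E2]"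
  by (simp add: crossing_of_def p pOb side_defs)

lemma signs': "s' a = s a" "s' b = s b" "s' y = s a * s b" "s' z = - (s a * s b)"
  using yz ab(1) by (auto simp: glide_sign_def)

text \<open>A star is listed from its over strand, so its first entry depends on the signs; its
  cyclic order in the picture does not, and \<open>star_turns\<close> sees only that. Here
  \<open>y\<close> lies west and \<open>z\<close> east of 3.\<close>

lemma stars'_new:
  "star_turns (star' b) = star_turns [\<phi> M, U, \<phi> S1, V]"
  "star_turns (star' a) = star_turns [Q, \<phi> N1, P, reverse_side (\<phi> M)]"
  "star_turns (star' y) = star_turns [reverse_side P, \<phi> W2, \<phi> W1, reverse_side U]"
  "star_turns (star' z) = star_turns [\<phi> E2, reverse_side Q, reverse_side V, \<phi> E1]"
proof -
  note simps = crossing_of_def new_positions side_defs star_turns_4 signs' offs[simplified]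
    insert_commute numeral_3_eq_3
  show "star_turns (star' b) = star_turns [\<phi> M, U, \<phi> S1, V]"
    by (cases "s b = 1") (simp_all add: simps)
  show "star_turns (star' a) = star_turns [Q, \<phi> N1, P, reverse_side (\<phi> M)]"
    by (cases "s a = 1") (simp_all add: simps)
  show "star_turns (star' y) = star_turns [reverse_side P, \<phi> W2, \<phi> W1, reverse_side U]"
    using signs by (elim disjE; simp add: simps)
  show "star_turns (star' z) = star_turns [\<phi> E2, reverse_side Q, reverse_side V, \<phi> E1]"
    using signs by (elim disjE; simp add: simps)
qed

lemma star'_other:
  assumes "c \<in> names Ws - {a, b}"
  shows "star' c = map \<phi> (star c)"
proof -
  obtain k i l j where kl: "pos Ws (Over c) = (k, i)" "pos Ws (Under c) = (l, j)" by fastforce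
  have "s' c = s c" using assms yz by (auto simp: glide_sign_def)
  then show ?thesis
    using other_positions[of c "Over c" k i] other_positions[of c "Under c" l j] kl assms
    by (simp add: crossing_of_def)
qed

lemma boundary_star': "boundary_star E = map \<phi> (boundary_star D)"
proof -
  have "endpoint_side E e = \<phi> (endpoint_side D e)" if "e \<in> set bd" for e
    using that bd(2) passages_diag[OF g] passages_diag[OF g'] lengths by (auto simp: diag_def)
  then show ?thesis by (simp add: boundary_star_def rev_map diag_def)
qed


text \<open>The vertices away from the move, where it merely renumbers the arcs.\<close>

definition "V0 = insert (boundary_star D) (star ` (names Ws - {a, b}))"
definition "R0 = (\<Union>v\<in>V0. star_turns v)"

lemma gauss_D: "gauss_diagram D" and gauss_E: "gauss_diagram E"
  using gauss_diag[OF g bd] gauss_diag[OF g'] bd lengths(1) by auto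

lemma stars_D: "stars D = V0 \<union> {star a, star b}"
proof -
  have "names Ws = (names Ws - {a, b}) \<union> {a, b}" using ab by auto
  then have "star ` names Ws = star ` ((names Ws - {a, b}) \<union> {a, b})" by (rule arg_cong)
  then have "star ` names Ws = star ` (names Ws - {a, b}) \<union> {star a, star b}" by (simp add: image_Un)
  moreover have "crossing_star ` crossings D = star ` names Ws" by (simp add: diag_eq image_image)
  ultimately show ?thesis unfolding stars_eq[OF gauss_D] V0_def by (simp add: insert_commute)
qed

lemma stars_E: "stars E = map \<phi> ` V0 \<union> {star' a, star' b, star' y, star' z}"
proof -
  have "names Ws' = (names Ws - {a, b}) \<union> {a, b, y, z}"
    using ab by (auto simp: names_glide_words[OF g r f])
  then have "star' ` names Ws' = star' ` ((names Ws - {a, b}) \<union> {a, b, y, z})" by (rule arg_cong)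
  then have "star' ` names Ws' = star' ` (names Ws - {a, b}) \<union> {star' a, star' b, star' y, star' z}"
    by (simp add: image_Un)
  moreover have "star' ` (names Ws - {a, b}) = map \<phi> ` star ` (names Ws - {a, b})"
    unfolding image_image using star'_other by (rule image_cong[OF refl])
  moreover have "crossing_star ` crossings E = star' ` names Ws'" by (simp add: diag_eq image_image)
  ultimately show ?thesis unfolding stars_eq[OF gauss_E] V0_def
    by (simp add: boundary_star' insert_commute)
qed

lemma star_inj:
  assumes "c \<in> names Ws" "d \<in> names Ws" "star c = star d"
  shows "c = d"
proof -
  have "hd (star c) = Along (fst (pos Ws (Over c))) (snd (pos Ws (Over c)) + 1)" for c
    by (cases "pos Ws (Over c)"; cases "pos Ws (Under c)") (simp add: crossing_of_def)
  note hd = this[of c] this[of d]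
  then have "pos Ws (Over c) = pos Ws (Over d)"
    unfolding assms(3) by (simp add: prod_eq_iff)
  then show ?thesis using pos_eq_iff[OF g, of "Over c" "Over d"] tokens assms by simp
qed

lemma boundary_star_ne: "c \<in> names Ws \<Longrightarrow> star c \<noteq> boundary_star D"
proof
  assume c: "c \<in> names Ws" and e: "star c = boundary_star D"
  have "star c \<noteq> []"
    by (cases "pos Ws (Over c)"; cases "pos Ws (Under c)") (simp add: crossing_of_def)
  then have d: "hd (star c) \<in> set (star c)" by simp
  have "crossing_of s Ws c \<in> crossings D" using c by (simp add: diag_eq)
  from crossing_star_origin(2)[OF gauss_D this d] show False
    using boundary_star_origin(2)[OF gauss_D, of "hd (star c)"] d unfolding e by auto
qed

lemma star_notin_V0: "star a \<notin> V0" "star b \<notin> V0"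
  using star_inj ab boundary_star_ne by (auto simp: V0_def)

text \<open>\<open>M\<close> departs from \<open>a\<close> and its reverse from \<open>b\<close>. No
  side departs from two vertices, so neither occurs at a vertex of \<open>V0\<close>.\<close>

lemma R0_sides: "R0 \<subseteq> (sides D - {M, reverse_side M}) \<times> (sides D - {M, reverse_side M})"
proof clarify
  fix d e assume "(d, e) \<in> R0"
  then obtain v where v: "v \<in> V0" "(d, e) \<in> star_turns v" by (auto simp: R0_def)
  note vt = star_turns_sides[OF v(2)]
  have "v \<in> stars D" "star a \<in> stars D" "star b \<in> stars D" using v(1) stars_D by auto
  moreover have "M \<in> set (star a)" "reverse_side M \<in> set (star b)" by (auto simp: star_a star_b)
  ultimately have "M \<notin> set v" "reverse_side M \<notin> set v"
    using star_unique[OF gauss_D, of v] star_notin_V0 v(1) by blast+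
  moreover have "reverse_side d \<in> sides D" "e \<in> sides D"
    using star_sides[OF gauss_D \<open>v \<in> stars D\<close>] vt by blast+
  ultimately show "d \<in> sides D - {M, reverse_side M} \<and> e \<in> sides D - {M, reverse_side M}"
    using vt reverse_side_in_sides[of "reverse_side d" D] by auto
qed

lemma site_bounds: "k1 < length Ws" "k2 < length Ws" "k3 < length Ws"
  "i1 < length (Ws ! k1)" "j2 < length (Ws ! k2)" "j3 + 1 < length (Ws ! k3)"
  using sites by (auto simp: token_at_def)

lemma site_distinct: "(k1, i1) \<noteq> (k3, j3)" "(k1, i1) \<noteq> (k3, j3 + 1)" "(k2, j2) \<noteq> (k3, j3)"
  "(k2, j2) \<noteq> (k3, j3 + 1)"
  using token_at_fun[OF sites(1)] token_at_fun[OF sites(2)] sites(3,4) ab(1) by auto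

lemma new_arcs: "A + 3 \<le> length (Ws' ! k1)" "C + 3 \<le> length (Ws' ! k2)"
  using offset_gap[of i1 "length (Ws ! k1)" "Ws ! k1" \<sigma>] offset_gap[of j2 "length (Ws ! k2)" "Ws ! k2" \<sigma>]
    site_bounds lengths(2) sites by (auto simp: token_at_def length_\<sigma>)

lemma new_sides: "{P, reverse_side P, Q, reverse_side Q, U, reverse_side U, V, reverse_side V} =
      {Along k1 (A + 1), Against k1 (A + 1), Along k1 (A + 2), Against k1 (A + 2),
       Along k2 (C + 1), Against k2 (C + 1), Along k2 (C + 2), Against k2 (C + 2)}"
  by (cases "s a = 1"; cases "s b = 1") (simp_all add: side_defs insert_commute)

lemma sides_E_eq: "sides E = \<phi> ` sides D \<union>
    {P, reverse_side P, Q, reverse_side Q, U, reverse_side U, V, reverse_side V}"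
proof -
  have le: "off k i \<le> length (Ws' ! k)" if "k < length Ws" "i \<le> length (Ws ! k)" for k i
    using that offset_gap[of i "length (Ws ! k)" "Ws ! k" \<sigma>] lengths(2)[of k]
    by (cases "i = length (Ws ! k)") auto
  show ?thesis
    unfolding new_sides
  proof (intro equalityI subsetI)
    fix d assume d: "d \<in> sides E"
    show "d \<in> \<phi> ` sides D \<union> {Along k1 (A + 1), Against k1 (A + 1), Along k1 (A + 2), Against k1 (A + 2),
       Along k2 (C + 1), Against k2 (C + 1), Along k2 (C + 2), Against k2 (C + 2)}"
    proof (cases d)
      case (Along k x)
      then have kx: "k < length Ws" "x \<le> length (Ws' ! k)" using d sides_E by auto
      from arcs[OF kx] show ?thesis
      proof (elim disjE exE conjE)
        fix i assume i: "i \<le> length (Ws ! k)" "x = off k i"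
        then have "Along k i \<in> sides D" using kx sides_D by simp
        moreover have "d = \<phi> (Along k i)" using i Along by simp
        ultimately show ?thesis by blast
      qed (simp_all add: Along)
    next
      case (Against k x)
      then have kx: "k < length Ws" "x \<le> length (Ws' ! k)" using d sides_E by auto
      from arcs[OF kx] show ?thesis
      proof (elim disjE exE conjE)
        fix i assume i: "i \<le> length (Ws ! k)" "x = off k i"
        then have "Against k i \<in> sides D" using kx sides_D by simp
        moreover have "d = \<phi> (Against k i)" using i Against by simp
        ultimately show ?thesis by blast
      qed (simp_all add: Against)
    qed
  next
    fix d assume "d \<in> \<phi> ` sides D \<union> {Along k1 (A + 1), Against k1 (A + 1), Along k1 (A + 2),
       Against k1 (A + 2), Along k2 (C + 1), Against k2 (C + 1), Along k2 (C + 2), Against k2 (C + 2)}"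
    moreover have "\<phi> e \<in> sides E" if "e \<in> sides D" for e
      using that le sides_D sides_E by (cases e) auto
    ultimately show "d \<in> sides E"
      using new_arcs site_bounds(1,2) by (auto simp: sides_E)
  qed
qed

abbreviation "K \<equiv> sides D - {M, reverse_side M}"

lemma left_turn_D: "left_turn D = R0 \<union> {(reverse_side M, E1), (reverse_side W1, M), (reverse_side S1, W1),
    (reverse_side E1, S1), (reverse_side N1, E2), (reverse_side W2, N1), (M, W2),
    (reverse_side E2, reverse_side M)}"
proof -
  have a: "star_turns (star a) = star_turns [E1, M, W1, S1]"
    by (simp add: star_a star_turns_4 insert_commute)
  have "left_turn D = R0 \<union> (star_turns (star a) \<union> star_turns (star b))"
    unfolding left_turn_stars stars_D UN_Un R0_def by (simp only: UN_insert UN_empty Un_empty_right)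
  also have "star_turns (star a) \<union> star_turns (star b) = {(reverse_side M, E1), (reverse_side W1, M),
    (reverse_side S1, W1), (reverse_side E1, S1), (reverse_side N1, E2), (reverse_side W2, N1), (M, W2),
    (reverse_side E2, reverse_side M)}"
    unfolding a unfolding star_b star_turns_4 reverse_reverse_side by (simp only: insert_commute Un_insert_left Un_empty_left)
  finally show ?thesis .
qed

lemma left_turn_E: "left_turn E = map_prod \<phi> \<phi> ` R0 \<union>
    {(\<phi> (reverse_side M), V), (reverse_side U, \<phi> M), (\<phi> (reverse_side S1), U), (reverse_side V, \<phi> S1),
     (\<phi> (reverse_side N1), Q), (reverse_side P, \<phi> N1), (\<phi> M, P), (reverse_side Q, \<phi> (reverse_side M)),
     (\<phi> (reverse_side W2), reverse_side P), (\<phi> (reverse_side W1), \<phi> W2), (U, \<phi> W1), (P, reverse_side U),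
     (Q, \<phi> E2), (V, reverse_side Q), (\<phi> (reverse_side E1), reverse_side V), (\<phi> (reverse_side E2), \<phi> E1)}"
proof -
  have "(\<Union>v\<in>map \<phi> ` V0. star_turns v) = map_prod \<phi> \<phi> ` R0"
    unfolding R0_def by (simp add: image_UN star_turns_map)
  then have "left_turn E = map_prod \<phi> \<phi> ` R0 \<union>
      (star_turns (star' b) \<union> (star_turns (star' a) \<union> (star_turns (star' y) \<union> star_turns (star' z))))"
    unfolding left_turn_stars stars_E UN_Un by (simp only: UN_insert UN_empty Un_empty_right Un_empty_left Un_ac)
  then show ?thesis
    unfolding stars'_new star_turns_4 reverse_reverse_side map_side_reverse
    by (simp only: Un_insert_left Un_insert_right Un_empty_left Un_empty_right insert_commute)
qed

lemma ends: "{E1, reverse_side E1, W1, reverse_side W1, S1, reverse_side S1, N1, reverse_side N1, E2,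
    reverse_side E2, W2, reverse_side W2} \<subseteq> K"
  using site_bounds site_distinct
  by (cases "s a = 1"; cases "s b = 1") (simp_all add: side_defs sides_D)

lemma inj_\<phi>: "inj_on \<phi> (sides D)"
proof (rule inj_onI)
  fix d e assume "d \<in> sides D" "e \<in> sides D" "\<phi> d = \<phi> e"
  then show "d = e" by (cases d; cases e) (auto simp: sides_D intro: off_inj)
qed

lemma new_distinct: "distinct [P, reverse_side P, Q, reverse_side Q, U, reverse_side U, V, reverse_side V]"
  using off_new(3) by (cases "s a = 1"; cases "s b = 1") (auto simp: side_defs)

lemma new_disjoint:
  "{P, reverse_side P, Q, reverse_side Q, U, reverse_side U, V, reverse_side V} \<inter> \<phi> ` sides D = {}"
proof -
  let ?N = "{P, reverse_side P, Q, reverse_side Q, U, reverse_side U, V, reverse_side V}"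
  have notin: "\<phi> d \<notin> ?N" if d: "d \<in> sides D" for d
  proof -
    obtain k x where k: "d = Along k x \<or> d = Against k x" by (cases d) auto
    then have "x \<le> length (Ws ! k)" using d sides_D by auto
    then have "k = k1 \<Longrightarrow> off k x \<noteq> A + 1 \<and> off k x \<noteq> A + 2"
      "k = k2 \<Longrightarrow> off k x \<noteq> C + 1 \<and> off k x \<noteq> C + 2"
      using off_new(1)[of x] off_new(2)[of x] by simp_all
    then show ?thesis unfolding new_sides using k by (elim disjE) auto
  qed
  show ?thesis
  proof (intro equals0I, elim IntE imageE)
    fix e d assume "e \<in> ?N" "e = \<phi> d" "d \<in> sides D"
    then show False using notin[of d] by (simp only: simp_thms)
  qed
qed

lemma card_regions_glide: "card (regions E) = card (regions D) + 2"
proof -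
  have "M \<in> sides D" "reverse_side M \<in> sides D" "M \<noteq> reverse_side M"
    using site_bounds by (auto simp: sides_D)
  from glide_regions.card_regions[OF glide_regions.intro[OF left_turn_D left_turn_E sides_E_eq
      finite_sides this R0_sides ends inj_\<phi> new_distinct new_disjoint
      sym_left_turn[OF gauss_D] sym_left_turn[OF gauss_E]]]
  show ?thesis unfolding regions_def .
qed

end

section \<open>Existence and uniqueness of the OU diagram\<close>

lemma gauss_diagramE:
  assumes "gauss_diagram D"
  obtains s Ws where "gauss_word s Ws" "D = diag (boundary D) s Ws" "distinct (boundary D)"
    "set (boundary D) = Start ` {..<length Ws} \<union> End ` {..<length Ws}"
proof -
  obtain s Ws where w: "gauss_word s Ws" "D = diag (boundary D) s Ws"
    using gauss_diagram_word[OF assms] by blast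
  have "strands D = length Ws" by (subst w(2)) (simp add: diag_def)
  then show ?thesis using that[OF w] assms by (simp add: gauss_diagram_def)
qed

lemma glideE:
  assumes "gauss_diagram D" "glide D E"
  obtains s Ws a b y z where "gauss_word s Ws" "D = diag (boundary D) s Ws" "redex Ws a b" "fresh y z Ws"
    "E = diag (boundary D) (glide_sign s a b y z) (glide_words s a b y z Ws)"
    "distinct (boundary D)" "set (boundary D) = Start ` {..<length Ws} \<union> End ` {..<length Ws}"
proof -
  obtain s Ws where w: "gauss_word s Ws" "D = diag (boundary D) s Ws" "distinct (boundary D)"
    "set (boundary D) = Start ` {..<length Ws} \<union> End ` {..<length Ws}"
    using gauss_diagramE[OF assms(1)] .
  have "glide (diag (boundary D) s Ws) E" using assms(2) w(2) by simp
  from glide_diagE[OF w(1) this] obtain a b where ab: "redex Ws a b"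
    "\<And>y z. fresh y z Ws \<Longrightarrow> E = diag (boundary D) (glide_sign s a b y z) (glide_words s a b y z Ws)"
    by blast
  obtain y z where "fresh y z Ws" using exists_fresh by blast
  then show ?thesis using that[OF w(1,2) ab(1) _ ab(2) w(3,4)] by blast
qed

lemma gauss_glide:
  assumes "gauss_diagram D" "glide D E"
  shows "gauss_diagram E"
  using glideE[OF assms]
proof cases
  case (1 s Ws a b y z)
  have "length (glide_words s a b y z Ws) = length Ws" by (simp add: glide_words_def)
  then show ?thesis
    unfolding 1(5) using gauss_diag[OF gauss_word_glide[OF 1(1,3,4)] 1(6)] 1(7) by simp
qed

lemma acyclic_glide:
  assumes "gauss_diagram D" "glide D E"
  shows "acyclic_diagram E \<longleftrightarrow> acyclic_diagram D"
  using glideE[OF assms]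
proof cases
  case (1 s Ws a b y z)
  interpret chain_glide "names Ws" "chain Ws" "chain (glide_words s a b y z Ws)" a b y z
    using chain_glide_words_locale[OF 1(1,3,4)] .
  have "acyclic_diagram D \<longleftrightarrow> acyclic (chain Ws)" by (subst 1(2)) (rule acyclic_diag[OF 1(1)])
  then show ?thesis
    unfolding 1(5) acyclic_diag[OF gauss_word_glide[OF 1(1,3,4)]] using acyclic_glide_iff by simp
qed

lemma card_crossings_diag: "gauss_word s Ws \<Longrightarrow> card (crossings (diag bd s Ws)) = card (names Ws)"
  by (simp add: diag_eq card_image inj_on_crossing_of)

lemma card_names_glide:
  assumes "gauss_word s Ws" "redex Ws a b" "fresh y z Ws"
  shows "card (names (glide_words s a b y z Ws)) = card (names Ws) + 2"
  using assms(3) by (simp add: names_glide_words[OF assms] fresh_def)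

lemma tangle_glide:
  assumes "tangle_diagram D" "glide D E"
  shows "tangle_diagram E"
proof -
  have gD: "gauss_diagram D" using assms(1) by (simp add: tangle_diagram_def)
  from glideE[OF gD assms(2)] show ?thesis
  proof cases
    case (1 s Ws a b y z)
    obtain k1 i1 k2 j2 k3 j3 where "pos Ws (Over a) = (k1, i1)" "pos Ws (Under b) = (k2, j2)"
      "pos Ws (Under a) = (k3, j3)" by fastforce
    then interpret glide_site s Ws a b y z k1 i1 k2 j2 k3 j3 "boundary D"
      using 1 by unfold_locales auto
    have "card (regions E) = card (regions D) + 2"
      using card_regions_glide unfolding 1(5) 1(2)[symmetric] .
    moreover have "card (crossings E) = card (crossings D) + 2"
      by (subst 1(2), subst 1(5))
        (simp add: card_crossings_diag[OF 1(1)] card_crossings_diag[OF g'] card_names_glide[OF 1(1,3,4)])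
    moreover have "strands E = strands D" using assms(2) by (auto simp: glide_def)
    ultimately show ?thesis
      using assms gauss_glide[OF gD assms(2)] by (simp add: tangle_diagram_def)
  qed
qed

text \<open>The number \<open>n\<close> bounds the number of the glide moves that can follow.\<close>

definition glides_bounded :: "nat \<Rightarrow> diagram \<Rightarrow> bool" where
  "glides_bounded n D \<longleftrightarrow> (\<exists>s Ws f. D = diag (boundary D) s Ws \<and> gauss_word s Ws \<and>
     potential (names Ws) (chain Ws) f \<and> sum f (names Ws) \<le> n + card (names Ws))"

lemma acyclic_bounded:
  assumes "gauss_diagram D" "acyclic_diagram D"
  shows "\<exists>n. glides_bounded n D"
proof -
  obtain s Ws where w: "gauss_word s Ws" "D = diag (boundary D) s Ws"
    using gauss_diagram_word[OF assms(1)] by blast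
  have "acyclic (chain Ws)" using assms(2) acyclic_diag[OF w(1), of "boundary D"] w(2) by simp
  then obtain f where "potential (names Ws) (chain Ws) f"
    using potential_exists[OF finite_names chain_names[OF w(1)]] by blast
  then have "glides_bounded (sum f (names Ws)) D" using w unfolding glides_bounded_def by fastforce
  then show ?thesis by blast
qed

lemma bounded_glide:
  assumes "glides_bounded n D" "glide D E"
  shows "\<exists>m<n. glides_bounded m E"
proof -
  obtain s Ws f where w: "D = diag (boundary D) s Ws" "gauss_word s Ws"
    "potential (names Ws) (chain Ws) f" "sum f (names Ws) \<le> n + card (names Ws)"
    using assms(1) unfolding glides_bounded_def by blast
  have "glide (diag (boundary D) s Ws) E" using assms(2) w(1) by simp
  from glide_diagE[OF w(2) this] obtain a b where redex: "redex Ws a b"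
    "\<And>y z. fresh y z Ws \<Longrightarrow> E = diag (boundary D) (glide_sign s a b y z) (glide_words s a b y z Ws)"
    by blast
  obtain y z where fr: "fresh y z Ws" using exists_fresh by blast
  let ?W = "glide_words s a b y z Ws"
  interpret chain_glide "names Ws" "chain Ws" "chain ?W" a b y z
    using chain_glide_words_locale[OF w(2) redex(1) fr] .
  obtain f' where f': "potential (names ?W) (chain ?W) f'" "sum f' (names ?W) = sum f (names Ws)"
    using potential_glide[OF w(3)] unfolding names_glide_words[OF w(2) redex(1) fr] by blast
  \<comment> \<open>Every value of a potential is at least 1, so the total bounds the number of
    crossings. As that number has grown by two and the total has not, 2 \<le> n, and the subtraction
    below is exact.\<close>
  have "(\<Sum>c\<in>names ?W. 1) \<le> sum f' (names ?W)"
    using f'(1) by (intro sum_mono) (auto simp: potential_def)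
  then have "card (names ?W) \<le> sum f' (names ?W)" by simp
  then have n: "2 \<le> n" "sum f' (names ?W) \<le> (n - 2) + card (names ?W)"
    using w(4) f'(2) card_names_glide[OF w(2) redex(1) fr] by linarith+
  have "glides_bounded (n - 2) E"
    unfolding glides_bounded_def
    using redex(2)[OF fr] gauss_word_glide[OF w(2) redex(1) fr] f'(1) n(2) by (auto simp: diag_def)
  then show ?thesis using n(1) by (intro exI[of _ "n - 2"]) simp
qed

lemma word_steps_glide:
  assumes "word_step\<^sup>*\<^sup>* S S'" "gauss_word (fst S) (snd S)"
  shows "glide\<^sup>*\<^sup>* (diag bd (fst S) (snd S)) (diag bd (fst S') (snd S')) \<and> gauss_word (fst S') (snd S')"
  using assms(1)
proof (induction rule: rtranclp_induct)
  case base
  then show ?case using assms(2) by simp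
next
  case (step S1 S2)
  then obtain a b y z where "redex (snd S1) a b" "fresh y z (snd S1)"
    "S2 = (glide_sign (fst S1) a b y z, glide_words (fst S1) a b y z (snd S1))"
    by (auto simp: word_step_def)
  then show ?case
    using step.IH glide_diag[of "fst S1" "snd S1" a b y z bd] gauss_word_glide[of "fst S1" "snd S1" a b y z]
    by (auto intro: rtranclp.rtrancl_into_rtrancl)
qed

lemma join_words:
  assumes "gauss_word s1 W1" "gauss_word s2 W2"
    and "\<exists>S. word_step\<^sup>*\<^sup>* (s1, W1) S \<and> word_step\<^sup>*\<^sup>* (s2, W2) S"
  shows "\<exists>F. glide\<^sup>*\<^sup>* (diag bd s1 W1) F \<and> glide\<^sup>*\<^sup>* (diag bd s2 W2) F"
proof -
  obtain S where S: "word_step\<^sup>*\<^sup>* (s1, W1) S" "word_step\<^sup>*\<^sup>* (s2, W2) S" using assms(3) by blast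
  show ?thesis
    using word_steps_glide[OF S(1), of bd] word_steps_glide[OF S(2), of bd] assms(1,2) by auto
qed

lemma join_critical_diag:
  assumes g: "gauss_word s Ws" and ab: "redex Ws a b" and bc: "redex Ws b c" and ac: "a \<noteq> c"
    and E: "\<And>y z. fresh y z Ws \<Longrightarrow> E = diag bd (glide_sign s a b y z) (glide_words s a b y z Ws)"
    and E': "\<And>y z. fresh y z Ws \<Longrightarrow> E' = diag bd (glide_sign s b c y z) (glide_words s b c y z Ws)"
  shows "\<exists>F. glide\<^sup>*\<^sup>* E F \<and> glide\<^sup>*\<^sup>* E' F"
proof -
  \<comment> \<open>All names from \<open>n\<close> on are fresh; eight of them serve both
    sides.\<close>
  obtain n where n: "\<And>c. c \<in> names Ws \<Longrightarrow> c < n"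
    using finite_names[of Ws] unfolding finite_nat_set_iff_bounded by blast
  define y1 z1 y2 z2 where "y1 = (if s b = 1 then n else n + 1)" and "z1 = (if s b = 1 then n + 1 else n)"
    and "y2 = (if s b = 1 then n + 2 else n + 3)" and "z2 = (if s b = 1 then n + 3 else n + 2)"
  have new: "n + i \<notin> names Ws" for i using n by fastforce
  have f: "fresh y1 z1 Ws" "fresh y2 z2 Ws"
    using new[of 0] new[of 1] new[of 2] new[of 3] by (auto simp: fresh_def y1_def z1_def y2_def z2_def)
  have "a < n" "b < n" "c < n" using redexD[OF g ab] redexD[OF g bc] n by auto
  then have "distinct [a, b, c, n, n + 1, n + 2, n + 3, n + 4, n + 5, n + 6, n + 7]"
    using redexD(1)[OF g ab] redexD(1)[OF g bc] ac by auto
  moreover have "{n, n + 1, n + 2, n + 3, n + 4, n + 5, n + 6, n + 7} \<inter> names Ws = {}"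
    using new[of 0] new[of 1] new[of 2] new[of 3] new[of 4] new[of 5] new[of 6] new[of 7] by simp
  ultimately have "\<exists>S. word_step\<^sup>*\<^sup>* (glide_sign s a b y2 z2, glide_words s a b y2 z2 Ws) S \<and>
      word_step\<^sup>*\<^sup>* (glide_sign s b c y1 z1, glide_words s b c y1 z1 Ws) S"
    using join_critical[OF g, of a b c n "n + 1" "n + 2" "n + 3" "n + 4" "n + 5" "n + 6" "n + 7"] ab bc
    unfolding redex_infix y1_def z1_def y2_def z2_def by blast
  then show ?thesis
    unfolding E[OF f(2)] E'[OF f(1)]
    by (rule join_words[OF gauss_word_glide[OF g ab f(2)] gauss_word_glide[OF g bc f(1)]])
qed

text \<open>Either passage of a redex determines the other, so two redexes are equal, follow each
  other in one order or both, or have no crossing in common.\<close>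

lemma local_confluence:
  assumes D: "gauss_diagram D" "acyclic_diagram D" and E: "glide D E" and E': "glide D E'"
  shows "\<exists>F. glide\<^sup>*\<^sup>* E F \<and> glide\<^sup>*\<^sup>* E' F"
proof -
  let ?bd = "boundary D"
  obtain s Ws where g: "gauss_word s Ws" and w: "D = diag ?bd s Ws"
    using gauss_diagram_word[OF D(1)] by blast
  have ac: "acyclic (chain Ws)" using D(2) acyclic_diag[OF g, of ?bd] w by simp
  have "glide (diag ?bd s Ws) E" "glide (diag ?bd s Ws) E'" using E E' w by simp_all
  then obtain a b c d where ab: "redex Ws a b" and cd: "redex Ws c d"
    and E1: "\<And>y z. fresh y z Ws \<Longrightarrow> E = diag ?bd (glide_sign s a b y z) (glide_words s a b y z Ws)"
    and E2: "\<And>y z. fresh y z Ws \<Longrightarrow> E' = diag ?bd (glide_sign s c d y z) (glide_words s c d y z Ws)"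
    using glide_diagE[OF g] by metis
  note pab = ab[unfolded redex_pos[OF g]] and pcd = cd[unfolded redex_pos[OF g]]
  have eq: "a = c \<longleftrightarrow> b = d"
  proof
    assume "a = c"
    then have "pos Ws (Over b) = pos Ws (Over d)" using pab pcd by simp
    then show "b = d" using pos_eq_iff[OF g, of "Over b" "Over d"] pab pcd set_gauss_word[OF g] by auto
  next
    assume "b = d"
    then have "pos Ws (Under a) = pos Ws (Under c)" using pab pcd by (simp add: prod_eq_iff)
    then show "a = c" using pos_eq_iff[OF g, of "Under a" "Under c"] pab pcd set_gauss_word[OF g] by auto
  qed
  consider "a = c" "b = d" | "b = c" "a = d" | "b = c" "a \<noteq> d" | "b \<noteq> c" "a = d"
    | "a \<noteq> c" "b \<noteq> d" "b \<noteq> c" "a \<noteq> d" using eq by blast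
  then show ?thesis
  proof cases
    case 1
    obtain y z where "fresh y z Ws" using exists_fresh by blast
    then have "E = E'" using E1 E2 1 by simp
    then show ?thesis by blast
  next
    case 2
    \<comment> \<open>Acyclicity excludes the overlap in both orders.\<close>
    then have "(a, b) \<in> chain Ws" "(b, a) \<in> chain Ws" using redexD(4)[OF g] ab cd by auto
    then have "(a, a) \<in> (chain Ws)\<^sup>+" by (meson r_into_trancl trancl_into_trancl)
    then show ?thesis using ac by (auto simp: acyclic_def)
  next
    case 3
    then show ?thesis using join_critical_diag[OF g ab _ 3(2) E1] cd E2 by blast
  next
    case 4
    then have "\<exists>F. glide\<^sup>*\<^sup>* E' F \<and> glide\<^sup>*\<^sup>* E F" using join_critical_diag[OF g cd _ _ E2] ab E1 by metis
    then show ?thesis by blast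
  next
    case 5
    obtain n where n: "\<And>c. c \<in> names Ws \<Longrightarrow> c < n"
      using finite_names[of Ws] unfolding finite_nat_set_iff_bounded by blast
    have new: "n + i \<notin> names Ws" for i using n by fastforce
    have f: "fresh n (n + 1) Ws" "fresh (n + 2) (n + 3) Ws"
      using new[of 0] new[of 1] new[of 2] new[of 3] by (auto simp: fresh_def)
    have "a < n" "b < n" "c < n" "d < n" using redexD[OF g ab] redexD[OF g cd] n by auto
    then have "distinct [a, b, c, d, n, n + 1, n + 2, n + 3]"
      using redexD(1)[OF g ab] redexD(1)[OF g cd] 5 by auto
    moreover have "{n, n + 1, n + 2, n + 3} \<inter> names Ws = {}" using new[of 0] new[of 1] new[of 2] new[of 3] by simp
    ultimately have "\<exists>S. word_step\<^sup>*\<^sup>* (glide_sign s a b n (n + 1), glide_words s a b n (n + 1) Ws) S \<and>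
        word_step\<^sup>*\<^sup>* (glide_sign s c d (n + 2) (n + 3), glide_words s c d (n + 2) (n + 3) Ws) S"
      using join_disjoint[OF g, of a b c d n "n + 1" "n + 2" "n + 3"] ab cd unfolding redex_infix by blast
    then show ?thesis
      unfolding E1[OF f(1)] E2[OF f(2)]
      by (rule join_words[OF gauss_word_glide[OF g ab f(1)] gauss_word_glide[OF g cd f(2)]])
  qed
qed

text \<open>On the way from an under passage to a later over passage, the kind must change from
  under to over between two neighbours.\<close>

lemma before_sublist:
  "before w (Under c) (Over d) \<Longrightarrow> \<exists>a b. sublist [Under a, Over b] w"
proof (induction w arbitrary: c)
  case (Cons t w)
  show ?case
  proof (cases "\<exists>c'. before w (Under c') (Over d)")
    case True
    then show ?thesis using Cons.IH by (meson sublist_Cons_right)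
  next
    case False
    then have t: "t = Under c" "Over d \<in> set w" using Cons.prems by auto
    then obtain t' w' where w: "w = t' # w'" by (cases w) auto
    obtain b where "t' = Over b" using t w False by (cases t') auto
    then have "t # w = [] @ [Under c, Over b] @ w'" using t w by simp
    then show ?thesis unfolding sublist_def by blast
  qed
qed simp

lemma exists_glide:
  assumes "gauss_diagram D" "acyclic_diagram D" "\<not> OU D"
  shows "\<exists>E. glide D E"
proof -
  let ?bd = "boundary D"
  obtain s Ws where g: "gauss_word s Ws" and w: "D = diag ?bd s Ws"
    using gauss_diagram_word[OF assms(1)] by blast
  have ac: "acyclic (chain Ws)" using assms(2) acyclic_diag[OF g, of ?bd] w by simp
  have "chain Ws \<noteq> {}" using assms(3) OU_diag[OF g, of ?bd] w by simp
  then obtain v c d where "v \<in> set Ws" "before v (Under c) (Over d)" by (auto simp: chain_def)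
  then obtain a b where ab: "v \<in> set Ws" "sublist [Under a, Over b] v" using before_sublist by blast
  then have "before v (Under a) (Over b)" by (auto simp: sublist_def before_append)
  then have "(a, b) \<in> chain Ws" using ab by (auto simp: chain_def)
  \<comment> \<open>A curl passed under first is no site of a move; it would be a loop of the chain
    relation.\<close>
  then have "a \<noteq> b" using ac by (auto simp: acyclic_def)
  then have "redex Ws a b" using ab by (auto simp: redex_def)
  moreover obtain y z where "fresh y z Ws" using exists_fresh by blast
  ultimately show ?thesis using glide_diag[OF g, of a b y z ?bd] w by auto
qed

lemma OU_no_glide:
  assumes "gauss_diagram D" "OU D"
  shows "\<not> glide D E"
proof
  assume "glide D E"
  from glideE[OF assms(1) this] show False
  proof cases
    case (1 s Ws a b y z)
    have "chain Ws = {}" using assms(2) OU_diag[OF 1(1), of "boundary D"] 1(2) by simp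
    then show False using redexD(4)[OF 1(1,3)] by simp
  qed
qed

lemma OU_acyclic:
  assumes "gauss_diagram D" "OU D"
  shows "acyclic_diagram D"
proof -
  obtain s Ws where w: "gauss_word s Ws" "D = diag (boundary D) s Ws"
    using gauss_diagram_word[OF assms(1)] by blast
  have "chain Ws = {}" using assms(2) OU_diag[OF w(1), of "boundary D"] w(2) by simp
  then show ?thesis using acyclic_diag[OF w(1), of "boundary D"] w(2) by (simp add: acyclic_def)
qed

lemma glides_preserve:
  assumes "glide\<^sup>*\<^sup>* D E" "gauss_diagram D"
  shows "gauss_diagram E" "acyclic_diagram E \<longleftrightarrow> acyclic_diagram D" "tangle_diagram D \<Longrightarrow> tangle_diagram E"
proof -
  have "gauss_diagram E \<and> (acyclic_diagram E \<longleftrightarrow> acyclic_diagram D) \<and> (tangle_diagram D \<longrightarrow> tangle_diagram E)"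
    using assms(1)
  proof (induction rule: rtranclp_induct)
    case (step F G)
    then show ?case using gauss_glide acyclic_glide tangle_glide by blast
  qed (simp add: assms(2))
  then show "gauss_diagram E" "acyclic_diagram E \<longleftrightarrow> acyclic_diagram D" "tangle_diagram D \<Longrightarrow> tangle_diagram E"
    by auto
qed

lemma OU_reachable:
  assumes "gauss_diagram D" "acyclic_diagram D"
  shows "\<exists>E. glide\<^sup>*\<^sup>* D E \<and> OU E"
proof -
  obtain n where "glides_bounded n D" using acyclic_bounded[OF assms] by blast
  then show ?thesis
    using assms
  proof (induction n arbitrary: D rule: less_induct)
    case (less n)
    show ?case
    proof (cases "OU D")
      case True
      then show ?thesis by blast
    next
      case False
      then obtain E where E: "glide D E" using exists_glide less.prems by blast
      then obtain m where "m < n" "glides_bounded m E" using bounded_glide less.prems(1) by blast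
      then obtain F where "glide\<^sup>*\<^sup>* E F" "OU F"
        using less.IH gauss_glide[OF less.prems(2) E] acyclic_glide[OF less.prems(2) E] less.prems(3) by blast
      then show ?thesis using converse_rtranclp_into_rtranclp[of glide, OF E] by blast
    qed
  qed
qed

text \<open>The induction on the bound carries acyclicity along, on which both termination and local
  confluence rest.\<close>

lemma OU_unique:
  assumes "gauss_diagram D" "acyclic_diagram D"
    and "glide\<^sup>*\<^sup>* D E" "OU E" "glide\<^sup>*\<^sup>* D E'" "OU E'"
  shows "E = E'"
proof -
  obtain n where "glides_bounded n D" using acyclic_bounded[OF assms(1,2)] by blast
  then show ?thesis
    using assms
  proof (induction n arbitrary: D E E' rule: less_induct)
    case (less n)
    note D = less.prems(2,3)
    show ?case
    proof (cases "OU D")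
      case True
      have "F = D" if "glide\<^sup>*\<^sup>* D F" for F
        using that OU_no_glide[OF D(1) True] by (metis converse_rtranclpE)
      then show ?thesis using less.prems(4,6) by blast
    next
      case False
      then obtain F F' where F: "glide D F" "glide\<^sup>*\<^sup>* F E" and F': "glide D F'" "glide\<^sup>*\<^sup>* F' E'"
        using less.prems(4-7) by (metis converse_rtranclpE)
      obtain G where G: "glide\<^sup>*\<^sup>* F G" "glide\<^sup>*\<^sup>* F' G" using local_confluence[OF D F(1) F'(1)] by blast
      have g: "gauss_diagram F" "acyclic_diagram F" "gauss_diagram F'" "acyclic_diagram F'"
        using gauss_glide acyclic_glide D F(1) F'(1) by blast+
      \<comment> \<open>An OU diagram below the common reduct: the induction hypothesis at
        \<open>F\<close> identifies it with \<open>E\<close>, and the one at \<open>F'\<close> with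
        \<open>E'\<close>.\<close>
      obtain H where H: "glide\<^sup>*\<^sup>* G H" "OU H"
        using OU_reachable glides_preserve(1,2)[OF G(1) g(1)] g(2) by blast
      obtain m m' where "m < n" "glides_bounded m F" "m' < n" "glides_bounded m' F'"
        using bounded_glide[OF less.prems(1)] F(1) F'(1) by blast
      then have "E = H" "E' = H"
        using less.IH[of m F E H] less.IH[of m' F' E' H] g F(2) F'(2) less.prems(5,7) H
          rtranclp_trans[OF G(1) H(1)] rtranclp_trans[OF G(2) H(1)] by blast+
      then show ?thesis by simp
    qed
  qed
qed

theorem theorem3p3:
  fixes D :: diagram
  assumes "tangle_diagram D"
  shows "((\<exists>E. glide\<^sup>*\<^sup>* D E \<and> tangle_diagram E \<and> OU E) \<longleftrightarrow> acyclic_diagram D) \<and>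
    (acyclic_diagram D \<longrightarrow> (\<exists>!E. glide\<^sup>*\<^sup>* D E \<and> tangle_diagram E \<and> OU E))"
proof -
  have D: "gauss_diagram D" using assms by (simp add: tangle_diagram_def)
  have ex: "\<exists>E. glide\<^sup>*\<^sup>* D E \<and> tangle_diagram E \<and> OU E" if "acyclic_diagram D"
    using OU_reachable[OF D that] glides_preserve(3)[OF _ D assms] by blast
  \<comment> \<open>An OU diagram has no chains, and acyclicity passes backwards along glide
    moves.\<close>
  moreover have "acyclic_diagram D" if "glide\<^sup>*\<^sup>* D E" "OU E" for E
    using OU_acyclic glides_preserve(1,2)[OF that(1) D] that(2) by blast
  moreover have "\<exists>!E. glide\<^sup>*\<^sup>* D E \<and> tangle_diagram E \<and> OU E" if "acyclic_diagram D"
    using ex[OF that] OU_unique[OF D that] by blast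
  ultimately show ?thesis by blast
qed

end
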